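(* Let $K$ be an algebraically closed field of characteristic zero, let $L=K\{\{t\}\}$, and let $J\unlhd L[x_1,\ldots,x_n]$ be an ideal. Then for every $\omega\in\mathbb{R}^n$: $$\omega\in\operatorname{Trop}(J)\cap\mathbb{Q}^n\quad\Longleftrightarrow\quad \text{there exists } p\in V(J)\text{ with } -\operatorname{val}(p)=\omega\in\mathbb{Q}^n .$$
   Context: For $N\ge 1$ let $R_N=K[[t^{1/N}]]$ and let $L_N$ be its quotient field; if $N\mid M$ then $R_N\subseteq R_M$, $L_N\subseteq L_M$. The field of Puiseux series is $L=K\{\{t\}\}=\bigcup_{N\ge1}L_N$, with valuation $\operatorname{val}$ = lowest exponent of $t$ occurring, $\operatorname{val}(0)=\infty$. For $p=(p_1,\ldots,p_n)\in L^n$, $\operatorname{val}(p)=(\operatorname{val}(p_1),\ldots,\operatorname{val}(p_n))$. $V(J)\subseteq L^n$ is the zero set of $J$. Write $\underline{x}=(x_1,\ldots,x_n)$. For $\omega\in\mathbb{R}^n$ the monomial $t^{\alpha}\underline{x}^\beta$ ($\alpha\in\mathbb{Q}_{\ge0}$, $\beta\in\mathbb{N}^n$) has $(-1,\omega)$-degree $-\alpha+\omega\cdot\beta$. For $0\ne f\in R_N[\underline{x}]$ the degrees of the terms occurring in $f$ have a maximum $\hat q$; $\operatorname{in}_\omega(f)\in K[t^{1/N},\underline{x}]$ is the (finite) sum of all terms of $f$ of degree $\hat q$, and $\operatorname{t-in}_\omega(f)=\operatorname{in}_\omega(f)|_{t=1}\in K[\underline{x}]$. For $f=t^{-\alpha/N}g\in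 L[\underline{x}]$ with $g\in R_N[\underline{x}]$ put $\operatorname{t-in}_\omega(f)=\operatorname{t-in}_\omega(g)$ (well defined); also $\operatorname{t-in}_\omega(0)=0$. For $J\subseteq L[\underline{x}]$, $\operatorname{t-in}_\omega(J)=\langle \operatorname{t-in}_\omega(f)\mid f\in J\rangle\unlhd K[\underline{x}]$. The tropical variety is $\operatorname{Trop}(J)=\{\omega\in\mathbb{R}^n\mid \operatorname{t-in}_\omega(J)\text{ contains no monomial}\}$ (the constant $1$ counts as a monomial). *)

theory Defs
  imports
    "HOL-Analysis.Analysis"
    "HOL-Library.Poly_Mapping"
    "HOL-Computational_Algebra.Formal_Laurent_Series"
begin

section \<open>Puiseux series\<close>

text \<open>
  A pair \<open>(N, f)\<close> with \<open>N > 0\<close> represents \<open>f(t\<^sup>1\<^sup>/\<^sup>N)\<close>, an element of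
  \<open>L\<^sub>N = Quot K[[t\<^sup>1\<^sup>/\<^sup>N]]\<close>. The inclusion of \<open>L\<^sub>N\<close> into \<open>L\<^sub>N\<^sub>M\<close> is substitution of the
  \<open>M\<close>-th power of the variable, so the union of the \<open>L\<^sub>N\<close> is the quotient below.
\<close>

definition puiseux_rel :: "nat \<times> 'a::zero fls \<Rightarrow> nat \<times> 'a fls \<Rightarrow> bool" where
  "puiseux_rel a b \<longleftrightarrow> fst a > 0 \<and> fst b > 0 \<and>
     fls_compose_power (snd a) (fst b) = fls_compose_power (snd b) (fst a)"

lemma fls_compose_power_compose_power:
  assumes "a > 0" "b > 0"
  shows "fls_compose_power (fls_compose_power f a) b = fls_compose_power f (a * b)"
proof (rule fls_eqI)
  fix n :: int
  show "fls_nth (fls_compose_power (fls_compose_power f a) b) n = fls_nth (fls_compose_power f (a * b)) n"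
  proof (cases "int b dvd n")
    case True
    then obtain k where k: "n = int b * k" by auto
    have "int a * int b dvd n \<longleftrightarrow> int a dvd k"
      using assms by (simp add: k mult.commute)
    moreover have "n div int b = k" using assms by (simp add: k)
    moreover have "n div (int a * int b) = k div int a"
      using assms by (simp add: k mult.commute)
    ultimately show ?thesis using assms True by (simp add: fls_nth_compose_power)
  next
    case False
    then have "\<not> int a * int b dvd n" by (meson dvd_mult_right)
    with False assms show ?thesis by (simp add: fls_nth_compose_power)
  qed
qed

lemma fls_compose_power_inject:
  assumes "d > 0" "fls_compose_power f d = fls_compose_power g d"
  shows "f = g"
proof (rule fls_eqI)
  fix n
  have "fls_nth (fls_compose_power f d) (int d * n) = fls_nth (fls_compose_power g d) (int d * n)"
    by (simp only: assms(2))
  then show "fls_nth f n = fls_nth g n"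
    using assms(1) by (simp add: fls_nth_compose_power)
qed

lemma puiseux_rel_trans:
  assumes "puiseux_rel a b" "puiseux_rel b c"
  shows "puiseux_rel a c"
proof -
  obtain A f where a: "a = (A, f)" by force
  obtain B g where b: "b = (B, g)" by force
  obtain C h where c: "c = (C, h)" by force
  from assms have pos: "A > 0" "B > 0" "C > 0"
    and e1: "fls_compose_power f B = fls_compose_power g A"
    and e2: "fls_compose_power g C = fls_compose_power h B"
    by (auto simp: puiseux_rel_def a b c)
  have "fls_compose_power (fls_compose_power f C) B = fls_compose_power (fls_compose_power f B) C"
    using pos by (simp add: fls_compose_power_compose_power mult.commute)
  also have "\<dots> = fls_compose_power (fls_compose_power g C) A"
    unfolding e1 using pos by (simp add: fls_compose_power_compose_power mult.commute)
  also have "\<dots> = fls_compose_power (fls_compose_power h A) B"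
    unfolding e2 using pos by (simp add: fls_compose_power_compose_power mult.commute)
  finally have "fls_compose_power f C = fls_compose_power h A"
    using fls_compose_power_inject pos by blast
  then show ?thesis using pos by (simp add: puiseux_rel_def a c)
qed

quotient_type (overloaded) 'a puiseux = "nat \<times> 'a::zero fls" / partial: puiseux_rel
proof (rule part_equivpI)
  show "\<exists>x::nat \<times> 'a fls. puiseux_rel x x"
    by (rule exI[of _ "(1, 0)"]) (simp add: puiseux_rel_def)
  show "symp (puiseux_rel :: nat \<times> 'a fls \<Rightarrow> _)"
    by (auto simp: symp_def puiseux_rel_def)
  show "transp (puiseux_rel :: nat \<times> 'a fls \<Rightarrow> _)"
    by (auto simp: transp_def intro: puiseux_rel_trans)
qed

lemma fls_compose_power_inverse:
  fixes f :: "'a::field fls"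
  assumes "d > 0"
  shows "fls_compose_power (inverse f) d = inverse (fls_compose_power f d)"
proof (cases "f = 0")
  case False
  have "fls_compose_power f d * fls_compose_power (inverse f) d = fls_compose_power (f * inverse f) d"
    by simp
  also have "\<dots> = 1" using False assms by simp
  finally show ?thesis by (metis inverse_unique)
qed simp

lemma puiseux_rel_cross:
  assumes "fls_compose_power f A' = fls_compose_power f' A" "A > 0" "A' > 0" "B > 0" "B' > 0"
  shows "fls_compose_power (fls_compose_power f B) (A' * B') =
         fls_compose_power (fls_compose_power f' B') (A * B)"
proof -
  have "fls_compose_power (fls_compose_power f B) (A' * B') =
        fls_compose_power (fls_compose_power f A') (B * B')"
    using assms(2-) by (simp add: fls_compose_power_compose_power mult_ac)
  also have "\<dots> = fls_compose_power (fls_compose_power f' B') (A * B)"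
    unfolding assms(1) using assms(2-) by (simp add: fls_compose_power_compose_power mult_ac)
  finally show ?thesis .
qed

lemma puiseux_rel_cross':
  assumes "fls_compose_power g B' = fls_compose_power g' B" "A > 0" "A' > 0" "B > 0" "B' > 0"
  shows "fls_compose_power (fls_compose_power g A) (A' * B') =
         fls_compose_power (fls_compose_power g' A') (A * B)"
  using puiseux_rel_cross[of g B' g' B A A'] assms by (simp add: mult.commute)

instantiation puiseux :: (field) field
begin

lift_definition zero_puiseux :: "'a puiseux" is "(1, 0)"
  by (simp add: puiseux_rel_def)

lift_definition one_puiseux :: "'a puiseux" is "(1, 1)"
  by (simp add: puiseux_rel_def)

lift_definition plus_puiseux :: "'a puiseux \<Rightarrow> 'a puiseux \<Rightarrow> 'a puiseux" is
  "\<lambda>a b. (fst a * fst b, fls_compose_power (snd a) (fst b) + fls_compose_power (snd b) (fst a))"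
  by (auto simp: puiseux_rel_def
      intro!: arg_cong2[where f = "plus"] puiseux_rel_cross puiseux_rel_cross')

lift_definition times_puiseux :: "'a puiseux \<Rightarrow> 'a puiseux \<Rightarrow> 'a puiseux" is
  "\<lambda>a b. (fst a * fst b, fls_compose_power (snd a) (fst b) * fls_compose_power (snd b) (fst a))"
  by (auto simp: puiseux_rel_def
      intro!: arg_cong2[where f = "times"] puiseux_rel_cross puiseux_rel_cross')

lift_definition uminus_puiseux :: "'a puiseux \<Rightarrow> 'a puiseux" is "\<lambda>a. (fst a, - snd a)"
  by (auto simp: puiseux_rel_def)

lift_definition inverse_puiseux :: "'a puiseux \<Rightarrow> 'a puiseux" is "\<lambda>a. (fst a, inverse (snd a))"
  by (auto simp: puiseux_rel_def fls_compose_power_inverse)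

definition minus_puiseux :: "'a puiseux \<Rightarrow> 'a puiseux \<Rightarrow> 'a puiseux" where
  "minus_puiseux a b = a + - b"

definition divide_puiseux :: "'a puiseux \<Rightarrow> 'a puiseux \<Rightarrow> 'a puiseux" where
  "divide_puiseux a b = a * inverse b"

instance
proof
  fix a b c :: "'a puiseux"
  show "a + b + c = a + (b + c)"
    by transfer (auto simp: puiseux_rel_def fls_compose_power_compose_power algebra_simps)
  show "a + b = b + a"
    by transfer (auto simp: puiseux_rel_def fls_compose_power_compose_power algebra_simps)
  show "0 + a = a"
    by transfer (auto simp: puiseux_rel_def fls_compose_power_compose_power)
  show "- a + a = 0"
    by transfer (auto simp: puiseux_rel_def fls_compose_power_compose_power)
  show "a - b = a + - b" by (simp add: minus_puiseux_def)
  show "a * b * c = a * (b * c)"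
    by transfer (auto simp: puiseux_rel_def fls_compose_power_compose_power algebra_simps)
  show "a * b = b * a"
    by transfer (auto simp: puiseux_rel_def fls_compose_power_compose_power algebra_simps)
  show "1 * a = a"
    by transfer (auto simp: puiseux_rel_def fls_compose_power_compose_power)
  show "(a + b) * c = a * c + b * c"
    by transfer (auto simp: puiseux_rel_def fls_compose_power_compose_power algebra_simps)
  show "(0::'a puiseux) \<noteq> 1"
    by transfer (auto simp: puiseux_rel_def)
  show "a div b = a * inverse b" by (simp add: divide_puiseux_def)
  show "inverse (0::'a puiseux) = 0"
    by transfer (auto simp: puiseux_rel_def)
  assume "a \<noteq> 0"
  then show "inverse a * a = 1"
  proof transfer
    fix a :: "nat \<times> 'a fls"
    assume a: "puiseux_rel a a" "\<not> puiseux_rel a (1, 0)"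
    obtain N f where Nf: "a = (N, f)" by force
    have N: "N > 0" and f: "f \<noteq> 0"
      using a by (auto simp: puiseux_rel_def Nf)
    have "fls_compose_power f N \<noteq> 0"
      using fls_compose_power_inject[of N f 0] N f by auto
    then show "puiseux_rel (fst (fst a, inverse (snd a)) * fst a,
        fls_compose_power (snd (fst a, inverse (snd a))) (fst a) *
        fls_compose_power (snd a) (fst (fst a, inverse (snd a)))) (1, 1)"
      using N f by (simp add: puiseux_rel_def Nf fls_compose_power_inverse
          flip: fls_compose_power_mult)
  qed
qed

end

text \<open>The coefficient of \<open>t\<^sup>q\<close>.\<close>

definition raw_nth :: "nat \<times> 'a::zero fls \<Rightarrow> rat \<Rightarrow> 'a" where
  "raw_nth a q = (if of_nat (fst a) * q \<in> \<int> then fls_nth (snd a) \<lfloor>of_nat (fst a) * q\<rfloor> else 0)"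

lemma raw_nth_refine:
  assumes "N > 0" "M > 0"
  shows "raw_nth (N * M, fls_compose_power f M) q = raw_nth (N, f) q"
proof (cases "of_nat (N * M) * q \<in> \<int>")
  case True
  then obtain k where k: "of_nat (N * M) * q = of_int k" by (elim Ints_cases)
  have Nq: "of_nat N * q = of_int k / of_nat M"
    using assms k by (simp add: field_simps)
  show ?thesis
  proof (cases "int M dvd k")
    case True
    then obtain j where j: "k = int M * j" by auto
    have "of_nat N * q = of_int j" using Nq assms by (simp add: j)
    moreover have "of_nat (N * M) * q = of_int (int M * j)" using k j by simp
    ultimately show ?thesis using assms
      by (simp add: raw_nth_def fls_nth_compose_power del: of_nat_mult of_int_mult)
  next
    case False
    have "of_nat N * q \<notin> \<int>"
    proof
      assume "of_nat N * q \<in> \<int>"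
      then obtain j where "of_nat N * q = of_int j" by (elim Ints_cases)
      with k have "(of_int k :: rat) = of_int (int M * j)"
        using \<open>of_nat N * q = of_int j\<close> by (simp add: mult_ac flip: k)
      then have "k = int M * j" by (simp only: of_int_eq_iff)
      with False show False by simp
    qed
    with k False show ?thesis using assms by (simp add: raw_nth_def fls_nth_compose_power del: of_nat_mult)
  qed
next
  case False
  have "of_nat N * q \<notin> \<int>"
  proof
    assume "of_nat N * q \<in> \<int>"
    then have "of_nat M * (of_nat N * q) \<in> \<int>" by (rule Ints_mult[OF Ints_of_nat])
    with False show False by (simp add: mult_ac)
  qed
  with False show ?thesis by (simp add: raw_nth_def)
qed

lemma raw_nth_eq_iff:
  assumes "N > 0"
  shows "raw_nth (N, f) = raw_nth (N, g) \<longleftrightarrow> f = g"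
proof
  assume *: "raw_nth (N, f) = raw_nth (N, g)"
  show "f = g"
  proof (rule fls_eqI)
    fix n
    show "fls_nth f n = fls_nth g n"
      using fun_cong[OF *, of "of_int n / of_nat N"] assms by (simp add: raw_nth_def)
  qed
qed simp

lemma puiseux_rel_iff_raw_nth:
  assumes "fst a > 0" "fst b > 0"
  shows "puiseux_rel a b \<longleftrightarrow> raw_nth a = raw_nth b"
proof -
  obtain N f where a: "a = (N, f)" by force
  obtain M g where b: "b = (M, g)" by force
  have pos: "N > 0" "M > 0" using assms by (auto simp: a b)
  have "raw_nth a = raw_nth (N * M, fls_compose_power f M)"
    using pos by (auto simp: a raw_nth_refine)
  moreover have "raw_nth b = raw_nth (N * M, fls_compose_power g N)"
    using pos raw_nth_refine[of M N g] by (auto simp: b mult.commute)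
  ultimately show ?thesis
    using pos by (simp add: raw_nth_eq_iff puiseux_rel_def a b)
qed

lift_definition puiseux_nth :: "'a::field puiseux \<Rightarrow> rat \<Rightarrow> 'a" is raw_nth
  using puiseux_rel_iff_raw_nth unfolding puiseux_rel_def by blast

lemma puiseux_eqI:
  assumes "\<And>q. puiseux_nth a q = puiseux_nth b q"
  shows "a = b"
proof -
  have "puiseux_nth a = puiseux_nth b" using assms by blast
  then show ?thesis
  proof transfer
    fix a b :: "nat \<times> 'a fls"
    assume "puiseux_rel a a" "puiseux_rel b b" "raw_nth a = raw_nth b"
    then show "puiseux_rel a b"
      by (subst puiseux_rel_iff_raw_nth) (auto simp: puiseux_rel_def)
  qed
qed

lemma puiseux_nth_zero [simp]: "puiseux_nth 0 q = 0"
  by transfer (simp add: raw_nth_def)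

lemma puiseux_support:
  fixes a :: "'a::field puiseux"
  obtains N k where "N > 0"
    "\<And>q. puiseux_nth a q \<noteq> 0 \<Longrightarrow> \<exists>i\<ge>k. q = of_int i / of_nat N"
proof -
  have "\<exists>N>0. \<exists>k. \<forall>q. puiseux_nth a q \<noteq> 0 \<longrightarrow> (\<exists>i\<ge>k. q = of_int i / of_nat N)"
  proof transfer
    fix a :: "nat \<times> 'a fls"
    assume a: "puiseux_rel a a"
    obtain N f where Nf: "a = (N, f)" by force
    have N: "N > 0" using a by (simp add: puiseux_rel_def Nf)
    have "\<exists>i\<ge>fls_subdegree f. q = of_int i / of_nat N" if q: "raw_nth a q \<noteq> 0" for q
    proof -
      have "of_nat N * q \<in> \<int>" using q by (auto simp: raw_nth_def Nf split: if_splits)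
      then obtain i where i: "of_nat N * q = of_int i" by (elim Ints_cases)
      then have "fls_nth f i \<noteq> 0" using q by (auto simp: raw_nth_def Nf)
      then have "i \<ge> fls_subdegree f" by (meson fls_subdegree_leI)
      then show ?thesis using i N by (intro exI[of _ i]) (simp add: field_simps)
    qed
    with N show "\<exists>N>0. \<exists>k. \<forall>q. raw_nth a q \<noteq> 0 \<longrightarrow> (\<exists>i\<ge>k. q = of_int i / of_nat N)"
      unfolding Nf by blast
  qed
  then show ?thesis using that by blast
qed

lemma puiseux_least_exponent:
  fixes a :: "'a::field puiseux"
  assumes "a \<noteq> 0"
  obtains m where "puiseux_nth a m \<noteq> 0" "\<And>q. puiseux_nth a q \<noteq> 0 \<Longrightarrow> m \<le> q"
proof -
  obtain N k where N: "N > 0"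
    and supp: "\<And>q. puiseux_nth a q \<noteq> 0 \<Longrightarrow> \<exists>i\<ge>k. q = of_int i / of_nat N"
    using puiseux_support[of a] by metis
  let ?P = "\<lambda>j. puiseux_nth a (of_int (k + int j) / of_nat N) \<noteq> 0"
  have rep: "\<exists>j. ?P j \<and> q = of_int (k + int j) / of_nat N" if q: "puiseux_nth a q \<noteq> 0" for q
  proof -
    obtain i where "i \<ge> k" "q = of_int i / of_nat N" using supp[OF q] by blast
    then show ?thesis using q by (intro exI[of _ "nat (i - k)"]) simp
  qed
  obtain q0 where "puiseux_nth a q0 \<noteq> 0"
    using assms puiseux_eqI[of a 0] by auto
  then obtain j0 where "?P j0" using rep by blast
  define j where "j = (LEAST j. ?P j)"
  have j: "?P j" unfolding j_def by (rule LeastI) (rule \<open>?P j0\<close>)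
  show ?thesis
  proof (rule that[OF j])
    fix q assume "puiseux_nth a q \<noteq> 0"
    then obtain i where i: "?P i" "q = of_int (k + int i) / of_nat N" using rep by blast
    have "j \<le> i" unfolding j_def by (rule Least_le) (rule i)
    then show "of_int (k + int j) / of_nat N \<le> q"
      unfolding i using N by (intro divide_right_mono) auto
  qed
qed

text \<open>Rational powers of \<open>t\<close>.\<close>

lift_definition tpow :: "rat \<Rightarrow> 'a::field puiseux" is
  "\<lambda>r. (nat (snd (quotient_of r)), fls_X_intpow (fst (quotient_of r)))"
  by (simp add: puiseux_rel_def quotient_of_denom_pos')

lemma puiseux_nth_tpow_times:
  "puiseux_nth (tpow r * a) q = puiseux_nth a (q - r)"
proof transfer
  fix r q :: rat and a :: "nat \<times> 'a fls"
  assume a: "puiseux_rel a a"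
  obtain N f where Nf: "a = (N, f)" by force
  obtain u v where uv: "quotient_of r = (u, v)" by force
  have N: "N > 0" using a by (simp add: puiseux_rel_def Nf)
  have v: "v > 0" using quotient_of_denom_pos[OF uv] .
  define D where "D = nat v"
  have D: "D > 0" "v = int D" using v by (auto simp: D_def)
  have r: "r = of_int u / of_nat D" using quotient_of_div[OF uv] D by simp
  have shift: "of_nat (N * D) * (q - r) = of_nat (N * D) * q - of_int (int N * u)"
    using D(1) by (simp add: r field_simps)
  have int: "of_nat (N * D) * (q - r) \<in> \<int> \<longleftrightarrow> of_nat (N * D) * q \<in> \<int>"
    unfolding shift by (metis Ints_add Ints_diff Ints_of_int diff_add_cancel)
  have "raw_nth a (q - r) = raw_nth (N * D, fls_compose_power f D) (q - r)"
    using N D by (simp add: raw_nth_refine Nf)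
  also have "\<dots> = raw_nth (D * N, fls_X_intpow (int N * u) * fls_compose_power f D) q"
    using int unfolding raw_nth_def fst_conv snd_conv shift
    by (auto simp: fls_X_intpow_times_conv_shift mult.commute[of D N] simp flip: of_nat_mult of_int_mult)
  finally show "raw_nth
      (fst (nat (snd (quotient_of r)), fls_X_intpow (fst (quotient_of r))) * fst a,
       fls_compose_power (snd (nat (snd (quotient_of r)), fls_X_intpow (fst (quotient_of r)))) (fst a) *
       fls_compose_power (snd a) (fst (nat (snd (quotient_of r)), fls_X_intpow (fst (quotient_of r))))) q
     = raw_nth a (q - r)"
    using N by (simp add: Nf uv D)
qed

lemma puiseux_nth_one: "puiseux_nth 1 q = (if q = 0 then 1 else 0)"
  by transfer (auto simp: raw_nth_def elim!: Ints_cases)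

lemma puiseux_nth_tpow: "puiseux_nth (tpow r) q = (if q = r then 1 else 0)"
  using puiseux_nth_tpow_times[of r 1 q] by (simp add: puiseux_nth_one)

lemma tpow_add: "tpow r * tpow s = tpow (r + s)"
  by (rule puiseux_eqI) (auto simp: puiseux_nth_tpow_times puiseux_nth_tpow)

lemma tpow_0 [simp]: "tpow 0 = 1"
  by (rule puiseux_eqI) (simp add: puiseux_nth_one puiseux_nth_tpow)

text \<open>\<open>R\<^sub>N = K[[t\<^sup>1\<^sup>/\<^sup>N]]\<close> as a subring of the Puiseux series.\<close>

definition puiseux_R :: "nat \<Rightarrow> 'a::field puiseux set" where
  "puiseux_R N = {a. \<forall>q. puiseux_nth a q \<noteq> 0 \<longrightarrow> (\<exists>i::nat. q = of_nat i / of_nat N)}"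

text \<open>For \<open>a \<noteq> 0\<close> the least exponent exists by \<open>puiseux_least_exponent\<close>.\<close>

definition pval :: "'a::field puiseux \<Rightarrow> ereal" where
  "pval a = (if a = 0 then \<infinity> else ereal (of_rat (LEAST q. puiseux_nth a q \<noteq> 0)))"


section \<open>Polynomials\<close>

text \<open>
  Polynomials over \<open>'a\<close> in variables indexed by the finite type \<open>'n\<close>, so that \<open>n = CARD('n)\<close>;
  an exponent vector is an element of \<open>'n \<Rightarrow>\<^sub>0 nat\<close>.
\<close>

type_synonym ('n, 'a) mpoly = "('n \<Rightarrow>\<^sub>0 nat) \<Rightarrow>\<^sub>0 'a"

abbreviation monom_x :: "('n \<Rightarrow>\<^sub>0 nat) \<Rightarrow> ('n, 'a::{zero, one}) mpoly" where
  "monom_x \<beta> \<equiv> Poly_Mapping.single \<beta> 1"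

definition mpoly_eval :: "('n::finite, 'a::comm_semiring_1) mpoly \<Rightarrow> 'a ^ 'n \<Rightarrow> 'a" where
  "mpoly_eval f p = (\<Sum>\<beta>\<in>Poly_Mapping.keys f.
     Poly_Mapping.lookup f \<beta> * (\<Prod>i\<in>UNIV. (p $ i) ^ Poly_Mapping.lookup \<beta> i))"

lemma module_times: "module ((*) :: 'a::comm_ring_1 \<Rightarrow> 'a \<Rightarrow> 'a)"
  by standard (simp_all add: algebra_simps)

text \<open>Ideals are the submodules of a commutative ring regarded as a module over itself.\<close>

abbreviation is_ideal :: "'a::comm_ring_1 set \<Rightarrow> bool" where
  "is_ideal \<equiv> module.subspace (*)"

abbreviation ideal_generated_by :: "'a::comm_ring_1 set \<Rightarrow> 'a set" where
  "ideal_generated_by \<equiv> module.span (*)"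

definition zero_set :: "('n::finite, 'a::comm_ring_1) mpoly set \<Rightarrow> ('a ^ 'n) set" where
  "zero_set J = {p. \<forall>f\<in>J. mpoly_eval f p = 0}"


section \<open>Initial forms and tropical varieties\<close>

text \<open>
  The pair \<open>(\<alpha>, \<beta>)\<close> stands for the monomial \<open>t\<^sup>\<alpha> x\<^sup>\<beta>\<close>, and \<open>K[t\<^sup>1\<^sup>/\<^sup>N, x]\<close> is viewed inside
  the finitely supported functions \<open>rat \<times> ('n \<Rightarrow>\<^sub>0 nat) \<Rightarrow>\<^sub>0 'a\<close>.
\<close>

definition wdeg :: "real ^ 'n \<Rightarrow> rat \<times> ('n::finite \<Rightarrow>\<^sub>0 nat) \<Rightarrow> real" where
  "wdeg \<omega> = (\<lambda>(\<alpha>, \<beta>). - of_rat \<alpha> + (\<Sum>i\<in>UNIV. \<omega> $ i * real (Poly_Mapping.lookup \<beta> i)))"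

definition term_coeff :: "('n, 'a::field puiseux) mpoly \<Rightarrow> rat \<times> ('n \<Rightarrow>\<^sub>0 nat) \<Rightarrow> 'a" where
  "term_coeff f = (\<lambda>(\<alpha>, \<beta>). puiseux_nth (Poly_Mapping.lookup f \<beta>) \<alpha>)"

definition terms :: "('n, 'a::field puiseux) mpoly \<Rightarrow> (rat \<times> ('n \<Rightarrow>\<^sub>0 nat)) set" where
  "terms f = {\<tau>. term_coeff f \<tau> \<noteq> 0}"

definition top_terms :: "real ^ 'n \<Rightarrow> ('n::finite, 'a::field puiseux) mpoly \<Rightarrow> (rat \<times> ('n \<Rightarrow>\<^sub>0 nat)) set" where
  "top_terms \<omega> f = {\<tau> \<in> terms f. \<forall>\<sigma>\<in>terms f. wdeg \<omega> \<sigma> \<le> wdeg \<omega> \<tau>}"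

definition in_form :: "real ^ 'n \<Rightarrow> ('n::finite, 'a::field puiseux) mpoly \<Rightarrow> rat \<times> ('n \<Rightarrow>\<^sub>0 nat) \<Rightarrow>\<^sub>0 'a" where
  "in_form \<omega> f = (\<Sum>\<tau>\<in>top_terms \<omega> f. Poly_Mapping.single \<tau> (term_coeff f \<tau>))"

definition set_t_1 :: "(rat \<times> ('n \<Rightarrow>\<^sub>0 nat) \<Rightarrow>\<^sub>0 'a::comm_monoid_add) \<Rightarrow> ('n, 'a) mpoly" where
  "set_t_1 h = (\<Sum>\<tau>\<in>Poly_Mapping.keys h. Poly_Mapping.single (snd \<tau>) (Poly_Mapping.lookup h \<tau>))"

definition R_poly :: "nat \<Rightarrow> ('n, 'a::field puiseux) mpoly set" where
  "R_poly N = {g. \<forall>\<beta>. Poly_Mapping.lookup g \<beta> \<in> puiseux_R N}"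

definition const_poly :: "'a::zero \<Rightarrow> ('n, 'a) mpoly" where
  "const_poly c = Poly_Mapping.single 0 c"

definition t_in :: "real ^ 'n \<Rightarrow> ('n::finite, 'a::field puiseux) mpoly \<Rightarrow> ('n, 'a) mpoly" where
  "t_in \<omega> f = (if f = 0 then 0 else
     (THE h. \<exists>N \<alpha> g. N > 0 \<and> g \<in> R_poly N \<and>
        f = const_poly (tpow (- (of_nat \<alpha> / of_nat N))) * g \<and> h = set_t_1 (in_form \<omega> g)))"

text \<open>
  The value of \<open>t_in\<close> does not depend on the chosen \<open>N\<close>, \<open>\<alpha>\<close> and \<open>g\<close>, which always exist; it is
  given by the same formula as over \<open>R\<^sub>N\<close>.
\<close>

lemma lookup_const_poly_times [simp]:
  "Poly_Mapping.lookup (const_poly c * g) \<beta> = c * Poly_Mapping.lookup (g :: ('n, 'a::field puiseux) mpoly) \<beta>"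
  unfolding const_poly_def by (simp flip: mult_map_scale_conv_mult add: map.rep_eq when_def)

lemma finite_top_terms: "finite (top_terms \<omega> f)"
proof (rule finite_imageD)
  have "snd ` top_terms \<omega> f \<subseteq> Poly_Mapping.keys f"
    by (auto simp: top_terms_def terms_def term_coeff_def in_keys_iff)
  then show "finite (snd ` top_terms \<omega> f)" by (rule finite_subset) simp
  show "inj_on snd (top_terms \<omega> f)"
  proof (rule inj_onI)
    fix \<sigma> \<tau> assume *: "\<sigma> \<in> top_terms \<omega> f" "\<tau> \<in> top_terms \<omega> f" "snd \<sigma> = snd \<tau>"
    then have "wdeg \<omega> \<sigma> = wdeg \<omega> \<tau>"
      by (auto simp: top_terms_def intro: antisym)
    with * show "\<sigma> = \<tau>" by (auto simp: wdeg_def split: prod.splits)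
  qed
qed

lemma top_terms_nonempty:
  assumes "f \<noteq> 0"
  shows "top_terms \<omega> f \<noteq> {}"
proof -
  let ?K = "Poly_Mapping.keys f"
  have "\<forall>\<beta>\<in>?K. \<exists>m. puiseux_nth (Poly_Mapping.lookup f \<beta>) m \<noteq> 0 \<and>
      (\<forall>q. puiseux_nth (Poly_Mapping.lookup f \<beta>) q \<noteq> 0 \<longrightarrow> m \<le> q)"
    by (metis in_keys_iff puiseux_least_exponent)
  then obtain m where m: "\<And>\<beta>. \<beta> \<in> ?K \<Longrightarrow> puiseux_nth (Poly_Mapping.lookup f \<beta>) (m \<beta>) \<noteq> 0"
    "\<And>\<beta> q. \<beta> \<in> ?K \<Longrightarrow> puiseux_nth (Poly_Mapping.lookup f \<beta>) q \<noteq> 0 \<Longrightarrow> m \<beta> \<le> q"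
    by metis
  have K: "finite ?K" "?K \<noteq> {}" using assms by auto
  obtain \<beta> where \<beta>: "\<beta> \<in> ?K" "\<And>\<gamma>. \<gamma> \<in> ?K \<Longrightarrow> wdeg \<omega> (m \<gamma>, \<gamma>) \<le> wdeg \<omega> (m \<beta>, \<beta>)"
  proof -
    have "Max ((\<lambda>\<gamma>. wdeg \<omega> (m \<gamma>, \<gamma>)) ` ?K) \<in> (\<lambda>\<gamma>. wdeg \<omega> (m \<gamma>, \<gamma>)) ` ?K"
      using K by (intro Max_in) auto
    then obtain \<beta> where "\<beta> \<in> ?K" "Max ((\<lambda>\<gamma>. wdeg \<omega> (m \<gamma>, \<gamma>)) ` ?K) = wdeg \<omega> (m \<beta>, \<beta>)" by blast
    then show ?thesis using K by (intro that[of \<beta>]) (auto dest: sym)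
  qed
  have "(m \<beta>, \<beta>) \<in> top_terms \<omega> f"
    unfolding top_terms_def
  proof (intro CollectI conjI ballI)
    show "(m \<beta>, \<beta>) \<in> terms f" using m \<beta> by (simp add: terms_def term_coeff_def)
    fix \<sigma> assume "\<sigma> \<in> terms f"
    then obtain q \<gamma> where \<sigma>: "\<sigma> = (q, \<gamma>)" "puiseux_nth (Poly_Mapping.lookup f \<gamma>) q \<noteq> 0"
      by (cases \<sigma>) (auto simp: terms_def term_coeff_def)
    then have \<gamma>: "\<gamma> \<in> ?K" by (auto simp: in_keys_iff)
    with \<sigma> m have "m \<gamma> \<le> q" by blast
    then have "wdeg \<omega> \<sigma> \<le> wdeg \<omega> (m \<gamma>, \<gamma>)" by (simp add: \<sigma> wdeg_def of_rat_less_eq)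
    also have "\<dots> \<le> wdeg \<omega> (m \<beta>, \<beta>)" using \<beta> \<gamma> by blast
    finally show "wdeg \<omega> \<sigma> \<le> wdeg \<omega> (m \<beta>, \<beta>)" .
  qed
  then show ?thesis by blast
qed

lemma lookup_in_form:
  "Poly_Mapping.lookup (in_form \<omega> f) \<tau> = (if \<tau> \<in> top_terms \<omega> f then term_coeff f \<tau> else 0)"
proof -
  have "Poly_Mapping.lookup (in_form \<omega> f) \<tau> =
      (\<Sum>\<sigma>\<in>top_terms \<omega> f. if \<sigma> = \<tau> then term_coeff f \<tau> else 0)"
    by (auto simp: in_form_def lookup_sum lookup_single when_def intro!: sum.cong)
  then show ?thesis by (simp add: finite_top_terms)
qed

lemma set_t_1_in_form:
  "set_t_1 (in_form \<omega> f) = (\<Sum>\<tau>\<in>top_terms \<omega> f. Poly_Mapping.single (snd \<tau>) (term_coeff f \<tau>))"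
proof -
  have "Poly_Mapping.keys (in_form \<omega> f) = top_terms \<omega> f"
    by (force simp: in_keys_iff lookup_in_form top_terms_def terms_def split: if_splits)
  then show ?thesis by (auto simp: set_t_1_def lookup_in_form intro!: sum.cong)
qed

lemma set_t_1_in_form_tpow:
  "set_t_1 (in_form \<omega> (const_poly (tpow r) * g)) = set_t_1 (in_form \<omega> g)"
proof -
  define s :: "rat \<times> ('a \<Rightarrow>\<^sub>0 nat) \<Rightarrow> rat \<times> ('a \<Rightarrow>\<^sub>0 nat)" where "s = (\<lambda>(\<alpha>, \<beta>). (\<alpha> + r, \<beta>))"
  have coeff: "term_coeff (const_poly (tpow r) * g) (s \<tau>) = term_coeff g \<tau>" for \<tau>
    by (cases \<tau>) (simp add: s_def term_coeff_def puiseux_nth_tpow_times)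
  have deg: "wdeg \<omega> (s \<tau>) = wdeg \<omega> \<tau> - of_rat r" for \<tau>
    by (cases \<tau>) (simp add: s_def wdeg_def of_rat_add)
  have surj: "\<exists>\<tau>. \<sigma> = s \<tau>" for \<sigma>
    by (cases \<sigma>) (auto simp: s_def intro!: exI[of _ "fst \<sigma> - r"])
  have inj: "inj_on s A" for A
    by (auto simp: inj_on_def s_def)
  have mem: "s \<tau> \<in> terms (const_poly (tpow r) * g) \<longleftrightarrow> \<tau> \<in> terms g" for \<tau>
    by (simp add: terms_def coeff)
  have top: "s \<tau> \<in> top_terms \<omega> (const_poly (tpow r) * g) \<longleftrightarrow> \<tau> \<in> top_terms \<omega> g" for \<tau>
  proof -
    have "(\<forall>\<sigma>\<in>terms (const_poly (tpow r) * g). wdeg \<omega> \<sigma> \<le> wdeg \<omega> (s \<tau>)) \<longleftrightarrow>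
        (\<forall>\<sigma>\<in>terms g. wdeg \<omega> (s \<sigma>) \<le> wdeg \<omega> (s \<tau>))"
    proof (intro iffI ballI)
      fix \<sigma> assume *: "\<forall>\<sigma>\<in>terms (const_poly (tpow r) * g). wdeg \<omega> \<sigma> \<le> wdeg \<omega> (s \<tau>)"
        and "\<sigma> \<in> terms g"
      then have "s \<sigma> \<in> terms (const_poly (tpow r) * g)" by (simp add: mem)
      with * show "wdeg \<omega> (s \<sigma>) \<le> wdeg \<omega> (s \<tau>)" by blast
    next
      fix \<rho> assume *: "\<forall>\<sigma>\<in>terms g. wdeg \<omega> (s \<sigma>) \<le> wdeg \<omega> (s \<tau>)"
        and \<rho>: "\<rho> \<in> terms (const_poly (tpow r) * g)"
      obtain \<sigma> where "\<rho> = s \<sigma>" using surj by blast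
      with * \<rho> show "wdeg \<omega> \<rho> \<le> wdeg \<omega> (s \<tau>)" by (simp add: mem)
    qed
    then show ?thesis by (simp add: top_terms_def mem deg)
  qed
  have "top_terms \<omega> (const_poly (tpow r) * g) = s ` top_terms \<omega> g"
  proof (intro subset_antisym subsetI)
    fix \<rho> assume \<rho>: "\<rho> \<in> top_terms \<omega> (const_poly (tpow r) * g)"
    obtain \<sigma> where "\<rho> = s \<sigma>" using surj by blast
    with \<rho> top show "\<rho> \<in> s ` top_terms \<omega> g" by blast
  qed (use top in blast)
  moreover have "snd (s \<tau>) = snd \<tau>" for \<tau> by (simp add: s_def split: prod.splits)
  ultimately show ?thesis
    by (simp add: set_t_1_in_form sum.reindex[OF inj] coeff)
qed

lemma R_poly_decomposition:
  fixes f :: "('n::finite, 'a::field puiseux) mpoly"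
  obtains N \<alpha> :: nat and g where "N > 0" "g \<in> R_poly N"
    "f = const_poly (tpow (- (of_nat \<alpha> / of_nat N))) * g"
proof -
  let ?K = "Poly_Mapping.keys f"
  have "\<forall>\<beta>. \<exists>N k. N > 0 \<and> (\<forall>q. puiseux_nth (Poly_Mapping.lookup f \<beta>) q \<noteq> 0 \<longrightarrow>
      (\<exists>i\<ge>k. q = of_int i / of_nat N))"
    by (metis puiseux_support)
  then obtain M k where M: "\<And>\<beta>. M \<beta> > 0"
    and k: "\<And>\<beta> q. puiseux_nth (Poly_Mapping.lookup f \<beta>) q \<noteq> 0 \<Longrightarrow>
      \<exists>i\<ge>k \<beta>. q = of_int i / of_nat (M \<beta>)"
    by metis
  define N where "N = (\<Prod>\<beta>\<in>?K. M \<beta>)"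
  define \<alpha> where "\<alpha> = (\<Sum>\<beta>\<in>?K. nat \<bar>k \<beta>\<bar>) * N"
  define g where "g = const_poly (tpow (of_nat \<alpha> / of_nat N)) * f"
  have N: "N > 0" using M by (simp add: N_def prod_pos)
  show ?thesis
  proof (rule that)
    show "N > 0" by (rule N)
    show "f = const_poly (tpow (- (of_nat \<alpha> / of_nat N))) * g"
      proof (rule poly_mapping_eqI)
      fix \<beta>
      show "Poly_Mapping.lookup f \<beta> =
          Poly_Mapping.lookup (const_poly (tpow (- (of_nat \<alpha> / of_nat N))) * g) \<beta>"
        unfolding g_def lookup_const_poly_times by (simp add: tpow_add flip: mult.assoc)
    qed
    have "\<exists>i::nat. q = of_nat i / of_nat N"
      if q: "puiseux_nth (Poly_Mapping.lookup g \<beta>) q \<noteq> 0" for \<beta> q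
    proof -
      have q': "puiseux_nth (Poly_Mapping.lookup f \<beta>) (q - of_nat \<alpha> / of_nat N) \<noteq> 0"
        using q by (simp add: g_def puiseux_nth_tpow_times)
      then have \<beta>: "\<beta> \<in> ?K" by (auto simp: in_keys_iff)
      obtain i where i: "i \<ge> k \<beta>" "q - of_nat \<alpha> / of_nat N = of_int i / of_nat (M \<beta>)"
        using k[OF q'] by blast
      obtain c where c: "N = M \<beta> * c"
        unfolding N_def using \<beta> by (metis dvd_def dvd_prodI finite_keys)
      have c0: "c > 0" using N c by simp
      have "nat \<bar>k \<beta>\<bar> \<le> (\<Sum>\<beta>\<in>?K. nat \<bar>k \<beta>\<bar>)"
        using \<beta> by (intro member_le_sum) auto
      then have "nat \<bar>k \<beta>\<bar> * c \<le> (\<Sum>\<beta>\<in>?K. nat \<bar>k \<beta>\<bar>) * N"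
        using M[of \<beta>] by (intro mult_mono) (auto simp: c)
      then have "\<bar>k \<beta>\<bar> * int c \<le> int \<alpha>"
        unfolding \<alpha>_def by (metis int_nat_eq abs_ge_zero of_nat_le_iff of_nat_mult nat_0_le)
      moreover have "- (\<bar>k \<beta>\<bar> * int c) \<le> i * int c"
        using i(1) mult_right_mono[of "- \<bar>k \<beta>\<bar>" i "int c"] by simp
      ultimately have nonneg: "int \<alpha> + i * int c \<ge> 0" by linarith
      have "q = of_nat \<alpha> / of_nat N + of_int i / of_nat (M \<beta>)"
        using i(2) by (simp add: algebra_simps)
      also have "of_int i / of_nat (M \<beta>) = (of_int (i * int c) / of_nat N :: rat)"
        using c0 M[of \<beta>] by (simp add: c)
      also have "of_nat \<alpha> / of_nat N + of_int (i * int c) / of_nat N = (of_int (int \<alpha> + i * int c) / of_nat N :: rat)"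
        by (simp add: add_divide_distrib)
      also have "\<dots> = of_nat (nat (int \<alpha> + i * int c)) / of_nat N"
        using nonneg by (simp only: of_nat_nat)
      finally show ?thesis by blast
    qed
    then show "g \<in> R_poly N" by (auto simp: R_poly_def puiseux_R_def)
  qed
qed

lemma t_in_eq: "t_in \<omega> f = set_t_1 (in_form \<omega> f)"
proof (cases "f = 0")
  case True
  then show ?thesis
    by (simp add: t_in_def set_t_1_in_form top_terms_def terms_def term_coeff_def)
next
  case False
  obtain N \<alpha> g where "N > 0" "g \<in> R_poly N" "f = const_poly (tpow (- (of_nat \<alpha> / of_nat N))) * g"
    using R_poly_decomposition by metis
  then have "\<exists>N \<alpha> g. N > 0 \<and> g \<in> R_poly N \<and>
      f = const_poly (tpow (- (of_nat \<alpha> / of_nat N))) * g \<and>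
      set_t_1 (in_form \<omega> f) = set_t_1 (in_form \<omega> g)"
    using set_t_1_in_form_tpow by metis
  moreover have "h = set_t_1 (in_form \<omega> f)"
    if "\<exists>N \<alpha> g. N > 0 \<and> g \<in> R_poly N \<and>
      f = const_poly (tpow (- (of_nat \<alpha> / of_nat N))) * g \<and> h = set_t_1 (in_form \<omega> g)" for h
    using that by (auto simp: set_t_1_in_form_tpow)
  ultimately show ?thesis
    unfolding t_in_def if_not_P[OF False] by (intro the_equality)
qed

definition t_in_ideal :: "real ^ 'n \<Rightarrow> ('n::finite, 'a::field puiseux) mpoly set \<Rightarrow> ('n, 'a) mpoly set" where
  "t_in_ideal \<omega> J = ideal_generated_by (t_in \<omega> ` J)"

definition Trop :: "('n::finite, 'a::field puiseux) mpoly set \<Rightarrow> (real ^ 'n) set" where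
  "Trop J = {\<omega>. \<forall>\<beta>. monom_x \<beta> \<notin> t_in_ideal \<omega> J}"

end

theory Submission
  imports Defs
begin

text \<open>
  Let \<open>L\<close> be the field of Puiseux series over \<open>K\<close>, \<open>O\<close> its valuation ring and \<open>\<omega> = w\<close> a rational weight.
  Substituting \<open>t\<close> to the power \<open>- w i\<close> times \<open>x\<^sub>i\<close> for \<open>x\<^sub>i\<close> reduces the assertion to \<open>w = 0\<close>: after the
  substitution, the initial form of \<open>f\<close> is the coefficient of the lowest power of \<open>t\<close> in \<open>f\<close>
  (\<open>t_in_slice\<close>), and the points in question are those with all coordinates units of \<open>O\<close>. If \<open>f\<close> vanishes at
  such a point, its initial form vanishes at the residues of the coordinates, which are not zero;
  so no monomial is in the ideal of initial forms (\<open>zero_imp_Trop\<close>).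

  For the converse, consider power series in roots of \<open>t\<close> with bounded denominators whose
  coefficients are Laurent polynomials in \<open>x\<close>. Those that can be approximated by elements of \<open>J\<close> up to
  monomial factors form an ideal that is saturated with respect to \<open>t\<close>, and that \<open>1\<close> is not in it
  means exactly that no element of \<open>J\<close> has a monomial as its initial form
  (\<open>one_notin_closure_ideal\<close>). It remains to show that a proper saturated ideal has a point: a
  homomorphism over \<open>O\<close> from the ring of series to \<open>O\<close> that kills the ideal. The images of \<open>x\<^sub>i\<close> and of its
  inverse then both belong to \<open>O\<close>, and the images of the \<open>x\<^sub>i\<close> are the desired zero of \<open>J\<close>
  (\<open>Trop_imp_zero\<close>).

  The existence of points (\<open>affinoid_nullstellensatz\<close>) holds for series over any finitely generated
  \<open>K\<close>-algebra and is proved by Noether normalization in the style of rigid geometry. The ideal may be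
  assumed to contain an element whose constant term is the value of a non-zero polynomial at the
  generators. Nagata's change of generators makes this polynomial monic in one generator \<open>y\<close>
  (\<open>nagata_normalization\<close>), and division with remainder, performed for one power of \<open>t\<close> after the other
  (\<open>weierstrass_division\<close>), shows that the quotient is finite over the series with \<open>y\<close> omitted. There a
  point exists by induction. It extends along the finite extension because \<open>L\<close> is algebraically closed
  (\<open>extend_hom_finite\<close>, whose core is Nakayama's lemma), and stays in \<open>O\<close> because \<open>O\<close> is integrally closed.

  That \<open>L\<close> is algebraically closed is the theorem of Newton and Puiseux. A substitution of the unknown
  removes the second coefficient of a monic polynomial, scaling by the least slope of the Newton
  polygon makes its coefficients integral with a second unit among them, and then the residue
  polynomial has coprime factors, which Hensel's lemma lifts.
\<close>

section \<open>Puiseux power series over a commutative ring\<close>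

text \<open>The union over \<open>N\<close> of the rings of power series in \<open>t\<^sup>1\<^sup>/\<^sup>N\<close> with coefficients in a ring, each series
  being given by its coefficient function on exponents. With a field of coefficients this is the
  valuation ring of the Puiseux series; the main argument takes Laurent polynomials as coefficients.
  Having all denominators in one ring, a single step handles all elements of an ideal of
  \<open>L[x]\<close>, whichever roots of \<open>t\<close> occur in them.\<close>

typedef (overloaded) 'a pps =
  "{f :: rat \<Rightarrow> 'a::zero. \<exists>N>0. \<forall>q. f q \<noteq> 0 \<longrightarrow> (\<exists>i::nat. q = of_nat i / of_nat N)}"
  morphisms pps_nth Abs_pps
  by (rule exI[of _ "\<lambda>_. 0"]) auto

lemma pps_eqI: "(\<And>q. pps_nth x q = pps_nth y q) \<Longrightarrow> x = y"
  by (metis ext pps_nth_inject)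

lemma nth_Abs_pps:
  assumes "N > 0" "\<And>q. f q \<noteq> 0 \<Longrightarrow> \<exists>i::nat. q = of_nat i / of_nat N"
  shows "pps_nth (Abs_pps f) = f"
  using assms by (intro Abs_pps_inverse) blast

text \<open>\<open>F(t\<^sup>1\<^sup>/\<^sup>N)\<close>, for \<open>N > 0\<close>.\<close>

definition pps_of :: "nat \<Rightarrow> 'a::zero fps \<Rightarrow> 'a pps" where
  "pps_of N F = Abs_pps (\<lambda>q. if \<exists>i::nat. q = of_nat i / of_nat N then fps_nth F (nat \<lfloor>of_nat N * q\<rfloor>) else 0)"

lemma nth_pps_of:
  assumes "N > 0"
  shows "pps_nth (pps_of N F) q =
    (if \<exists>i::nat. q = of_nat i / of_nat N then fps_nth F (nat \<lfloor>of_nat N * q\<rfloor>) else 0)"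
  unfolding pps_of_def using assms by (subst nth_Abs_pps[of N]) (auto split: if_splits)

lemma nth_pps_of_div [simp]:
  assumes "N > 0"
  shows "pps_nth (pps_of N F) (of_nat i / of_nat N) = fps_nth F i"
  using assms by (auto simp: nth_pps_of)

lemma pps_of_support:
  assumes "N > 0" "pps_nth (pps_of N F) q \<noteq> 0"
  obtains i where "q = of_nat i / of_nat N"
  using assms by (auto simp: nth_pps_of split: if_splits)

lemma pps_of_support_exists:
  assumes "N > 0" "pps_nth (pps_of N F) q \<noteq> 0"
  shows "\<exists>i::nat. q = of_nat i / of_nat N"
  using pps_of_support[OF assms] by blast

lemma pps_of_eqI:
  assumes "N > 0" "\<And>i. pps_nth x (of_nat i / of_nat N) = fps_nth F i"
    "\<And>q. pps_nth x q \<noteq> 0 \<Longrightarrow> \<exists>i::nat. q = of_nat i / of_nat N"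
  shows "x = pps_of N F"
proof (rule pps_eqI)
  fix q
  show "pps_nth x q = pps_nth (pps_of N F) q"
  proof (cases "\<exists>i::nat. q = of_nat i / of_nat N")
    case True
    then show ?thesis using assms by auto
  next
    case False
    then show ?thesis using assms(3)[of q] pps_of_support_exists[OF assms(1), of F q] by metis
  qed
qed

lemma pps_of_exists: "\<exists>N>0. \<exists>F. x = pps_of N F"
proof -
  obtain N where "N > 0" "\<forall>q. pps_nth x q \<noteq> 0 \<longrightarrow> (\<exists>i::nat. q = of_nat i / of_nat N)"
    using pps_nth[of x] by blast
  then have "x = pps_of N (Abs_fps (\<lambda>i. pps_nth x (of_nat i / of_nat N)))"
    by (intro pps_of_eqI) auto
  with \<open>N > 0\<close> show ?thesis by blast
qed

lemma pps_of_refine: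
  assumes "N > 0" "M > 0"
  shows "\<exists>G. pps_of N F = pps_of (N * M) G"
proof -
  have "pps_of N F = pps_of (N * M) (Abs_fps (\<lambda>i. pps_nth (pps_of N F) (of_nat i / of_nat (N * M))))"
  proof (rule pps_of_eqI)
    fix q assume "pps_nth (pps_of N F) q \<noteq> 0"
    then obtain i where "q = of_nat i / of_nat N" using pps_of_support assms by blast
    then show "\<exists>i::nat. q = of_nat i / of_nat (N * M)"
      using assms by (intro exI[of _ "i * M"]) simp
  qed (use assms in auto)
  then show ?thesis by blast
qed

text \<open>Finitely many series have a common denominator, so identities between them may be checked
  on ordinary power series in \<open>t\<^sup>1\<^sup>/\<^sup>N\<close>.\<close>

lemma pps_common_denominator:
  assumes "finite X"
  obtains N where "N > 0" "\<And>x. x \<in> X \<Longrightarrow> \<exists>F. x = pps_of N F"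
proof -
  have "\<exists>N>0. \<forall>x\<in>X. \<exists>F. x = pps_of N F"
    using assms
  proof (induction X)
    case empty
    then show ?case by (auto intro: exI[of _ 1])
  next
    case (insert y X)
    then obtain N where N: "N > 0" "\<forall>x\<in>X. \<exists>F. x = pps_of N F" by blast
    obtain M F where M: "M > 0" "y = pps_of M F" using pps_of_exists by blast
    have "\<exists>F. x = pps_of (N * M) F" if "x \<in> insert y X" for x
    proof (cases "x = y")
      case True
      then show ?thesis using M N pps_of_refine[of M N F] by (metis mult.commute)
    next
      case False
      then show ?thesis using that N M pps_of_refine by (metis insertE)
    qed
    then show ?case using N M by (intro exI[of _ "N * M"]) auto
  qed
  then show ?thesis using that by blast
qed

lemma pps_common_denominator3:
  fixes x y z :: "'a::zero pps"
  obtains N F G H where "N > 0" "x = pps_of N F" "y = pps_of N G" "z = pps_of N H"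
proof -
  obtain N where N: "N > 0" "\<And>u. u \<in> {x, y, z} \<Longrightarrow> \<exists>F. u = pps_of N F"
    using pps_common_denominator[of "{x, y, z}"] by auto
  then obtain F G H where "x = pps_of N F" "y = pps_of N G" "z = pps_of N H" by (metis insertCI)
  with N(1) that show ?thesis by blast
qed

lemma pps_common_denominator2:
  fixes x y :: "'a::zero pps"
  obtains N F G where "N > 0" "x = pps_of N F" "y = pps_of N G"
  by (rule pps_common_denominator3[of x y x]) (rule that)

instantiation pps :: (comm_ring_1) comm_ring_1
begin

definition zero_pps :: "'a pps" where "0 = pps_of 1 0"
definition one_pps :: "'a pps" where "1 = pps_of 1 1"
definition plus_pps :: "'a pps \<Rightarrow> 'a pps \<Rightarrow> 'a pps" where
  "x + y = Abs_pps (\<lambda>q. pps_nth x q + pps_nth y q)"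
definition uminus_pps :: "'a pps \<Rightarrow> 'a pps" where
  "- x = Abs_pps (\<lambda>q. - pps_nth x q)"
definition minus_pps :: "'a pps \<Rightarrow> 'a pps \<Rightarrow> 'a pps" where
  "x - y = Abs_pps (\<lambda>q. pps_nth x q - pps_nth y q)"
definition times_pps :: "'a pps \<Rightarrow> 'a pps \<Rightarrow> 'a pps" where
  "x * y = Abs_pps (\<lambda>q. \<Sum>a | pps_nth x a \<noteq> 0 \<and> pps_nth y (q - a) \<noteq> 0. pps_nth x a * pps_nth y (q - a))"

lemma pps_of_0: "N > 0 \<Longrightarrow> pps_of N 0 = (0::'a pps)"
  unfolding zero_pps_def
  by (rule pps_eqI) (auto simp: nth_pps_of)

lemma pps_of_1: "N > 0 \<Longrightarrow> pps_of N 1 = (1::'a pps)"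
  unfolding one_pps_def
proof (rule pps_of_eqI[symmetric])
  fix i assume "N > 0"
  show "pps_nth (pps_of 1 (1::'a fps)) (of_nat i / of_nat N) = fps_nth 1 i"
  proof (cases "i = 0")
    case False
    have "fps_nth (1::'a fps) (nat \<lfloor>of_nat i / of_nat N :: rat\<rfloor>) = 0"
      if "of_nat i / of_nat N = (of_nat j :: rat)" for j :: nat
      using that False \<open>N > 0\<close> by (cases "j = 0") auto
    then show ?thesis using False by (auto simp: nth_pps_of)
  qed (simp add: nth_pps_of)
next
  fix q assume "N > 0" "pps_nth (pps_of 1 (1::'a fps)) q \<noteq> 0"
  then have "q = 0" by (auto simp: nth_pps_of split: if_splits)
  then show "\<exists>i::nat. q = of_nat i / of_nat N" by auto
qed

lemma nth_plus_pps: "pps_nth (x + y) q = pps_nth x q + pps_nth (y::'a pps) q"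
proof -
  obtain N F G where N: "N > 0" "x = pps_of N F" "y = pps_of N G"
    by (rule pps_common_denominator2)
  have *: "\<exists>i::nat. q = of_nat i / of_nat N" if "pps_nth x q + pps_nth y q \<noteq> 0" for q
    using that pps_of_support_exists[OF N(1), of F q] pps_of_support_exists[OF N(1), of G q]
    unfolding N by (cases "pps_nth (pps_of N F) q = 0") auto
  show ?thesis unfolding plus_pps_def by (subst nth_Abs_pps[OF N(1) *]) auto
qed

lemma nth_uminus_pps: "pps_nth (- x) q = - pps_nth (x::'a pps) q"
proof -
  obtain N F where N: "N > 0" "x = pps_of N F"
    using pps_of_exists by blast
  have *: "\<exists>i::nat. q = of_nat i / of_nat N" if "- pps_nth x q \<noteq> 0" for q
    using that pps_of_support_exists[OF N(1), of F q] unfolding N by auto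
  show ?thesis unfolding uminus_pps_def by (subst nth_Abs_pps[OF N(1) *]) auto
qed

lemma nth_minus_pps: "pps_nth (x - y) q = pps_nth x q - pps_nth (y::'a pps) q"
proof -
  obtain N F G where N: "N > 0" "x = pps_of N F" "y = pps_of N G"
    by (rule pps_common_denominator2)
  have *: "\<exists>i::nat. q = of_nat i / of_nat N" if "pps_nth x q - pps_nth y q \<noteq> 0" for q
    using that pps_of_support_exists[OF N(1), of F q] pps_of_support_exists[OF N(1), of G q]
    unfolding N by (cases "pps_nth (pps_of N F) q = 0") auto
  show ?thesis unfolding minus_pps_def by (subst nth_Abs_pps[OF N(1) *]) auto
qed

lemma pps_of_plus: "N > 0 \<Longrightarrow> pps_of N F + pps_of N G = pps_of N (F + G :: 'a fps)"
  by (rule pps_eqI) (auto simp: nth_plus_pps nth_pps_of)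
lemma pps_of_minus: "N > 0 \<Longrightarrow> pps_of N F - pps_of N G = pps_of N (F - G :: 'a fps)"
  by (rule pps_eqI) (auto simp: nth_minus_pps nth_pps_of)
lemma pps_of_uminus: "N > 0 \<Longrightarrow> - pps_of N F = pps_of N (- F :: 'a fps)"
  by (rule pps_eqI) (auto simp: nth_uminus_pps nth_pps_of)

lemma pps_of_times_sum:
  assumes "N > 0"
  shows "(\<Sum>a | pps_nth (pps_of N F) a \<noteq> 0 \<and> pps_nth (pps_of N G) (q - a) \<noteq> 0.
      pps_nth (pps_of N F) a * pps_nth (pps_of N G) (q - a)) = pps_nth (pps_of N (F * G :: 'a fps)) q"
    (is "sum ?h ?S = _")
proof (cases "\<exists>n::nat. q = of_nat n / of_nat N")
  case True
  then obtain n where n: "q = of_nat n / of_nat N" by blast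
  let ?e = "\<lambda>i. of_nat i / of_nat N :: rat"
  have diff: "q - ?e i = ?e (n - i)" if "i \<le> n" for i
    using that by (simp add: n of_nat_diff diff_divide_distrib)
  have sub: "?S \<subseteq> ?e ` {0..n}"
  proof
    fix a assume a: "a \<in> ?S"
    then obtain i where i: "a = ?e i" using assms by (auto elim!: pps_of_support)
    from a obtain j where j: "q - a = ?e j" using pps_of_support_exists[OF assms] by blast
    then have "?e n = ?e (i + j)" using i n by (simp add: add_divide_distrib)
    then have "n = i + j" using assms by (simp del: of_nat_add)
    then show "a \<in> ?e ` {0..n}" using i by auto
  qed
  have "sum ?h ?S = sum ?h (?e ` {0..n})"
    by (rule sum.mono_neutral_left) (use sub in auto)
  also have "\<dots> = (\<Sum>i=0..n. ?h (?e i))"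
    using assms by (subst sum.reindex) (auto simp: inj_on_def)
  also have "\<dots> = (\<Sum>i=0..n. fps_nth F i * fps_nth G (n - i))"
  proof (rule sum.cong)
    fix i assume "i \<in> {0..n}"
    then have "q - ?e i = ?e (n - i)" using diff by simp
    then show "?h (?e i) = fps_nth F i * fps_nth G (n - i)" using assms by (simp only: nth_pps_of_div)
  qed simp
  finally show ?thesis using assms by (simp add: n fps_mult_nth)
next
  case False
  have "?S = {}"
  proof (rule ccontr)
    assume "?S \<noteq> {}"
    then obtain a where a: "a \<in> ?S" by blast
    then obtain i j where ij: "a = of_nat i / of_nat N" "q - a = of_nat j / of_nat N"
      using pps_of_support_exists[OF assms] by blast
    then have "q = of_nat (i + j) / of_nat N" by (simp add: add_divide_distrib)
    with False show False by blast
  qed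
  then have "sum ?h ?S = 0" by (simp only: sum.empty)
  then show ?thesis using False assms by (simp add: nth_pps_of)
qed

lemma pps_of_times: "N > 0 \<Longrightarrow> pps_of N F * pps_of N G = pps_of N (F * G :: 'a fps)"
  unfolding times_pps_def pps_of_times_sum by (simp add: pps_nth_inverse)

instance
proof
  fix x y z :: "'a pps"
  obtain N F G H where N: "N > 0" "x = pps_of N F" "y = pps_of N G" "z = pps_of N H"
    by (rule pps_common_denominator3)
  note simps = N pps_of_plus pps_of_minus pps_of_uminus pps_of_times
    pps_of_0[OF N(1), symmetric] pps_of_1[OF N(1), symmetric]
  show "x + y + z = x + (y + z)" by (simp add: simps add_ac)
  show "x + y = y + x" by (simp add: simps add_ac)
  show "0 + x = x" by (simp add: simps)
  show "- x + x = 0" by (simp add: simps)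
  show "x - y = x + - y" by (simp add: simps)
  show "x * y * z = x * (y * z)" by (simp add: simps mult_ac)
  show "x * y = y * x" by (simp add: simps mult_ac)
  show "1 * x = x" by (simp add: simps)
  show "(x + y) * z = x * z + y * z" by (simp add: simps algebra_simps)
next
  have "pps_nth (0 :: 'a pps) 0 = 0" "pps_nth (1 :: 'a pps) 0 = 1"
    using nth_pps_of_div[of 1 "0 :: 'a fps" 0] nth_pps_of_div[of 1 "1 :: 'a fps" 0]
    by (simp_all add: zero_pps_def one_pps_def del: nth_pps_of_div)
  then show "(0 :: 'a pps) \<noteq> 1" by auto
qed

end

lemma nth_zero_pps [simp]: "pps_nth (0::'a::comm_ring_1 pps) q = 0"
  by (simp add: zero_pps_def nth_pps_of)

lemma nth_one_pps: "pps_nth (1::'a::comm_ring_1 pps) q = (if q = 0 then 1 else 0)"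
  by (auto simp: one_pps_def nth_pps_of)

lemma nth_neg_pps: 
  assumes "q < 0" shows "pps_nth x q = 0"
proof (rule ccontr)
  obtain N F where N: "N > 0" "x = pps_of N F" using pps_of_exists by blast
  assume "pps_nth x q \<noteq> 0"
  then obtain i where "q = of_nat i / of_nat N" using N pps_of_support by blast
  with assms N show False by (simp add: divide_less_0_iff)
qed

lemma nth_times_pps:
  fixes x y :: "'a::comm_ring_1 pps"
  assumes "finite S" "\<And>a. pps_nth x a \<noteq> 0 \<Longrightarrow> pps_nth y (q - a) \<noteq> 0 \<Longrightarrow> a \<in> S"
  shows "pps_nth (x * y) q = (\<Sum>a\<in>S. pps_nth x a * pps_nth y (q - a))"
proof -
  obtain N F G where N: "N > 0" "x = pps_of N F" "y = pps_of N G"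
    by (rule pps_common_denominator2)
  have "pps_nth (x * y) q = pps_nth (pps_of N (F * G)) q"
    unfolding N(2,3) using N(1) by (simp add: pps_of_times)
  also have "\<dots> = (\<Sum>a | pps_nth x a \<noteq> 0 \<and> pps_nth y (q - a) \<noteq> 0. pps_nth x a * pps_nth y (q - a))"
    unfolding N(2,3) by (rule pps_of_times_sum[OF N(1), symmetric])
  also have "\<dots> = (\<Sum>a\<in>S. pps_nth x a * pps_nth y (q - a))"
    by (rule sum.mono_neutral_left) (use assms in auto)
  finally show ?thesis .
qed

lemma nth_times_pps_0: "pps_nth (x * y) 0 = pps_nth x 0 * pps_nth (y::'a::comm_ring_1 pps) 0"
proof (subst nth_times_pps[of "{0}"])
  fix a assume "pps_nth x a \<noteq> 0" "pps_nth y (0 - a) \<noteq> 0"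
  then have "\<not> a < 0" "\<not> 0 - a < 0" using nth_neg_pps by blast+
  then show "a \<in> {0}" by simp
qed simp_all

lemma finite_pps_support_below: "finite {a. pps_nth x a \<noteq> 0 \<and> a \<le> q}"
proof -
  obtain N F where N: "N > 0" "x = pps_of N F" using pps_of_exists by blast
  have "{a. pps_nth x a \<noteq> 0 \<and> a \<le> q} \<subseteq> (\<lambda>i. of_nat i / of_nat N) ` {..nat \<lceil>of_nat N * q\<rceil>}"
  proof
    fix a assume "a \<in> {a. pps_nth x a \<noteq> 0 \<and> a \<le> q}"
    then obtain i where i: "a = of_nat i / of_nat N" "a \<le> q" using N by (auto elim: pps_of_support)
    then have "of_nat i \<le> of_nat N * q" using N(1) by (simp add: divide_le_eq mult.commute)
    then have "int i \<le> \<lceil>of_nat N * q\<rceil>" by linarith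
    then show "a \<in> (\<lambda>i. of_nat i / of_nat N) ` {..nat \<lceil>of_nat N * q\<rceil>}" using i by auto
  qed
  then show ?thesis by (rule finite_subset) auto
qed

text \<open>Constants and the powers \<open>t\<^sup>q\<close>, which are only meaningful for \<open>q \<ge> 0\<close>.\<close>

definition pps_const :: "'a::comm_ring_1 \<Rightarrow> 'a pps" where
  "pps_const c = pps_of 1 (fps_const c)"

definition pps_t :: "rat \<Rightarrow> 'a::comm_ring_1 pps" where
  "pps_t q = Abs_pps (\<lambda>e. if e = q then 1 else 0)"

lemma nth_pps_const: "pps_nth (pps_const c) q = (if q = 0 then c else 0)"
  by (auto simp: pps_const_def nth_pps_of)

lemma pps_const_of: "N > 0 \<Longrightarrow> pps_const c = pps_of N (fps_const c)"
  by (rule pps_eqI) (auto simp: nth_pps_const nth_pps_of)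

lemma pps_const_simps [simp]:
  "pps_const 0 = 0" "pps_const 1 = 1"
  "pps_const (a + b) = pps_const a + pps_const b"
  "pps_const (a - b) = pps_const a - pps_const b"
  "pps_const (a * b) = pps_const a * pps_const b"
  by (simp_all add: pps_const_def pps_of_plus pps_of_times pps_of_minus zero_pps_def one_pps_def)

lemma nth_pps_const_times [simp]: "pps_nth (pps_const c * x) q = c * pps_nth x q"
  by (subst nth_times_pps[of "{0}"]) (auto simp: nth_pps_const split: if_splits)

lemma pps_const_power: "pps_const (a ^ n) = pps_const a ^ n"
  by (induction n) auto

lemma nth_pps_t: 
  assumes "q \<ge> 0"
  shows "pps_nth (pps_t q) e = (if e = q then 1 else 0)"
proof -
  obtain a b where ab: "quotient_of q = (a, b)" by force
  have b: "b > 0" using quotient_of_denom_pos[OF ab] .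
  have q: "q = of_int a / of_int b" using quotient_of_div[OF ab] .
  have a: "a \<ge> 0" using assms b by (simp add: q zero_le_divide_iff)
  have "pps_nth (pps_t q) = (\<lambda>e. if e = q then 1 else 0)"
    unfolding pps_t_def
    by (rule nth_Abs_pps[of "nat b"]) (use a b q in \<open>auto intro!: exI[of _ "nat a"] split: if_splits\<close>)
  then show ?thesis by metis
qed

lemma nth_pps_t_times [simp]:
  assumes "q \<ge> 0"
  shows "pps_nth (pps_t q * x) e = pps_nth x (e - q)"
  by (subst nth_times_pps[of "{q}"]) (use assms in \<open>auto simp: nth_pps_t split: if_splits\<close>)

lemma pps_t_0 [simp]: "pps_t 0 = 1"
  by (rule pps_eqI) (simp add: nth_pps_t nth_one_pps)

lemma pps_t_add: "p \<ge> 0 \<Longrightarrow> q \<ge> 0 \<Longrightarrow> pps_t p * pps_t q = pps_t (p + q)"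
  by (rule pps_eqI) (auto simp: nth_pps_t)

text \<open>An ideal that is saturated with respect to \<open>t\<close> contains with \<open>x\<close> also the cofactor \<open>y\<close>, whose
  reduction modulo the positive powers of \<open>t\<close> does not vanish.\<close>

lemma pps_factor_t:
  assumes "x \<noteq> 0"
  obtains q y where "q \<ge> 0" "x = pps_t q * y" "pps_nth y 0 \<noteq> 0"
    "\<And>e. e \<ge> 0 \<Longrightarrow> pps_nth y e = pps_nth x (e + q)"
proof -
  obtain N F where N: "N > 0" "x = pps_of N F" using pps_of_exists by blast
  have "F \<noteq> 0" using assms N pps_of_0 by blast
  define k where "k = subdegree F"
  have F: "F = fps_X ^ k * fps_shift k F" 
    by (simp add: k_def subdegree_decompose fps_mult_fps_X_power_commute)
  let ?q = "of_nat k / of_nat N :: rat" and ?y = "pps_of N (fps_shift k F)"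
  have tq: "pps_t ?q = (pps_of N (fps_X ^ k) :: 'a pps)"
    by (rule pps_of_eqI) (use N in \<open>auto simp: nth_pps_t fps_X_power_nth split: if_splits\<close>)
  have eq: "x = pps_t ?q * ?y"
    unfolding tq N(2) using F N(1) by (simp add: pps_of_times)
  show ?thesis
  proof (rule that[of ?q ?y])
    have "pps_nth ?y 0 = fps_nth (fps_shift k F) 0" using nth_pps_of_div[OF N(1), of "fps_shift k F" 0] by simp
    also have "\<dots> \<noteq> 0" using \<open>F \<noteq> 0\<close> by (simp add: k_def)
    finally show "pps_nth ?y 0 \<noteq> 0" .
    show "pps_nth ?y e = pps_nth x (e + ?q)" if "e \<ge> 0" for e
      by (subst eq) (use N(1) in simp)
  qed (use eq in auto)
qed

definition pps_map :: "('a::comm_ring_1 \<Rightarrow> 'b::comm_ring_1) \<Rightarrow> 'a pps \<Rightarrow> 'b pps" where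
  "pps_map h x = Abs_pps (\<lambda>q. h (pps_nth x q))"

lemma nth_pps_map:
  assumes "h 0 = 0"
  shows "pps_nth (pps_map h x) q = h (pps_nth x q)"
proof -
  obtain N F where N: "N > 0" "x = pps_of N F" using pps_of_exists by blast
  have *: "\<exists>i::nat. q = of_nat i / of_nat N" if "h (pps_nth x q) \<noteq> 0" for q
    using that assms pps_of_support_exists[OF N(1), of F q] unfolding N
    by (cases "pps_nth (pps_of N F) q = 0") auto
  show ?thesis unfolding pps_map_def by (subst nth_Abs_pps[OF N(1) *]) auto
qed

section \<open>Puiseux series\<close>

text \<open>\<open>f(t\<^sup>1\<^sup>/\<^sup>N)\<close>, for \<open>N > 0\<close>; for fixed \<open>N\<close> this is a ring homomorphism.\<close>

definition puiseux_of :: "nat \<Rightarrow> 'a::field fls \<Rightarrow> 'a puiseux" where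
  "puiseux_of N f = abs_puiseux (N, f)"

lemma puiseux_rel_self: "N > 0 \<Longrightarrow> puiseux_rel (N, f) (N, f)"
  by (simp add: puiseux_rel_def)

lemma puiseux_of_eq: "puiseux_rel (N, f) (M, g) \<Longrightarrow> puiseux_of N f = puiseux_of M g"
  unfolding puiseux_of_def by (rule Quotient_rel_abs[OF Quotient_puiseux])

lemma puiseux_nth_of:
  "N > 0 \<Longrightarrow> puiseux_nth (puiseux_of N f) q =
    (if of_nat N * q \<in> \<int> then fls_nth f \<lfloor>of_nat N * q\<rfloor> else 0)"
  unfolding puiseux_of_def by (simp add: puiseux_nth.abs_eq puiseux_rel_self raw_nth_def)

lemma puiseux_of_add: "N > 0 \<Longrightarrow> puiseux_of N f + puiseux_of N g = puiseux_of N (f + g)"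
proof -
  assume N: "N > 0"
  then have "puiseux_of N f + puiseux_of N g =
      puiseux_of (N * N) (fls_compose_power f N + fls_compose_power g N)"
    by (simp add: puiseux_of_def plus_puiseux.abs_eq puiseux_rel_self)
  also have "\<dots> = puiseux_of N (f + g)"
    by (rule puiseux_of_eq) (simp add: N puiseux_rel_def fls_compose_power_compose_power)
  finally show ?thesis .
qed

lemma puiseux_of_mult: "N > 0 \<Longrightarrow> puiseux_of N f * puiseux_of N g = puiseux_of N (f * g)"
proof -
  assume N: "N > 0"
  then have "puiseux_of N f * puiseux_of N g =
      puiseux_of (N * N) (fls_compose_power f N * fls_compose_power g N)"
    by (simp add: puiseux_of_def times_puiseux.abs_eq puiseux_rel_self)
  also have "\<dots> = puiseux_of N (f * g)"
    by (rule puiseux_of_eq) (simp add: N puiseux_rel_def fls_compose_power_compose_power)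
  finally show ?thesis .
qed

lemma puiseux_of_0: "N > 0 \<Longrightarrow> puiseux_of N 0 = 0"
  unfolding zero_puiseux.abs_eq puiseux_of_def[symmetric]
  by (rule puiseux_of_eq) (simp add: puiseux_rel_def)

lemma puiseux_of_1: "N > 0 \<Longrightarrow> puiseux_of N 1 = 1"
  unfolding one_puiseux.abs_eq puiseux_of_def[symmetric]
  by (rule puiseux_of_eq) (simp add: puiseux_rel_def)

text \<open>A Puiseux series is determined by its coefficients, and one with the required coefficients exists
  because every element of the domain has the form \<open>F(t\<^sup>1\<^sup>/\<^sup>N)\<close>.\<close>

definition puiseux_emb :: "'a::field pps \<Rightarrow> 'a puiseux" where
  "puiseux_emb x = (THE a. \<forall>q. puiseux_nth a q = pps_nth x q)"

lemma nth_puiseux_of_fps: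
  assumes "N > 0"
  shows "puiseux_nth (puiseux_of N (fps_to_fls F)) q = pps_nth (pps_of N F) q"
proof (cases "\<exists>i::nat. q = of_nat i / of_nat N")
  case True
  then obtain i :: nat where "q = of_nat i / of_nat N" by blast
  then show ?thesis using assms by (simp add: puiseux_nth_of)
next
  case False
  have "fls_nth (fps_to_fls F) \<lfloor>of_nat N * q\<rfloor> = 0" if int: "of_nat N * q \<in> \<int>"
  proof -
    obtain k where k: "of_nat N * q = of_int k" using int by (elim Ints_cases)
    have "k < 0"
    proof (rule ccontr)
      assume "\<not> k < 0"
      then have "q = of_nat (nat k) / of_nat N" using k assms by (simp add: field_simps)
      with False show False by blast
    qed
    then show ?thesis by (simp add: k)
  qed
  then show ?thesis using False assms by (simp add: puiseux_nth_of nth_pps_of)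
qed

lemma puiseux_emb_pps_of: 
  assumes "N > 0"
  shows "puiseux_emb (pps_of N F) = puiseux_of N (fps_to_fls F)"
  unfolding puiseux_emb_def
  by (rule the_equality) (use assms in \<open>auto simp: nth_puiseux_of_fps intro: puiseux_eqI\<close>)

lemma nth_puiseux_emb [simp]: "puiseux_nth (puiseux_emb x) q = pps_nth x q"
proof -
  obtain N F where "N > 0" "x = pps_of N F" using pps_of_exists by blast
  then show ?thesis by (simp add: puiseux_emb_pps_of nth_puiseux_of_fps)
qed

lemma puiseux_emb_add [simp]: "puiseux_emb (x + y) = puiseux_emb x + puiseux_emb y"
proof -
  obtain N F G where "N > 0" "x = pps_of N F" "y = pps_of N G" by (rule pps_common_denominator2)
  then show ?thesis
    by (simp add: pps_of_plus puiseux_emb_pps_of puiseux_of_add)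
qed

lemma puiseux_emb_mult [simp]: "puiseux_emb (x * y) = puiseux_emb x * puiseux_emb y"
proof -
  obtain N F G where "N > 0" "x = pps_of N F" "y = pps_of N G" by (rule pps_common_denominator2)
  then show ?thesis
    by (simp add: pps_of_times puiseux_emb_pps_of puiseux_of_mult fls_times_fps_to_fls)
qed

lemma puiseux_emb_0 [simp]: "puiseux_emb 0 = 0"
  by (rule puiseux_eqI) simp

lemma puiseux_emb_1 [simp]: "puiseux_emb 1 = 1"
  by (rule puiseux_eqI) (simp add: nth_one_pps puiseux_nth_one)

lemma puiseux_emb_t: "q \<ge> 0 \<Longrightarrow> puiseux_emb (pps_t q) = tpow q"
  by (rule puiseux_eqI) (simp add: nth_pps_t puiseux_nth_tpow)

lemma puiseux_nth_add: "puiseux_nth (a + b) q = puiseux_nth a q + puiseux_nth b q"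
proof -
  have *: "raw_nth (fst x * fst y, fls_compose_power (snd x) (fst y) + fls_compose_power (snd y) (fst x)) q
      = raw_nth x q + raw_nth y q"
    if "puiseux_rel x x" "puiseux_rel y y" for x y :: "nat \<times> 'a fls" and q
    using that raw_nth_refine[of "fst x" "fst y" "snd x" q] raw_nth_refine[of "fst y" "fst x" "snd y" q]
    by (auto simp: raw_nth_def puiseux_rel_def mult.commute[of "fst y"] mult.commute[of "of_nat (fst y)"] split: if_splits)
  show ?thesis by transfer (use * in blast)
qed

lemma puiseux_nth_sum: "puiseux_nth (sum f A) q = (\<Sum>i\<in>A. puiseux_nth (f i) q)"
  by (induction A rule: infinite_finite_induct) (auto simp: puiseux_nth_add)

subsection \<open>The valuation ring\<close>

definition puiseux_O :: "'a::field puiseux set" where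
  "puiseux_O = {a. \<forall>q<0. puiseux_nth a q = 0}"

lemma puiseux_emb_in_O [simp]: "puiseux_emb x \<in> puiseux_O"
  by (simp add: puiseux_O_def nth_neg_pps)

lemma puiseux_O_emb:
  assumes "a \<in> puiseux_O"
  obtains x where "a = puiseux_emb x" "pps_nth x = puiseux_nth a"
proof -
  obtain N k where N: "N > 0"
    and supp: "\<And>q. puiseux_nth a q \<noteq> 0 \<Longrightarrow> \<exists>i\<ge>k. q = of_int i / of_nat N"
    using puiseux_support[of a] by metis
  have "\<exists>i::nat. q = of_nat i / of_nat N" if q: "puiseux_nth a q \<noteq> 0" for q
  proof -
    obtain i where i: "q = of_int i / of_nat N" using supp[OF q] by blast
    have "\<not> q < 0" using q assms by (auto simp: puiseux_O_def)
    then have "i \<ge> 0" using N i by (simp add: divide_less_0_iff)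
    then show ?thesis using i by (intro exI[of _ "nat i"]) simp
  qed
  then have "pps_nth (Abs_pps (puiseux_nth a)) = puiseux_nth a"
    using N by (intro nth_Abs_pps) auto
  moreover from this have "a = puiseux_emb (Abs_pps (puiseux_nth a))"
    by (intro puiseux_eqI) simp
  ultimately show ?thesis using that by blast
qed

lemma puiseux_O_closed [simp]:
  "0 \<in> puiseux_O" "1 \<in> puiseux_O"
  "a \<in> puiseux_O \<Longrightarrow> b \<in> puiseux_O \<Longrightarrow> a + b \<in> puiseux_O"
  "a \<in> puiseux_O \<Longrightarrow> b \<in> puiseux_O \<Longrightarrow> a * b \<in> puiseux_O"
proof -
  show "0 \<in> puiseux_O" "1 \<in> puiseux_O"
    using puiseux_emb_in_O[of 0] puiseux_emb_in_O[of 1] by simp_all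
  assume "a \<in> puiseux_O" "b \<in> puiseux_O"
  then obtain x y where "a = puiseux_emb x" "b = puiseux_emb y" by (metis puiseux_O_emb)
  then show "a + b \<in> puiseux_O" "a * b \<in> puiseux_O"
    by (simp_all flip: puiseux_emb_add puiseux_emb_mult)
qed

lemma puiseux_O_sum: "(\<And>i. i \<in> A \<Longrightarrow> f i \<in> puiseux_O) \<Longrightarrow> sum f A \<in> puiseux_O"
  by (induction A rule: infinite_finite_induct) auto

lemma puiseux_O_power: "a \<in> puiseux_O \<Longrightarrow> a ^ n \<in> puiseux_O"
  by (induction n) auto

lemma puiseux_res_mult:
  assumes "a \<in> puiseux_O" "b \<in> puiseux_O"
  shows "puiseux_nth (a * b) 0 = puiseux_nth a 0 * puiseux_nth b 0"
proof -
  obtain x y where "a = puiseux_emb x" "b = puiseux_emb y"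
    using assms by (metis puiseux_O_emb)
  then show ?thesis by (simp add: nth_times_pps_0 flip: puiseux_emb_mult)
qed

lemma puiseux_res_power:
  "a \<in> puiseux_O \<Longrightarrow> puiseux_nth (a ^ n) 0 = puiseux_nth a 0 ^ n"
  by (induction n) (auto simp: puiseux_res_mult puiseux_O_power puiseux_nth_one)

lemma tpow_in_O: "q \<ge> 0 \<Longrightarrow> tpow q \<in> puiseux_O"
  by (metis puiseux_emb_t puiseux_emb_in_O)

lemma tpow_nonzero [simp]: "tpow r \<noteq> 0"
proof
  assume "tpow r = (0::'a puiseux)"
  then have "puiseux_nth (tpow r :: 'a puiseux) r = 0" by simp
  then show False by (simp add: puiseux_nth_tpow)
qed

lemma tpow_power: "tpow r ^ n = tpow (of_nat n * r)"
  by (induction n) (auto simp: tpow_add algebra_simps)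

lemma tpow_inverse: "inverse (tpow r) = tpow (- r)"
proof -
  have "tpow r * tpow (- r) = (1 :: 'a puiseux)" by (simp add: tpow_add)
  then show ?thesis by (rule inverse_unique)
qed

lemma puiseux_O_unit:
  assumes "a \<in> puiseux_O" "puiseux_nth a 0 \<noteq> 0"
  shows "inverse a \<in> puiseux_O"
proof -
  obtain x where x: "a = puiseux_emb x" "pps_nth x = puiseux_nth a" using puiseux_O_emb assms by blast
  obtain N F where N: "N > 0" "x = pps_of N F" using pps_of_exists by blast
  have "fps_nth F 0 \<noteq> 0" using assms(2) nth_pps_of_div[OF N(1), of F 0] by (simp add: N flip: x(2))
  then have "F * inverse F = 1" by (metis inverse_mult_eq_1 mult.commute)
  then have "x * pps_of N (inverse F) = 1" using N by (simp add: pps_of_times pps_of_1)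
  then have "a * puiseux_emb (pps_of N (inverse F)) = 1" by (simp add: x(1) flip: puiseux_emb_mult)
  then show ?thesis by (metis inverse_unique puiseux_emb_in_O)
qed

text \<open>The exponent is the valuation; removing that power of \<open>t\<close> leaves a series with invertible residue,
  hence a unit of the valuation ring.\<close>

lemma puiseux_normal_form:
  assumes "a \<noteq> 0"
  obtains m u where "a = tpow m * u" "u \<in> puiseux_O" "puiseux_nth u 0 \<noteq> 0"
    "pval a = ereal (of_rat m)" "puiseux_nth a m \<noteq> 0" "\<And>q. puiseux_nth a q \<noteq> 0 \<Longrightarrow> m \<le> q"
proof -
  obtain m where m: "puiseux_nth a m \<noteq> 0" "\<And>q. puiseux_nth a q \<noteq> 0 \<Longrightarrow> m \<le> q"
    using puiseux_least_exponent[OF assms] by blast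
  have val: "pval a = ereal (of_rat m)"
    unfolding pval_def using assms m by (auto intro!: Least_equality)
  define u where "u = tpow (- m) * a"
  have "a = tpow m * u" by (simp add: u_def tpow_add flip: mult.assoc)
  moreover have "u \<in> puiseux_O" 
    unfolding puiseux_O_def mem_Collect_eq u_def puiseux_nth_tpow_times using m(2) by force
  moreover have "puiseux_nth u 0 \<noteq> 0"
    by (simp add: u_def puiseux_nth_tpow_times m)
  ultimately show ?thesis using that val m by blast
qed

lemma pval_tpow_unit:
  assumes "u \<in> puiseux_O" "puiseux_nth u 0 \<noteq> 0"
  shows "pval (tpow m * u) = ereal (of_rat m)"
proof -
  have "u \<noteq> 0" using assms(2) by auto
  moreover have "(LEAST q. puiseux_nth (tpow m * u) q \<noteq> 0) = m"
    by (rule Least_equality)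
      (use assms in \<open>force simp: puiseux_nth_tpow_times puiseux_O_def\<close>)+
  ultimately show ?thesis by (simp add: pval_def)
qed

lemma puiseux_notin_O:
  assumes "a \<notin> puiseux_O"
  shows "a \<noteq> 0" "inverse a \<in> puiseux_O" "puiseux_nth (inverse a) 0 = 0"
proof -
  show "a \<noteq> 0" using assms by auto
  then obtain m u where mu: "a = tpow m * u" "u \<in> puiseux_O" "puiseux_nth u 0 \<noteq> 0"
    "puiseux_nth a m \<noteq> 0" "\<And>q. puiseux_nth a q \<noteq> 0 \<Longrightarrow> m \<le> q"
    using puiseux_normal_form[OF \<open>a \<noteq> 0\<close>] by metis
  have "m < 0"
  proof (rule ccontr)
    assume "\<not> m < 0"
    then have "a \<in> puiseux_O" unfolding mu(1) using mu(2) by (simp add: tpow_in_O)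
    with assms show False by blast
  qed
  have inv: "inverse a = tpow (- m) * inverse u" by (simp add: mu(1) tpow_inverse)
  have u: "inverse u \<in> puiseux_O" using mu by (intro puiseux_O_unit)
  show "inverse a \<in> puiseux_O" unfolding inv using u \<open>m < 0\<close> by (simp add: tpow_in_O)
  show "puiseux_nth (inverse a) 0 = 0"
    unfolding inv puiseux_nth_tpow_times using u \<open>m < 0\<close> by (simp add: puiseux_O_def)
qed

text \<open>The valuation ring is integrally closed: dividing the equation by \<open>b\<^sup>d\<close> for some \<open>b\<close> of
  negative valuation and passing to residues would give \<open>1 = 0\<close>.\<close>

lemma puiseux_O_integrally_closed:
  assumes r: "\<And>i. i < d \<Longrightarrow> r i \<in> puiseux_O" and eq: "b ^ d = (\<Sum>i<d. r i * b ^ i)"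
  shows "b \<in> puiseux_O"
proof (rule ccontr)
  assume "b \<notin> puiseux_O"
  then have b: "b \<noteq> 0" "inverse b \<in> puiseux_O" "puiseux_nth (inverse b) 0 = 0"
    using puiseux_notin_O by blast+
  have "1 = inverse b ^ d * b ^ d" using b(1) by (simp flip: power_mult_distrib)
  also have "\<dots> = (\<Sum>i<d. r i * inverse b ^ (d - i))"
    unfolding eq sum_distrib_left
  proof (rule sum.cong)
    fix i assume "i \<in> {..<d}"
    then have "inverse b ^ d = inverse b ^ (d - i) * inverse b ^ i" by (simp flip: power_add)
    moreover have "inverse b ^ i * b ^ i = 1" using b(1) by (simp flip: power_mult_distrib)
    ultimately show "inverse b ^ d * (r i * b ^ i) = r i * inverse b ^ (d - i)"
      by (metis (no_types, lifting) mult.assoc mult.commute mult.right_neutral)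
  qed simp
  finally have "puiseux_nth 1 0 = puiseux_nth (\<Sum>i<d. r i * inverse b ^ (d - i)) 0" by simp
  also have "\<dots> = (\<Sum>i<d. puiseux_nth (r i) 0 * puiseux_nth (inverse b) 0 ^ (d - i))"
    unfolding puiseux_nth_sum
    by (rule sum.cong) (use r b(2) in \<open>auto simp: puiseux_res_mult puiseux_res_power puiseux_O_power\<close>)
  also have "\<dots> = 0" using b(3) by (intro sum.neutral) (auto simp: power_0_left)
  finally show False by (simp add: puiseux_nth_one)
qed

section \<open>Subrings and homomorphisms defined on them\<close>

text \<open>The induction on the number of generators passes from a ring to a subring with fewer generators.
  All these rings are subsets of one type, and homomorphisms are functions on the whole type of
  which only the values on such a subset matter.\<close>

definition subring :: "'a::comm_ring_1 set \<Rightarrow> bool" where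
  "subring A \<longleftrightarrow> 1 \<in> A \<and> (\<forall>x\<in>A. \<forall>y\<in>A. x - y \<in> A \<and> x * y \<in> A)"

definition hom_on :: "'a::comm_ring_1 set \<Rightarrow> ('a \<Rightarrow> 'b::comm_ring_1) \<Rightarrow> bool" where
  "hom_on A h \<longleftrightarrow> h 1 = 1 \<and> (\<forall>x\<in>A. \<forall>y\<in>A. h (x + y) = h x + h y \<and> h (x * y) = h x * h y)"

lemma subringD:
  assumes "subring A"
  shows "1 \<in> A" "0 \<in> A" "x \<in> A \<Longrightarrow> - x \<in> A" "x \<in> A \<Longrightarrow> y \<in> A \<Longrightarrow> x + y \<in> A"
    "x \<in> A \<Longrightarrow> y \<in> A \<Longrightarrow> x - y \<in> A" "x \<in> A \<Longrightarrow> y \<in> A \<Longrightarrow> x * y \<in> A" "x \<in> A \<Longrightarrow> x ^ n \<in> A"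
proof -
  note A = assms[unfolded subring_def]
  show one: "1 \<in> A" using A by blast
  show zero: "0 \<in> A" using A one by (metis diff_self)
  show diff: "x \<in> A \<Longrightarrow> y \<in> A \<Longrightarrow> x - y \<in> A" for x y using A by blast
  show neg: "x \<in> A \<Longrightarrow> - x \<in> A" for x using diff[OF zero] by simp
  show "x \<in> A \<Longrightarrow> y \<in> A \<Longrightarrow> x + y \<in> A" using diff[OF _ neg] by simp
  show mult: "x \<in> A \<Longrightarrow> y \<in> A \<Longrightarrow> x * y \<in> A" for x y using A by blast
  show "x \<in> A \<Longrightarrow> x ^ n \<in> A" by (induction n) (auto simp: one mult)
qed

lemma subring_UNIV: "subring (UNIV :: 'a::comm_ring_1 set)"
  by (simp add: subring_def)

lemma subring_sum: "subring A \<Longrightarrow> (\<And>i. i \<in> S \<Longrightarrow> f i \<in> A) \<Longrightarrow> sum f S \<in> A"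
  by (induction S rule: infinite_finite_induct) (auto simp: subringD)

lemma hom_onD:
  assumes "hom_on A h" "subring A"
  shows "h 1 = 1" "h 0 = 0" "x \<in> A \<Longrightarrow> y \<in> A \<Longrightarrow> h (x + y) = h x + h y"
    "x \<in> A \<Longrightarrow> y \<in> A \<Longrightarrow> h (x * y) = h x * h y" "x \<in> A \<Longrightarrow> h (- x) = - h x"
    "x \<in> A \<Longrightarrow> y \<in> A \<Longrightarrow> h (x - y) = h x - h y" "x \<in> A \<Longrightarrow> h (x ^ n) = h x ^ n"
proof -
  note A = assms(1)[unfolded hom_on_def] and S = subringD[OF assms(2)]
  show one: "h 1 = 1" using A by blast
  show add: "x \<in> A \<Longrightarrow> y \<in> A \<Longrightarrow> h (x + y) = h x + h y" for x y using A by blast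
  show mult: "x \<in> A \<Longrightarrow> y \<in> A \<Longrightarrow> h (x * y) = h x * h y" for x y using A by blast
  show zero: "h 0 = 0" using add[OF S(2) S(2)] by simp
  show neg: "x \<in> A \<Longrightarrow> h (- x) = - h x" for x
    using add[of x "- x"] S(3)[of x] zero by (simp add: eq_neg_iff_add_eq_0 add.commute)
  show "x \<in> A \<Longrightarrow> y \<in> A \<Longrightarrow> h (x - y) = h x - h y"
    using add[of x "- y"] S(3)[of y] neg by simp
  show "x \<in> A \<Longrightarrow> h (x ^ n) = h x ^ n" by (induction n) (auto simp: one mult S)
qed

lemma hom_on_sum:
  assumes "hom_on A h" "subring A" "\<And>i. i \<in> S \<Longrightarrow> f i \<in> A"
  shows "h (sum f S) = (\<Sum>i\<in>S. h (f i))"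
  using assms(3)
  by (induction S rule: infinite_finite_induct)
    (auto simp: hom_onD[OF assms(1,2)] subring_sum[OF assms(2)])

definition polys_over :: "'a::comm_ring_1 set \<Rightarrow> 'a poly set" where
  "polys_over A = {p. \<forall>i. coeff p i \<in> A}"

lemma subring_polys_over:
  assumes "subring A"
  shows "subring (polys_over A)"
  unfolding subring_def polys_over_def
  using subringD[OF assms] by (auto simp: coeff_mult coeff_1 intro!: subring_sum[OF assms])

lemma poly_in_subring: "subring A \<Longrightarrow> p \<in> polys_over A \<Longrightarrow> y \<in> A \<Longrightarrow> poly p y \<in> A"
  unfolding poly_altdef polys_over_def by (intro subring_sum) (auto simp: subringD)

lemma hom_on_map_poly:
  assumes "hom_on A h" "subring A"
  shows "hom_on (polys_over A) (map_poly h)"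
  unfolding hom_on_def
proof (intro conjI ballI)
  note h = hom_onD[OF assms]
  show "map_poly h 1 = 1" by (rule poly_eqI) (auto simp: coeff_map_poly h coeff_1)
  fix p q assume "p \<in> polys_over A" "q \<in> polys_over A"
  then have pq: "coeff p i \<in> A" "coeff q i \<in> A" for i by (auto simp: polys_over_def)
  show "map_poly h (p + q) = map_poly h p + map_poly h q"
    by (rule poly_eqI) (simp add: coeff_map_poly h pq)
  show "map_poly h (p * q) = map_poly h p * map_poly h q"
    by (rule poly_eqI)
      (simp add: coeff_map_poly coeff_mult h pq hom_on_sum[OF assms] subringD[OF assms(2)])
qed

section \<open>The field of Puiseux series is algebraically closed\<close>

text \<open>Write \<open>p = P 0 + P 1 s + P 2 s\<^sup>2 + \<dots>\<close> with polynomials \<open>P j\<close> over the field. The factors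
  \<open>G 0 + G 1 s + \<dots>\<close> and \<open>H 0 + H 1 s + \<dots>\<close> are found by comparing coefficients of \<open>s\<^sup>j\<close>, which leads to
  \<open>g0 * H j + h0 * G j = R\<close> with \<open>R\<close> known from smaller indices. Multiplying \<open>a * g0 + b * h0 = 1\<close> by \<open>R\<close>
  gives a solution; the multiple of \<open>g0\<close> in \<open>b * R\<close> is moved to the other factor to keep the degree of
  \<open>G j\<close> below that of \<open>g0\<close>.\<close>

function hensel_factors ::
  "(nat \<Rightarrow> 'a::field poly) \<Rightarrow> 'a poly \<Rightarrow> 'a poly \<Rightarrow> 'a poly \<Rightarrow> 'a poly \<Rightarrow> nat \<Rightarrow> 'a poly \<times> 'a poly" where
  "hensel_factors P a b g0 h0 j = (if j = 0 then (g0, h0) else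
     let R = P j - (\<Sum>i\<in>{1..<j}. fst (hensel_factors P a b g0 h0 i) * snd (hensel_factors P a b g0 h0 (j - i)))
     in ((b * R) mod g0, a * R + h0 * ((b * R) div g0)))"
  by auto
termination by (relation "Wellfounded.measure (\<lambda>(P, a, b, g0, h0, j). j)") auto

declare hensel_factors.simps [simp del]

text \<open>Regards a power series with polynomial coefficients of degree at most \<open>k\<close> as a polynomial with
  power series coefficients.\<close>

definition fps_poly_of_seq :: "nat \<Rightarrow> (nat \<Rightarrow> 'a::comm_ring_1 poly) \<Rightarrow> 'a fps poly" where
  "fps_poly_of_seq k G = (\<Sum>i\<le>k. monom (Abs_fps (\<lambda>j. coeff (G j) i)) i)"

lemma coeff_fps_poly_of_seq:
  assumes "\<And>j. degree (G j) \<le> k"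
  shows "fps_nth (coeff (fps_poly_of_seq k G) i) j = coeff (G j) i"
proof (cases "i \<le> k")
  case True
  then have "coeff (fps_poly_of_seq k G) i = Abs_fps (\<lambda>j. coeff (G j) i)"
    by (simp add: fps_poly_of_seq_def coeff_sum if_distrib cong: if_cong)
  then show ?thesis by simp
next
  case False
  then have "coeff (fps_poly_of_seq k G) i = 0"
    by (auto simp: fps_poly_of_seq_def coeff_sum intro!: sum.neutral)
  moreover have "coeff (G j) i = 0" using False assms[of j] by (intro coeff_eq_0) linarith
  ultimately show ?thesis by simp
qed

lemma degree_fps_poly_of_seq:
  assumes "\<And>j. degree (G j) \<le> k" "coeff (G 0) k \<noteq> 0"
  shows "degree (fps_poly_of_seq k G) = k"
proof (rule antisym)
  show "degree (fps_poly_of_seq k G) \<le> k"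
    unfolding fps_poly_of_seq_def
    by (intro degree_sum_le) (auto intro: order.trans[OF degree_monom_le])
  have "fps_nth (coeff (fps_poly_of_seq k G) k) 0 \<noteq> 0"
    using assms by (simp add: coeff_fps_poly_of_seq)
  then show "k \<le> degree (fps_poly_of_seq k G)" by (intro le_degree) auto
qed

text \<open>Hensel's lemma, in the form that a factorization of the residue polynomial into coprime factors
  lifts. The degree bounds on all \<open>G j\<close> and \<open>H j\<close> are what makes the two factors polynomials.\<close>

lemma hensel_factorization:
  fixes p :: "'a::field fps poly"
  assumes p: "lead_coeff p = 1" "map_poly (\<lambda>f. fps_nth f 0) p = g0 * h0"
    and bezout: "a * g0 + b * h0 = 1" and deg: "degree g0 > 0" "degree h0 > 0"
  obtains g h where "p = g * h" "degree g > 0" "degree h > 0"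
proof -
  define P where "P = (\<lambda>j. map_poly (\<lambda>f. fps_nth f j) p)"
  have coeff_P: "coeff (P j) i = fps_nth (coeff p i) j" for i j
    by (simp add: P_def coeff_map_poly)
  define n where "n = degree p"
  have nz: "g0 \<noteq> 0" "h0 \<noteq> 0" using deg by auto
  have P0: "P 0 = g0 * h0" using p(2) by (simp add: P_def)
  have deg_P0: "degree (P 0) = n"
  proof (rule antisym)
    show "degree (P 0) \<le> n" by (rule degree_le) (simp add: n_def coeff_P coeff_eq_0)
    show "n \<le> degree (P 0)" by (rule le_degree) (use p(1) in \<open>simp add: n_def coeff_P\<close>)
  qed
  then have deg_n: "degree g0 + degree h0 = n" using nz by (simp add: P0 degree_mult_eq)
  have deg_P: "degree (P j) < n" if "j > 0" for j
  proof (rule degree_lessI)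
    show "P j \<noteq> 0 \<or> n > 0" using deg deg_n by simp
    show "\<forall>k\<ge>n. coeff (P j) k = 0"
    proof (intro allI impI)
      fix k assume "n \<le> k"
      then show "coeff (P j) k = 0" using p(1) that by (cases "k = n") (auto simp: coeff_P n_def coeff_eq_0)
    qed
  qed
  define G where "G = (\<lambda>j. fst (hensel_factors P a b g0 h0 j))"
  define H where "H = (\<lambda>j. snd (hensel_factors P a b g0 h0 j))"
  have GH0: "G 0 = g0" "H 0 = h0" by (simp_all add: G_def H_def hensel_factors.simps)
  have conv: "(\<Sum>c=0..j. G c * H (j - c)) = P j \<and> degree (G j) \<le> degree g0 \<and> degree (H j) \<le> degree h0" for j
  proof (induction j rule: less_induct)
    case (less j)
    show ?case
    proof (cases "j = 0")
      case True
      then show ?thesis by (simp add: GH0 P0)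
    next
      case False
      define R where "R = P j - (\<Sum>i\<in>{1..<j}. G i * H (j - i))"
      have G: "G j = (b * R) mod g0" and H: "H j = a * R + h0 * ((b * R) div g0)"
        using False unfolding G_def H_def R_def by (subst hensel_factors.simps; simp add: Let_def)+
      have "g0 * H j + G j * h0 = R * (a * g0) + h0 * (g0 * ((b * R) div g0) + (b * R) mod g0)"
        by (simp only: G H algebra_simps)
      also have "\<dots> = R * (a * g0 + b * h0)"
        unfolding mult_div_mod_eq by (simp only: algebra_simps)
      finally have eq: "g0 * H j + G j * h0 = R" by (simp add: bezout)
      have degG: "degree (G j) < degree g0"
        using deg(1) degree_mod_less[OF nz(1), of "b * R"] by (auto simp: G)
      have degR: "degree R < n"
        unfolding R_def
      proof (intro degree_diff_less deg_P)
        show "0 < j" using False by simp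
        show "degree (\<Sum>i\<in>{1..<j}. G i * H (j - i)) < n"
        proof (rule degree_sum_less)
          fix i assume i: "i \<in> {1..<j}"
          define R' where "R' = P i - (\<Sum>l\<in>{1..<i}. G l * H (i - l))"
          have "G i = (b * R') mod g0"
            using i unfolding G_def H_def R'_def by (subst hensel_factors.simps; simp add: Let_def)+
          then have "degree (G i) < degree g0"
            using deg(1) degree_mod_less[OF nz(1), of "b * R'"] by auto
          moreover have "degree (H (j - i)) \<le> degree h0" using less[of "j - i"] i by auto
          ultimately show "degree (G i * H (j - i)) < n"
            using degree_mult_le[of "G i" "H (j - i)"] deg_n by linarith
        qed (use deg deg_n in simp)
      qed
      have "degree (H j) \<le> degree h0"
      proof (cases "H j = 0")
        case False
        have "g0 * H j = R - G j * h0" using eq by (simp add: algebra_simps)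
        moreover have "degree (G j * h0) < n"
          using degree_mult_le[of "G j" h0] degG deg_n by linarith
        ultimately have "degree (g0 * H j) < n" using degR by (metis degree_diff_less)
        then show ?thesis using False nz deg_n by (simp add: degree_mult_eq)
      qed simp
      moreover have "(\<Sum>c=0..j. G c * H (j - c)) = P j"
      proof -
        have set: "{0..j} = insert 0 (insert j {1..<j})" using False by auto
        have "(\<Sum>c=0..j. G c * H (j - c)) = g0 * H j + G j * h0 + (\<Sum>i\<in>{1..<j}. G i * H (j - i))"
          unfolding set using False by (simp add: GH0 algebra_simps)
        then show ?thesis unfolding eq by (simp add: R_def)
      qed
      ultimately show ?thesis using degG by simp
    qed
  qed
  define g h where "g = fps_poly_of_seq (degree g0) G" and "h = fps_poly_of_seq (degree h0) H"
  show ?thesis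
  proof (rule that)
    show "degree g > 0" "degree h > 0"
      using conv deg nz by (simp_all add: g_def h_def degree_fps_poly_of_seq GH0)
    show "p = g * h"
    proof (rule poly_eqI, rule fps_ext)
      fix i j
      have "fps_nth (coeff (g * h) i) j =
          (\<Sum>u\<le>i. \<Sum>c=0..j. coeff (G c) u * coeff (H (j - c)) (i - u))"
        using conv by (simp add: coeff_mult fps_sum_nth fps_mult_nth g_def h_def coeff_fps_poly_of_seq)
      also have "\<dots> = (\<Sum>c=0..j. \<Sum>u\<le>i. coeff (G c) u * coeff (H (j - c)) (i - u))"
        by (rule sum.swap)
      also have "\<dots> = coeff (\<Sum>c=0..j. G c * H (j - c)) i" by (simp add: coeff_sum coeff_mult)
      also have "\<dots> = fps_nth (coeff p i) j" by (simp only: conv coeff_P)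
      finally show "fps_nth (coeff p i) j = fps_nth (coeff (g * h) i) j" by simp
    qed
  qed
qed

text \<open>The polynomial \<open>1 - u / u(c)\<close> vanishes at \<open>c\<close>, so its \<open>k\<close>-th power is divisible by \<open>(Y - c)\<^sup>k\<close>, and
  it differs from \<open>1\<close> by a multiple of \<open>u\<close>.\<close>

lemma coprime_linear_power_bezout:
  fixes u :: "'a::field poly"
  assumes "poly u c \<noteq> 0"
  obtains a b where "a * [:- c, 1:] ^ k + b * u = 1"
proof -
  define z where "z = 1 - smult (1 / poly u c) u"
  have "poly z c = 0" using assms by (simp add: z_def)
  then obtain y where y: "z = [:- c, 1:] * y" by (auto simp: poly_eq_0_iff_dvd)
  have "1 - z ^ k = (1 - z) * (\<Sum>i<k. z ^ i)" by (rule one_diff_power_eq)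
  also have "1 - z = [:1 / poly u c:] * u" by (simp add: z_def)
  finally have "z ^ k + ([:1 / poly u c:] * (\<Sum>i<k. z ^ i)) * u = 1"
    by (simp add: algebra_simps)
  then have "y ^ k * [:- c, 1:] ^ k + ([:1 / poly u c:] * (\<Sum>i<k. z ^ i)) * u = 1"
    by (simp only: y power_mult_distrib mult.commute[of "y ^ k"])
  then show ?thesis using that by blast
qed

instance puiseux :: (field_char_0) field_char_0
proof
  have of_nat: "puiseux_nth (of_nat n :: 'a puiseux) 0 = of_nat n" for n
    by (induction n) (auto simp: puiseux_nth_add puiseux_nth_one)
  show "inj (of_nat :: nat \<Rightarrow> 'a puiseux)"
    by (rule injI) (metis of_nat of_nat_eq_iff)
qed

lemma puiseux_of_hom:
  assumes "N > 0"
  shows "hom_on UNIV (\<lambda>F. puiseux_of N (fps_to_fls F))"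
  using assms by (simp add: hom_on_def puiseux_of_1 puiseux_of_add puiseux_of_mult fls_times_fps_to_fls)

text \<open>The residue polynomial has no term of degree \<open>n - 1\<close> but another one below the leading term, so
  in characteristic zero it is not the \<open>n\<close>-th power of a linear polynomial. Splitting off all
  occurrences of one of its roots yields a coprime factorization, and Hensel's lemma lifts it.\<close>

lemma puiseux_reducible:
  fixes q :: "'a::{alg_closed_field, field_char_0} puiseux poly"
  assumes deg: "degree q > 1" and monic: "lead_coeff q = 1" and O: "\<And>i. coeff q i \<in> puiseux_O"
    and sub: "coeff q (degree q - 1) = 0" and low: "i0 < degree q" "puiseux_nth (coeff q i0) 0 \<noteq> 0"
  obtains g h where "q = g * h" "degree g > 0" "degree h > 0"
proof -
  define n where "n = degree q"
  have "\<forall>i. \<exists>x. coeff q i = puiseux_emb x" using O by (metis puiseux_O_emb)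
  then obtain x where x: "\<And>i. coeff q i = puiseux_emb (x i)" by metis
  obtain N where N: "N > 0" "\<And>y. y \<in> x ` {..n} \<Longrightarrow> \<exists>F. y = pps_of N F"
    using pps_common_denominator[of "x ` {..n}"] by blast
  then have "\<forall>i\<in>{..n}. \<exists>F. x i = pps_of N F" by blast
  then obtain F where F: "\<And>i. i \<le> n \<Longrightarrow> x i = pps_of N (F i)" by (metis atMost_iff)
  let ?\<phi> = "\<lambda>F. puiseux_of N (fps_to_fls F) :: 'a puiseux"
  note hom = puiseux_of_hom[OF N(1), where 'a = 'a]
  note sub_UNIV = subring_UNIV[where 'a = "'a fps"]
  define Q where "Q = (\<Sum>i<n. monom (F i) i) + monom 1 n"
  have coeff_Q: "coeff Q i = (if i < n then F i else if i = n then 1 else 0)" for i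
    by (auto simp: Q_def coeff_sum)
  have deg_Q: "degree Q = n"
    by (rule antisym) (auto intro!: degree_le le_degree simp: coeff_Q)
  have map_Q: "map_poly ?\<phi> Q = q"
  proof (rule poly_eqI)
    fix i
    have "?\<phi> (coeff Q i) = coeff q i"
      using monic F[of i] x[of i] N(1)
      by (auto simp: coeff_Q puiseux_of_1 puiseux_of_0 puiseux_emb_pps_of n_def coeff_eq_0)
    then show "coeff (map_poly ?\<phi> Q) i = coeff q i"
      by (simp add: coeff_map_poly puiseux_of_0 N(1))
  qed
  define Q0 where "Q0 = map_poly (\<lambda>f. fps_nth f 0) Q"
  have coeff_Q0: "coeff Q0 i = puiseux_nth (coeff q i) 0" for i
  proof -
    have "puiseux_nth (?\<phi> (coeff Q i)) 0 = fps_nth (coeff Q i) 0" using N(1) by (simp add: puiseux_nth_of)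
    moreover have "?\<phi> (coeff Q i) = coeff q i"
      by (subst map_Q[symmetric]) (simp add: coeff_map_poly puiseux_of_0 N(1))
    ultimately show ?thesis by (simp add: Q0_def coeff_map_poly)
  qed
  have deg_Q0: "degree Q0 = n" "lead_coeff Q0 = 1"
  proof -
    have lc: "coeff Q0 n = 1" using monic by (simp add: coeff_Q0 n_def puiseux_nth_one)
    show "degree Q0 = n"
    proof (rule antisym)
      show "degree Q0 \<le> n" by (rule degree_le) (simp add: coeff_Q0 n_def coeff_eq_0)
      show "n \<le> degree Q0" by (rule le_degree) (simp add: lc)
    qed
    with lc show "lead_coeff Q0 = 1" by simp
  qed
  have "degree Q0 > 0" using deg deg_Q0 by (simp add: n_def)
  then obtain c where c: "poly Q0 c = 0" using alg_closed_imp_poly_has_root by blast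
  define k where "k = order c Q0"
  have Q0_nz: "Q0 \<noteq> 0" using deg_Q0 by auto
  have k: "k > 0" using c Q0_nz by (simp add: k_def order_root)
  obtain u where u: "Q0 = [:- c, 1:] ^ k * u" "\<not> [:- c, 1:] dvd u"
    using order_decomp[OF Q0_nz, of c] by (auto simp: k_def)
  have uc: "poly u c \<noteq> 0" using u(2) by (simp add: poly_eq_0_iff_dvd)
  have u_nz: "u \<noteq> 0" using uc by auto
  have deg_pow: "degree ([:- c, 1:] ^ k) = k" by (simp add: degree_power_eq)
  have n_split: "n = k + degree u"
  proof -
    have "degree Q0 = degree ([:- c, 1:] ^ k) + degree u"
      unfolding u(1) using u_nz by (intro degree_mult_eq) auto
    then show ?thesis using deg_Q0 deg_pow by simp
  qed
  have "degree u > 0"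
  proof (rule ccontr)
    \<comment> \<open>The coefficient of \<open>Y\<^sup>n\<^sup>-\<^sup>1\<close> in \<open>(Y - c)\<^sup>n\<close> is \<open>- n c\<close>, so \<open>c = 0\<close> in characteristic zero.\<close>
    assume "\<not> degree u > 0"
    then have kn: "k = n" and "degree u = 0" using n_split by auto
    then obtain e where e: "u = [:e:]" by (meson degree_eq_zeroE)
    have "lead_coeff Q0 = e" 
      unfolding u(1) e by (simp add: lead_coeff_mult lead_coeff_power)
    then have "e = 1" using deg_Q0(2) by simp
    then have Q0: "Q0 = [:- c, 1:] ^ n" using u(1) e kn by simp
    have n: "n > 1" using deg by (simp add: n_def)
    have coeffs: "coeff Q0 i = of_nat (n choose i) * (- c) ^ (n - i)" if "i \<le> n" for i
      unfolding Q0 using that by (simp add: coeff_linear_poly_power)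
    have "coeff Q0 (n - 1) = 0" using sub by (simp add: coeff_Q0 n_def)
    moreover have "n choose (n - 1) = n" using n binomial_symmetric[of 1 n] by simp
    then have "coeff Q0 (n - 1) = of_nat n * (- c)"
      using n coeffs[of "n - 1"] by simp
    ultimately have "c = 0" using n by simp
    then have "coeff Q0 i0 = 0" using coeffs[of i0] low(1) by (simp add: n_def)
    then show False using low(2) by (simp add: coeff_Q0)
  qed
  obtain a b where "a * [:- c, 1:] ^ k + b * u = 1"
    using coprime_linear_power_bezout[OF uc] by blast
  then obtain g h where gh: "Q = g * h" "degree g > 0" "degree h > 0"
    using hensel_factorization[of Q "[:- c, 1:] ^ k" u a b] deg_Q u(1) k \<open>degree u > 0\<close>
    by (metis Q0_def coeff_Q deg_pow less_irrefl)
  have "q = map_poly ?\<phi> g * map_poly ?\<phi> h"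
    unfolding map_Q[symmetric] gh(1)
    using hom_onD(4)[OF hom_on_map_poly[OF hom sub_UNIV] subring_polys_over[OF sub_UNIV], of g h]
    by (simp add: polys_over_def)
  moreover have "degree (map_poly ?\<phi> f) = degree f" for f
  proof -
    have "?\<phi> F \<noteq> 0" if F: "F \<noteq> 0" for F
    proof -
      obtain i where "fps_nth F i \<noteq> 0" using F fps_nonzero_nth by blast
      then have "puiseux_nth (?\<phi> F) (of_nat i / of_nat N) \<noteq> 0" using N(1) by (simp add: puiseux_nth_of)
      then show ?thesis by auto
    qed
    then show ?thesis by (rule degree_map_poly)
  qed
  ultimately show ?thesis using that gh by metis
qed

instance puiseux :: ("{alg_closed_field, field_char_0}") alg_closed_field
proof (rule alg_closedI_reducible_coeff_deg_minus_one_eq_0)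
  fix p :: "'a puiseux poly"
  assume p: "degree p > 1" "lead_coeff p = 1" "coeff p (degree p - 1) = 0" "coeff p 0 \<noteq> 0"
  define n where "n = degree p"
  define S where "S = {i. i < n \<and> coeff p i \<noteq> 0}"
  have S: "finite S" "S \<noteq> {}" using p(1,4) by (auto simp: S_def n_def intro: exI[of _ 0])
  have "\<forall>i\<in>S. \<exists>m. puiseux_nth (coeff p i) m \<noteq> 0 \<and> (\<forall>q. puiseux_nth (coeff p i) q \<noteq> 0 \<longrightarrow> m \<le> q)"
    by (auto simp: S_def) (metis puiseux_least_exponent)
  then obtain v where v: "\<And>i. i \<in> S \<Longrightarrow> puiseux_nth (coeff p i) (v i) \<noteq> 0"
    "\<And>i q. i \<in> S \<Longrightarrow> puiseux_nth (coeff p i) q \<noteq> 0 \<Longrightarrow> v i \<le> q"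
    by metis
  \<comment> \<open>The least slope of the Newton polygon: after \<open>Y \<mapsto> t\<^sup>r Y\<close> all coefficients are integral and
    one of them besides the leading one is a unit.\<close>
  define r where "r = Min ((\<lambda>i. v i / of_nat (n - i)) ` S)"
  have r_le: "r \<le> v i / of_nat (n - i)" if "i \<in> S" for i
    using that S unfolding r_def by (intro Min_le) auto
  have "r \<in> (\<lambda>i. v i / of_nat (n - i)) ` S" unfolding r_def using S by (intro Min_in) auto
  then obtain i0 where i0: "i0 \<in> S" "r = v i0 / of_nat (n - i0)" by blast
  define q where "q = smult (tpow (- (of_nat n * r))) (pcompose p [:0, tpow r:])"
  have coeff_q: "coeff q i = tpow (- (of_nat n * r) + of_nat i * r) * coeff p i" for i
    by (simp add: q_def coeff_pcompose_linear tpow_power tpow_add flip: mult.assoc)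
  have q_shift: "puiseux_nth (coeff q i) e = puiseux_nth (coeff p i) (e + of_nat (n - i) * r)" if "i \<le> n" for i e
    using that unfolding coeff_q puiseux_nth_tpow_times by (simp add: of_nat_diff algebra_simps)
  have deg_q: "degree q = n" by (simp add: q_def degree_pcompose n_def)
  have "coeff q n = 1"
  proof -
    have "coeff q n = coeff p n" unfolding coeff_q by simp
    then show ?thesis using p(2) by (simp add: n_def)
  qed
  have O: "coeff q i \<in> puiseux_O" for i
  proof (cases "i \<in> S")
    case True
    then have i: "i < n" by (simp add: S_def)
    then have "of_nat (n - i) * r \<le> v i" using r_le[OF True] by (simp add: field_simps)
    then show ?thesis
      unfolding puiseux_O_def mem_Collect_eq q_shift[OF less_imp_le[OF i]] using v(2)[OF True] by force
  next
    case False
    then have "coeff q i = 0 \<or> i = n"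
      using deg_q by (auto simp: S_def coeff_q n_def coeff_eq_0 not_less le_less)
    then show ?thesis using \<open>coeff q n = 1\<close> by auto
  qed
  obtain g h where gh: "q = g * h" "degree g > 0" "degree h > 0"
  proof (rule puiseux_reducible[of q i0])
    show "degree q > 1" "lead_coeff q = 1" "coeff q (degree q - 1) = 0" "i0 < degree q"
      using p i0 \<open>coeff q n = 1\<close> by (simp_all add: deg_q coeff_q n_def S_def)
    have "i0 < n" using i0 by (simp add: S_def)
    then have "of_nat (n - i0) * r = v i0" using i0(2) by simp
    then show "puiseux_nth (coeff q i0) 0 \<noteq> 0"
      using v(1)[OF i0(1)] q_shift[of i0 0] \<open>i0 < n\<close> by simp
  qed (use O in auto)
  have inv: "pcompose (pcompose f [:0, tpow r:]) [:0, tpow (- r):] = f" for f :: "'a puiseux poly"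
    by (simp add: pcompose_pCons tpow_add flip: pcompose_assoc)
  have "p = smult (tpow (of_nat n * r)) (pcompose q [:0, tpow (- r):])"
    unfolding q_def pcompose_smult inv by (simp add: tpow_add)
  then have "p = smult (tpow (of_nat n * r)) (pcompose g [:0, tpow (- r):]) * pcompose h [:0, tpow (- r):]"
    by (simp add: gh(1) pcompose_mult)
  moreover have "degree (smult (tpow (of_nat n * r)) (pcompose g [:0, tpow (- r):])) > 0"
    "degree (pcompose h [:0, tpow (- r):]) > 0"
    using gh by (simp_all add: degree_pcompose)
  ultimately show "\<not> irreducible p" by (intro reducible_polyI)
qed

section \<open>Extending homomorphisms along finite extensions\<close>

definition ideal_on :: "'a::comm_ring_1 set \<Rightarrow> 'a set \<Rightarrow> bool" where
  "ideal_on A I \<longleftrightarrow> I \<subseteq> A \<and> 0 \<in> I \<and> (\<forall>x\<in>I. \<forall>y\<in>I. x + y \<in> I) \<and> (\<forall>a\<in>A. \<forall>x\<in>I. a * x \<in> I)"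

lemma ideal_onD:
  assumes "ideal_on A I" "subring A"
  shows "x \<in> I \<Longrightarrow> x \<in> A" "0 \<in> I" "x \<in> I \<Longrightarrow> y \<in> I \<Longrightarrow> x + y \<in> I"
    "a \<in> A \<Longrightarrow> x \<in> I \<Longrightarrow> a * x \<in> I" "a \<in> A \<Longrightarrow> x \<in> I \<Longrightarrow> x * a \<in> I" "x \<in> I \<Longrightarrow> - x \<in> I"
    "x \<in> I \<Longrightarrow> y \<in> I \<Longrightarrow> x - y \<in> I"
proof -
  note I = assms(1)[unfolded ideal_on_def]
  show "x \<in> I \<Longrightarrow> x \<in> A" "0 \<in> I" using I by auto
  show add: "x \<in> I \<Longrightarrow> y \<in> I \<Longrightarrow> x + y \<in> I" for x y using I by blast
  show mult: "a \<in> A \<Longrightarrow> x \<in> I \<Longrightarrow> a * x \<in> I" for a x using I by blast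
  show "a \<in> A \<Longrightarrow> x \<in> I \<Longrightarrow> x * a \<in> I" using mult by (simp add: mult.commute)
  have "- 1 \<in> A" using subringD[OF assms(2)] by blast
  then show neg: "x \<in> I \<Longrightarrow> - x \<in> I" for x using mult[of "- 1" x] by simp
  show "x \<in> I \<Longrightarrow> y \<in> I \<Longrightarrow> x - y \<in> I" using add[of x "- y"] neg by simp
qed

lemma ideal_on_sum: "ideal_on A I \<Longrightarrow> (\<And>i. i \<in> S \<Longrightarrow> f i \<in> I) \<Longrightarrow> sum f S \<in> I"
  by (induction S rule: infinite_finite_induct) (auto simp: ideal_on_def)

text \<open>This is Nakayama's lemma over the localization of \<open>B\<close> at the prime ideal \<open>ker \<psi>\<close>, with denominators
  cleared: if the module generated by the \<open>m j\<close> modulo \<open>I\<close> is contained in \<open>ker \<psi>\<close> times itself, then it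
  vanishes. The generators are eliminated one at a time, since the last relation has the coefficient
  \<open>e\<close> outside \<open>ker \<psi>\<close> in front of its own generator.\<close>

lemma nakayama_kernel:
  fixes \<psi> :: "'a::comm_ring_1 \<Rightarrow> 'b::idom" and m :: "nat \<Rightarrow> 'a"
  assumes B: "subring B" "B \<subseteq> C" and C: "subring C" and I: "ideal_on C I" and \<psi>: "hom_on B \<psi>"
    and m: "\<And>j. m j \<in> C"
    and rel: "\<And>j. j < k \<Longrightarrow> \<exists>a\<in>B. \<exists>n. \<psi> a \<noteq> 0 \<and> (\<forall>i. n i \<in> B \<and> \<psi> (n i) = 0) \<and>
      a * m j - (\<Sum>i<k. n i * m i) \<in> I"
  shows "\<exists>b\<in>B. \<psi> b \<noteq> 0 \<and> (\<forall>j<k. b * m j \<in> I)"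
  using rel
proof (induction k)
  case 0
  show ?case using subringD(1)[OF B(1)] hom_onD(1)[OF \<psi> B(1)] by (intro bexI[of _ 1]) auto
next
  case (Suc k)
  note Bs = subringD[OF B(1)] and h = hom_onD[OF \<psi> B(1)] and Is = ideal_onD[OF I C]
  obtain a n where a: "a \<in> B" "\<psi> a \<noteq> 0" and n: "\<And>i. n i \<in> B" "\<And>i. \<psi> (n i) = 0"
    and rel_k: "a * m k - (\<Sum>i<Suc k. n i * m i) \<in> I"
    using Suc.prems[of k] by blast
  define e where "e = a - n k"
  have e: "e \<in> B" "\<psi> e \<noteq> 0" using a n by (simp_all add: e_def Bs h)
  have em: "e * m k - (\<Sum>i<k. n i * m i) \<in> I" using rel_k by (simp add: e_def algebra_simps)
  have "\<exists>b\<in>B. \<psi> b \<noteq> 0 \<and> (\<forall>j<k. b * m j \<in> I)"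
  proof (rule Suc.IH)
    fix j assume "j < k"
    then obtain a' n' where a': "a' \<in> B" "\<psi> a' \<noteq> 0" and n': "\<And>i. n' i \<in> B" "\<And>i. \<psi> (n' i) = 0"
      and rel_j: "a' * m j - (\<Sum>i<Suc k. n' i * m i) \<in> I"
      using Suc.prems[of j] by (meson less_SucI)
    have "e * (a' * m j - (\<Sum>i<Suc k. n' i * m i)) + n' k * (e * m k - (\<Sum>i<k. n i * m i)) \<in> I"
      by (rule Is(3)[OF Is(4) Is(4)]) (use rel_j em e(1) n'(1) B(2) in blast)+
    also have "e * (a' * m j - (\<Sum>i<Suc k. n' i * m i)) + n' k * (e * m k - (\<Sum>i<k. n i * m i)) =
        (e * a') * m j - (\<Sum>i<k. (e * n' i + n' k * n i) * m i)"
      by (simp add: algebra_simps sum.distrib sum_distrib_left)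
    finally show "\<exists>a\<in>B. \<exists>n. \<psi> a \<noteq> 0 \<and> (\<forall>i. n i \<in> B \<and> \<psi> (n i) = 0) \<and> a * m j - (\<Sum>i<k. n i * m i) \<in> I"
      using e a' n n' by (intro bexI[of _ "e * a'"] exI[of _ "\<lambda>i. e * n' i + n' k * n i"]) (auto simp: Bs h)
  qed
  then obtain b where b: "b \<in> B" "\<psi> b \<noteq> 0" "\<And>j. j < k \<Longrightarrow> b * m j \<in> I" by blast
  have "(b * e) * m j \<in> I" if "j < Suc k" for j
  proof (cases "j = k")
    case True
    have "b * (e * m k - (\<Sum>i<k. n i * m i)) + (\<Sum>i<k. n i * (b * m i)) \<in> I"
      by (rule Is(3)[OF Is(4) ideal_on_sum[OF I Is(4)]]) (use em b n B(2) in auto)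
    also have "b * (e * m k - (\<Sum>i<k. n i * m i)) + (\<Sum>i<k. n i * (b * m i)) = (b * e) * m k"
      by (simp add: algebra_simps sum_distrib_left)
    finally show ?thesis by (simp add: True)
  next
    case False
    then have "e * (b * m j) \<in> I" using that b(3)[of j] e(1) B(2) by (intro Is(4)[of e "b * m j"]) auto
    then show ?thesis by (simp add: mult_ac)
  qed
  then show ?case using b e by (intro bexI[of _ "b * e"]) (auto simp: Bs h)
qed

lemma poly_eq_sum_lessThan:
  fixes p :: "'a::comm_ring_1 poly"
  assumes "\<And>i. i \<ge> d \<Longrightarrow> coeff p i = 0"
  shows "poly p y = (\<Sum>i<d. coeff p i * y ^ i)"
proof -
  have "poly p y = (\<Sum>i\<le>degree p. coeff p i * y ^ i)" by (simp add: poly_altdef)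
  also have "\<dots> = (\<Sum>i\<le>max d (degree p). coeff p i * y ^ i)"
    by (rule sum.mono_neutral_left) (auto simp: coeff_eq_0)
  also have "\<dots> = (\<Sum>i<d. coeff p i * y ^ i)"
    by (rule sum.mono_neutral_right) (auto simp: assms)
  finally show ?thesis .
qed

text \<open>Modulo \<open>I\<close> the ring \<open>C\<close> is \<open>B[y]\<close> and is a finitely generated module over \<open>B\<close>. An extension that sends \<open>y\<close>
  to \<open>c\<close> exists as soon as \<open>c\<close> is a root of the image under \<open>\<psi>\<close> of every polynomial \<open>G\<close> over \<open>B\<close> with
  \<open>G(y) \<in> I\<close>. By pseudo-division a non-zero such image of least degree divides all the others up to
  non-zero factors, so any of its roots will do. Its degree is positive: otherwise a relation
  \<open>G(y) \<in> I\<close> with invertible constant term and the other coefficients in \<open>ker \<psi>\<close> would, by Nakayama's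
  lemma, produce an element of \<open>B \<inter> I\<close> outside \<open>ker \<psi>\<close>.\<close>

lemma extend_hom_finite:
  fixes \<psi> :: "'a::comm_ring_1 \<Rightarrow> 'b::alg_closed_field"
  assumes B: "subring B" "B \<subseteq> C" and C: "subring C" and I: "ideal_on C I" and y: "y \<in> C"
    and \<psi>: "hom_on B \<psi>" "\<And>x. x \<in> B \<Longrightarrow> x \<in> I \<Longrightarrow> \<psi> x = 0"
    and span: "\<And>g. g \<in> C \<Longrightarrow> \<exists>p\<in>polys_over B. (\<forall>i\<ge>d. coeff p i = 0) \<and> g - poly p y \<in> I"
  obtains \<Psi> where "hom_on C \<Psi>" "\<And>x. x \<in> B \<Longrightarrow> \<Psi> x = \<psi> x" "\<And>x. x \<in> I \<Longrightarrow> \<Psi> x = 0"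
proof -
  note Bs = subringD[OF B(1)] and h = hom_onD[OF \<psi>(1) B(1)] and Is = ideal_onD[OF I C]
    and Cs = subringD[OF C]
  note PB = subring_polys_over[OF B(1)]
  note PBs = subringD[OF PB] and hp = hom_onD[OF hom_on_map_poly[OF \<psi>(1) B(1)] PB]
  define \<G> where "\<G> = {G \<in> polys_over B. poly G y \<in> I}"
  have coeff_map: "coeff (map_poly \<psi> p) i = \<psi> (coeff p i)" for p i by (simp add: coeff_map_poly h)
  have poly_C: "poly p y \<in> C" if "p \<in> polys_over B" for p
    using that B(2) y by (intro poly_in_subring[OF C]) (auto simp: polys_over_def)
  \<comment> \<open>A relation whose image under \<open>\<psi>\<close> is a non-zero constant contradicts Nakayama's lemma.\<close>
  have no_unit: False if hG: "hp \<in> \<G>" "\<psi> (coeff hp 0) \<noteq> 0" "\<And>i. i > 0 \<Longrightarrow> \<psi> (coeff hp i) = 0" for hp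
  proof -
    have hpB: "coeff hp i \<in> B" for i using hG(1) by (simp add: \<G>_def polys_over_def)
    have "\<exists>P\<in>polys_over B. (\<forall>i\<ge>d. coeff P i = 0) \<and> y ^ k - poly P y \<in> I" for k
      by (rule span) (simp add: Cs y)
    then obtain P where P: "\<And>k. P k \<in> polys_over B" "\<And>k i. i \<ge> d \<Longrightarrow> coeff (P k) i = 0"
      "\<And>k. y ^ k - poly (P k) y \<in> I" by metis
    have P_eval: "poly (P k) y = (\<Sum>l<d. coeff (P k) l * y ^ l)" for k
      by (rule poly_eq_sum_lessThan) (rule P(2))
    define D where "D = degree hp"
    have "\<exists>b\<in>B. \<psi> b \<noteq> 0 \<and> (\<forall>j<d. b * y ^ j \<in> I)"
    proof (rule nakayama_kernel[OF B C I \<psi>(1)])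
      fix j assume "j < d"
      \<comment> \<open>Multiply the relation by \<open>y\<^sup>j\<close> and reduce the powers of \<open>y\<close> other than \<open>y\<^sup>j\<close> modulo \<open>I\<close>.\<close>
      define n where "n = (\<lambda>l. - (\<Sum>i\<in>{0<..D}. coeff hp i * coeff (P (i + j)) l))"
      have "y ^ j * poly hp y - (\<Sum>i\<in>{0<..D}. coeff hp i * (y ^ (i + j) - poly (P (i + j)) y)) \<in> I"
        by (rule Is(7)[OF Is(4) ideal_on_sum[OF I Is(4)]])
          (use hG(1) P(3) hpB B(2) y in \<open>auto simp: \<G>_def Cs\<close>)
      also have "y ^ j * poly hp y = coeff hp 0 * y ^ j + (\<Sum>i\<in>{0<..D}. coeff hp i * y ^ (i + j))"
      proof -
        have "poly hp y = (\<Sum>i\<in>insert 0 {0<..D}. coeff hp i * y ^ i)"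
          unfolding poly_altdef D_def by (rule sum.cong) auto
        then show ?thesis by (simp add: algebra_simps sum_distrib_left power_add)
      qed
      also have "coeff hp 0 * y ^ j + (\<Sum>i\<in>{0<..D}. coeff hp i * y ^ (i + j)) -
          (\<Sum>i\<in>{0<..D}. coeff hp i * (y ^ (i + j) - poly (P (i + j)) y)) =
          coeff hp 0 * y ^ j + (\<Sum>i\<in>{0<..D}. coeff hp i * poly (P (i + j)) y)"
        by (simp add: algebra_simps sum.distrib sum_subtractf)
      also have "(\<Sum>i\<in>{0<..D}. coeff hp i * poly (P (i + j)) y) = - (\<Sum>l<d. n l * y ^ l)"
        unfolding P_eval n_def
        by (simp add: sum_distrib_left sum_distrib_right sum_negf mult.assoc) (rule sum.swap)
      finally have "coeff hp 0 * y ^ j - (\<Sum>l<d. n l * y ^ l) \<in> I" by simp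
      moreover have nB: "n l \<in> B" for l
        unfolding n_def using hpB P(1) by (auto simp: polys_over_def intro!: Bs subring_sum[OF B(1)])
      moreover have "\<psi> (n l) = 0" for l
      proof -
        have prod: "coeff hp i * coeff (P (i + j)) l \<in> B" for i
          using hpB P(1) by (auto simp: polys_over_def intro!: Bs)
        have "\<psi> (n l) = - (\<Sum>i\<in>{0<..D}. \<psi> (coeff hp i * coeff (P (i + j)) l))"
          unfolding n_def using prod
          by (simp add: h(5) subring_sum[OF B(1)] hom_on_sum[OF \<psi>(1) B(1)])
        also have "\<dots> = 0"
          using hG(3) hpB P(1) by (auto simp: h polys_over_def intro!: sum.neutral)
        finally show ?thesis .
      qed
      ultimately show "\<exists>a\<in>B. \<exists>n. \<psi> a \<noteq> 0 \<and> (\<forall>i. n i \<in> B \<and> \<psi> (n i) = 0) \<and>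
          a * y ^ j - (\<Sum>i<d. n i * y ^ i) \<in> I"
        using hG(2) hpB by blast
    qed (use y in \<open>simp add: Cs\<close>)
    then obtain b where b: "b \<in> B" "\<psi> b \<noteq> 0" "\<And>j. j < d \<Longrightarrow> b * y ^ j \<in> I" by blast
    have "b * (y ^ 0 - poly (P 0) y) + (\<Sum>l<d. coeff (P 0) l * (b * y ^ l)) \<in> I"
      by (rule Is(3)[OF Is(4) ideal_on_sum[OF I Is(4)]])
        (use b P(1,3)[of 0] B(2) in \<open>auto simp: polys_over_def\<close>)
    also have "b * (y ^ 0 - poly (P 0) y) + (\<Sum>l<d. coeff (P 0) l * (b * y ^ l)) = b"
      unfolding P_eval by (simp add: algebra_simps sum_distrib_left)
    finally show False using \<psi>(2) b by blast
  qed
  have "\<exists>c. \<forall>G\<in>\<G>. poly (map_poly \<psi> G) c = 0"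
  proof (cases "\<exists>G\<in>\<G>. map_poly \<psi> G \<noteq> 0")
    case True
    define e where "e = (LEAST e. \<exists>G\<in>\<G>. map_poly \<psi> G \<noteq> 0 \<and> degree (map_poly \<psi> G) = e)"
    have "\<exists>G\<in>\<G>. map_poly \<psi> G \<noteq> 0 \<and> degree (map_poly \<psi> G) = e"
      unfolding e_def by (rule LeastI_ex) (use True in blast)
    then obtain H where H: "H \<in> \<G>" "map_poly \<psi> H \<noteq> 0" "degree (map_poly \<psi> H) = e" by blast
    have min: "e \<le> degree (map_poly \<psi> G)" if "G \<in> \<G>" "map_poly \<psi> G \<noteq> 0" for G
      unfolding e_def by (rule Least_le) (use that in blast)
    have lcH: "\<psi> (coeff H e) \<noteq> 0" using H(2,3) leading_coeff_0_iff[of "map_poly \<psi> H"] by (simp add: coeff_map)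
    have "e > 0"
    proof (rule ccontr)
      assume "\<not> e > 0"
      then have "\<psi> (coeff H i) = 0" if "i > 0" for i
        using that H(3) coeff_map[of H i] by (metis coeff_eq_0 gr0I)
      with \<open>\<not> e > 0\<close> lcH no_unit[OF H(1)] show False by auto
    qed
    then obtain c where c: "poly (map_poly \<psi> H) c = 0"
      using alg_closed_imp_poly_has_root[of "map_poly \<psi> H"] H(3) by auto
    have "poly (map_poly \<psi> G) c = 0" if "G \<in> \<G>" for G
      using that
    proof (induction "degree (map_poly \<psi> G)" arbitrary: G rule: less_induct)
      case less
      show ?case
      proof (cases "map_poly \<psi> G = 0")
        case False
        define f where "f = degree (map_poly \<psi> G)"
        have "e \<le> f" using min less.prems False by (simp add: f_def)
        have mem: "H \<in> polys_over B" "G \<in> polys_over B" "poly H y \<in> I" "poly G y \<in> I"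
          using H(1) less.prems by (auto simp: \<G>_def)
        define u v where "u = coeff H e" and "v = coeff G f"
        have uv: "u \<in> B" "v \<in> B" using mem by (auto simp: u_def v_def polys_over_def)
        have mon: "[:u:] \<in> polys_over B" "monom v (f - e) \<in> polys_over B"
          using uv Bs by (auto simp: polys_over_def coeff_pCons split: nat.splits)
        \<comment> \<open>One step of pseudo-division of \<open>G\<close> by \<open>H\<close>.\<close>
        define G' where "G' = [:u:] * G - monom v (f - e) * H"
        have "poly G' y = u * poly G y - (v * y ^ (f - e)) * poly H y"
          by (simp add: G'_def poly_monom)
        also have "\<dots> \<in> I"
          by (rule Is(7)[OF Is(4) Is(4)]) (use mem uv B(2) y in \<open>auto intro!: Cs\<close>)
        finally have "poly G' y \<in> I" .
        moreover have "G' \<in> polys_over B" unfolding G'_def using mem mon by (intro PBs)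
        ultimately have G': "G' \<in> \<G>" by (simp add: \<G>_def)
        have map_G': "map_poly \<psi> G' = [:\<psi> u:] * map_poly \<psi> G - monom (\<psi> v) (f - e) * map_poly \<psi> H"
        proof -
          have "map_poly \<psi> [:u:] = [:\<psi> u:]" "map_poly \<psi> (monom v (f - e)) = monom (\<psi> v) (f - e)"
            by (auto simp: poly_eq_iff coeff_map coeff_pCons h split: nat.splits)
          then show ?thesis using mem mon by (simp only: G'_def hp PBs)
        qed
        have "poly (map_poly \<psi> G') c = 0"
        proof (cases "map_poly \<psi> G' = 0")
          case False
          have "degree (map_poly \<psi> G') < f"
          proof (rule degree_lessI)
            show "map_poly \<psi> G' \<noteq> 0 \<or> 0 < f" using False by simp
            show "\<forall>k\<ge>f. coeff (map_poly \<psi> G') k = 0"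
            proof (intro allI impI)
              fix k assume k: "k \<ge> f"
              have G_k: "coeff (map_poly \<psi> G) k = (if k = f then \<psi> v else 0)"
                using k by (auto simp: v_def coeff_map f_def intro: coeff_eq_0) (metis coeff_eq_0 coeff_map le_neq_implies_less)
              have "coeff (map_poly \<psi> H) (k - (f - e)) = (if k = f then \<psi> u else 0)"
                using k \<open>e \<le> f\<close> H(3) by (auto simp: u_def coeff_map[symmetric] intro!: coeff_eq_0)
              then show "coeff (map_poly \<psi> G') k = 0"
                using G_k k less_le_trans[of k "f - e" f]
                by (auto simp: map_G' coeff_monom_mult)
            qed
          qed
          then show ?thesis using less.hyps[of G'] G' by (simp add: f_def)
        qed simp
        then show ?thesis using c lcH by (simp add: map_G' u_def)
      qed simp
    qed
    then show ?thesis by blast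
  qed auto
  then obtain c where c: "\<And>G. G \<in> \<G> \<Longrightarrow> poly (map_poly \<psi> G) c = 0" by blast
  define \<Psi> where "\<Psi> = (\<lambda>g. poly (map_poly \<psi> (SOME G. G \<in> polys_over B \<and> g - poly G y \<in> I)) c)"
  have \<Psi>: "\<Psi> g = poly (map_poly \<psi> G) c" if G: "G \<in> polys_over B" "g - poly G y \<in> I" for g G
  proof -
    define G1 where "G1 = (SOME G. G \<in> polys_over B \<and> g - poly G y \<in> I)"
    have G1: "G1 \<in> polys_over B \<and> g - poly G1 y \<in> I"
      unfolding G1_def by (rule someI[of _ G]) (use G in blast)
    have "poly (G1 - G) y = (g - poly G y) - (g - poly G1 y)" by simp
    also have "\<dots> \<in> I" by (rule Is(7)) (use G G1 in auto)
    finally have "G1 - G \<in> \<G>" using G G1 by (simp add: \<G>_def PBs)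
    then have "poly (map_poly \<psi> (G1 - G)) c = 0" by (rule c)
    then show ?thesis using G G1 by (simp add: \<Psi>_def hp flip: G1_def)
  qed
  have rep: "\<exists>G. G \<in> polys_over B \<and> g - poly G y \<in> I" if "g \<in> C" for g using span[OF that] by blast
  show ?thesis
  proof (rule that[of \<Psi>])
    show "hom_on C \<Psi>"
      unfolding hom_on_def
    proof (intro conjI ballI)
      show "\<Psi> 1 = 1" using \<Psi>[of 1 1] by (simp add: PBs hp Is)
      fix x z assume xz: "x \<in> C" "z \<in> C"
      obtain X Z where X: "X \<in> polys_over B" "x - poly X y \<in> I" and Z: "Z \<in> polys_over B" "z - poly Z y \<in> I"
        using rep xz by metis
      have "x + z - poly (X + Z) y = (x - poly X y) + (z - poly Z y)" by simp
      also have "\<dots> \<in> I" by (rule Is(3)[OF X(2) Z(2)])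
      finally show "\<Psi> (x + z) = \<Psi> x + \<Psi> z" using X Z by (simp add: \<Psi>[OF X] \<Psi>[OF Z] \<Psi>[of "X + Z"] PBs hp)
      have "x * z - poly (X * Z) y = z * (x - poly X y) + poly X y * (z - poly Z y)"
        by (simp add: algebra_simps)
      also have "\<dots> \<in> I" by (rule Is(3)[OF Is(4) Is(4)]) (use X Z xz poly_C in auto)
      finally show "\<Psi> (x * z) = \<Psi> x * \<Psi> z" using X Z by (simp add: \<Psi>[OF X] \<Psi>[OF Z] \<Psi>[of "X * Z"] PBs hp)
    qed
    show "\<Psi> x = \<psi> x" if "x \<in> B" for x
    proof -
      have "[:x:] \<in> polys_over B" using that Bs by (auto simp: polys_over_def coeff_pCons split: nat.splits)
      moreover have "map_poly \<psi> [:x:] = [:\<psi> x:]"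
        by (auto simp: poly_eq_iff coeff_map coeff_pCons h split: nat.splits)
      ultimately show ?thesis using \<Psi>[of "[:x:]" x] by (simp add: Is)
    qed
    show "\<Psi> x = 0" if "x \<in> I" for x
      using \<Psi>[of 0 x] that by (simp add: PBs hp)
  qed
qed

section \<open>Weierstrass division\<close>

definition pps_over :: "'a::comm_ring_1 set \<Rightarrow> 'a pps set" where
  "pps_over A = {x. \<forall>q. pps_nth x q \<in> A}"

lemma subring_pps_over:
  assumes "subring A"
  shows "subring (pps_over A)"
  unfolding subring_def
proof (intro conjI ballI)
  note A = subringD[OF assms]
  show "1 \<in> pps_over A" using A by (simp add: pps_over_def nth_one_pps)
  fix x y assume "x \<in> pps_over A" "y \<in> pps_over A"
  then have xy: "pps_nth x q \<in> A" "pps_nth y q \<in> A" for q by (auto simp: pps_over_def)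
  show "x - y \<in> pps_over A" using xy A by (simp add: pps_over_def nth_minus_pps)
  have "pps_nth (x * y) q \<in> A" for q
  proof -
    have "pps_nth (x * y) q = (\<Sum>a\<in>{a. pps_nth x a \<noteq> 0 \<and> a \<le> q}. pps_nth x a * pps_nth y (q - a))"
      by (rule nth_times_pps) (use nth_neg_pps[of _ y] in \<open>force simp: finite_pps_support_below\<close>)+
    also have "\<dots> \<in> A" using xy A by (intro subring_sum[OF assms]) auto
    finally show ?thesis .
  qed
  then show "x * y \<in> pps_over A" by (simp add: pps_over_def)
qed

lemma pps_of_over: "N > 0 \<Longrightarrow> subring A \<Longrightarrow> pps_of N F \<in> pps_over A \<longleftrightarrow> (\<forall>i. fps_nth F i \<in> A)"
  unfolding pps_over_def
proof safe
  fix i assume "N > 0" "\<forall>q. pps_nth (pps_of N F) q \<in> A"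
  then show "fps_nth F i \<in> A" using nth_pps_of_div[of N F i] by metis
next
  fix q assume "N > 0" "subring A" "\<forall>i. fps_nth F i \<in> A"
  then show "pps_nth (pps_of N F) q \<in> A" by (auto simp: nth_pps_of subringD)
qed

lemma unit_lead_division:
  assumes A: "subring A" and P: "P \<in> polys_over A" "\<And>i. i > d \<Longrightarrow> coeff P i = 0"
    and unit: "v \<in> A" "v * coeff P d = 1"
    and G: "G \<in> polys_over A"
  shows "\<exists>Q\<in>polys_over A. \<exists>R\<in>polys_over A. G = Q * P + R \<and> (\<forall>i\<ge>d. coeff R i = 0)"
proof -
  note PAs = subringD[OF subring_polys_over[OF A]]
  have "\<exists>Q\<in>polys_over A. \<exists>R\<in>polys_over A. G = Q * P + R \<and> (\<forall>i\<ge>d. coeff R i = 0)"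
    if "\<forall>i\<ge>n. coeff G i = 0" for n
    using that G
  proof (induction n arbitrary: G)
    case 0
    then have "G = 0" by (simp add: poly_eq_iff)
    then show ?case by (intro bexI[of _ 0]) (auto simp: PAs)
  next
    case (Suc m)
    show ?case
    proof (cases "Suc m \<le> d")
      case True
      then show ?thesis using Suc.prems by (intro bexI[of _ 0] bexI[of _ G]) (auto simp: PAs)
    next
      case False
      then have md: "d \<le> m" by simp
      define M where "M = monom (v * coeff G m) (m - d)"
      have M: "M \<in> polys_over A"
        using Suc.prems(2) unit(1) subringD[OF A] by (auto simp: M_def polys_over_def)
      have "coeff (G - M * P) i = 0" if "i \<ge> m" for i
      proof (cases "i = m")
        case True
        have "v * coeff G m * coeff P d = coeff G m * (v * coeff P d)" by (simp add: mult_ac)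
        then show ?thesis using md unit(2) by (simp add: True M_def coeff_monom_mult)
      next
        case False
        then have "coeff G i = 0" using that Suc.prems(1) by simp
        moreover have "coeff P (i - (m - d)) = 0" using False that md by (intro P(2)) linarith
        ultimately show ?thesis by (simp add: M_def coeff_monom_mult)
      qed
      then obtain Q R where QR: "Q \<in> polys_over A" "R \<in> polys_over A" "G - M * P = Q * P + R"
        "\<forall>i\<ge>d. coeff R i = 0"
        using Suc.IH[of "G - M * P"] PAs(5)[OF Suc.prems(2) PAs(6)[OF M P(1)]] by blast
      have "G = (Q + M) * P + R" using QR(3) by (simp add: algebra_simps)
      then show ?thesis using QR M by (intro bexI[of _ "Q + M"] bexI[of _ R]) (auto simp: PAs)
    qed
  qed
  from this[of "Suc (degree G)"] show ?thesis by (simp add: coeff_eq_0)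
qed

text \<open>The coefficients of the quotient of \<open>G\<close> by \<open>F\<close>, where \<open>dv\<close> computes quotients by the constant term of
  \<open>F\<close> in the coefficient ring: what the earlier coefficients have not yet accounted for in degree \<open>k\<close>
  is divided by that constant term.\<close>

function weierstrass_quotient ::
  "('a::comm_ring_1 \<Rightarrow> 'a) \<Rightarrow> 'a fps \<Rightarrow> 'a fps \<Rightarrow> nat \<Rightarrow> 'a" where
  "weierstrass_quotient dv F G k =
     dv (fps_nth G k - (\<Sum>j<k. weierstrass_quotient dv F G j * fps_nth F (k - j)))"
  by auto
termination by (relation "Wellfounded.measure (\<lambda>(dv, F, G, k). k)") auto

declare weierstrass_quotient.simps [simp del]

text \<open>The constant term of \<open>f\<close> is a polynomial in \<open>y\<close> with invertible leading coefficient, so division with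
  remainder by it is possible in \<open>A\<close>. Performing it for one power of \<open>t\<close> after the other divides by \<open>f\<close>;
  power series coefficients make this infinite process converge. Thus \<open>A\<close>-series modulo \<open>f\<close> form a
  finitely generated module over \<open>A'\<close>-series.\<close>

lemma weierstrass_division:
  assumes A': "subring A'" and A: "subring A" and AA': "A = (\<lambda>p. poly p y) ` polys_over A'"
    and P: "P \<in> polys_over A'" "\<And>i. i > d \<Longrightarrow> coeff P i = 0"
    and unit: "v \<in> A'" "v * coeff P d = 1"
    and f: "f \<in> pps_over A" "pps_nth f 0 = poly P y" and g: "g \<in> pps_over A"
  shows "\<exists>q\<in>pps_over A. \<exists>p\<in>polys_over (pps_over A').
    (\<forall>i\<ge>d. coeff p i = 0) \<and> g = q * f + poly p (pps_const y)"
proof -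
  note As = subringD[OF A]
  have "\<exists>b p. b \<in> A \<and> p \<in> polys_over A' \<and> (\<forall>i\<ge>d. coeff p i = 0) \<and> a = b * poly P y + poly p y"
    if "a \<in> A" for a
  proof -
    obtain G where G: "G \<in> polys_over A'" "a = poly G y" using \<open>a \<in> A\<close> AA' by auto
    obtain Q R where "Q \<in> polys_over A'" "R \<in> polys_over A'" "G = Q * P + R" "\<forall>i\<ge>d. coeff R i = 0"
      using unit_lead_division[OF A' P unit G(1)] by blast
    then show ?thesis using G AA' by (intro exI[of _ "poly Q y"] exI[of _ R]) auto
  qed
  then obtain dv rm where dr: "\<And>a. a \<in> A \<Longrightarrow> dv a \<in> A" "\<And>a. a \<in> A \<Longrightarrow> rm a \<in> polys_over A'"
    "\<And>a i. a \<in> A \<Longrightarrow> i \<ge> d \<Longrightarrow> coeff (rm a) i = 0" "\<And>a. a \<in> A \<Longrightarrow> a = dv a * poly P y + poly (rm a) y"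
    by metis
  obtain N F G where N: "N > 0" "f = pps_of N F" "g = pps_of N G" by (rule pps_common_denominator2)
  have F: "fps_nth F i \<in> A" and G: "fps_nth G i \<in> A" for i
    using f(1) g N pps_of_over[OF N(1) A] by auto
  have F0: "fps_nth F 0 = poly P y" using f(2) nth_pps_of_div[OF N(1), of F 0] by (simp add: N)
  define Q where "Q = weierstrass_quotient dv F G"
  define a where "a = (\<lambda>k. fps_nth G k - (\<Sum>j<k. Q j * fps_nth F (k - j)))"
  have Q: "Q k = dv (a k)" for k unfolding Q_def a_def by (subst weierstrass_quotient.simps) simp
  have QA: "Q k \<in> A" for k
  proof (induction k rule: less_induct)
    case (less k)
    then have "a k \<in> A" unfolding a_def by (intro As subring_sum[OF A]) (auto simp: F G)
    then show ?case by (simp add: Q dr)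
  qed
  then have aA: "a k \<in> A" for k unfolding a_def by (intro As subring_sum[OF A]) (auto simp: F G)
  define p where "p = (\<Sum>i<d. monom (pps_of N (Abs_fps (\<lambda>k. coeff (rm (a k)) i))) i)"
  have coeff_p: "coeff p i = (if i < d then pps_of N (Abs_fps (\<lambda>k. coeff (rm (a k)) i)) else 0)" for i
    by (simp add: p_def coeff_sum)
  show ?thesis
  proof (intro bexI conjI allI impI)
    show "coeff p i = 0" if "i \<ge> d" for i using that by (simp add: coeff_p)
    show "p \<in> polys_over (pps_over A')"
      using N(1) dr(2)[OF aA] A' subringD[OF subring_pps_over[OF A']]
      by (auto simp: polys_over_def coeff_p pps_of_over)
    show "pps_of N (Abs_fps Q) \<in> pps_over A" using QA N(1) A by (simp add: pps_of_over)
    have poly_p: "poly p (pps_const y) = pps_of N (\<Sum>i<d. Abs_fps (\<lambda>k. coeff (rm (a k)) i) * fps_const (y ^ i))"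
    proof -
      have "pps_of N (sum h S) = (\<Sum>i\<in>S. pps_of N (h i))" for h :: "nat \<Rightarrow> 'a fps" and S
        by (induction S rule: infinite_finite_induct) (simp_all add: pps_of_0 N(1) flip: pps_of_plus)
      moreover have "pps_const y ^ i = pps_of N (fps_const (y ^ i))" for i
        by (simp only: pps_const_of[OF N(1), symmetric] pps_const_power)
      ultimately show ?thesis
        unfolding p_def by (simp add: poly_sum poly_monom pps_of_times N(1))
    qed
    have "G = Abs_fps Q * F + (\<Sum>i<d. Abs_fps (\<lambda>k. coeff (rm (a k)) i) * fps_const (y ^ i))"
    proof (rule fps_ext)
      fix k
      have rm: "poly (rm (a k)) y = (\<Sum>i<d. coeff (rm (a k)) i * y ^ i)"
        by (rule poly_eq_sum_lessThan) (rule dr(3)[OF aA])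
      have "{0..k} = insert k {..<k}" by auto
      then have "fps_nth (Abs_fps Q * F) k = Q k * fps_nth F 0 + (\<Sum>j<k. Q j * fps_nth F (k - j))"
        by (simp add: fps_mult_nth)
      also have "Q k * fps_nth F 0 = a k - poly (rm (a k)) y"
        using dr(4)[OF aA[of k]] by (simp add: Q F0 algebra_simps)
      finally have "fps_nth G k = fps_nth (Abs_fps Q * F) k + poly (rm (a k)) y" by (simp add: a_def)
      then show "fps_nth G k = fps_nth (Abs_fps Q * F + (\<Sum>i<d. Abs_fps (\<lambda>k. coeff (rm (a k)) i) * fps_const (y ^ i))) k"
        by (simp add: rm fps_sum_nth)
    qed
    then show "g = pps_of N (Abs_fps Q) * f + poly p (pps_const y)"
      unfolding poly_p N(2,3) using N(1) by (simp add: pps_of_times pps_of_plus)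
  qed
qed

section \<open>Finitely generated subalgebras and Nagata's change of generators\<close>

text \<open>The algebra generated over the field is built by adjoining one generator at a time, so that its
  elements are polynomials in the first generator over the algebra of the others.\<close>

fun gen_alg :: "('k::field \<Rightarrow> 'r::comm_ring_1) \<Rightarrow> 'r list \<Rightarrow> 'r set" where
  "gen_alg \<kappa> [] = range \<kappa>"
| "gen_alg \<kappa> (y # gs) = (\<lambda>p. poly p y) ` polys_over (gen_alg \<kappa> gs)"

lemma poly_image_subring:
  assumes A: "subring A"
  shows "subring ((\<lambda>p. poly p y) ` polys_over A)"
  unfolding subring_def
proof (intro conjI ballI)
  note PAs = subringD[OF subring_polys_over[OF A]]
  show "1 \<in> (\<lambda>p. poly p y) ` polys_over A" using PAs by (intro image_eqI[of _ _ 1]) auto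
  fix x z assume "x \<in> (\<lambda>p. poly p y) ` polys_over A" "z \<in> (\<lambda>p. poly p y) ` polys_over A"
  then obtain p q where "p \<in> polys_over A" "q \<in> polys_over A" "x = poly p y" "z = poly q y" by auto
  then show "x - z \<in> (\<lambda>p. poly p y) ` polys_over A" "x * z \<in> (\<lambda>p. poly p y) ` polys_over A"
    using PAs by (auto intro: image_eqI[of _ _ "p - q"] image_eqI[of _ _ "p * q"])
qed

lemma const_polys_over: "subring A \<Longrightarrow> a \<in> A \<Longrightarrow> [:a:] \<in> polys_over A"
  by (auto simp: polys_over_def coeff_pCons subringD split: nat.splits)

lemma monom_polys_over: "subring A \<Longrightarrow> a \<in> A \<Longrightarrow> monom a n \<in> polys_over A"
  by (auto simp: polys_over_def subringD)

lemma poly_image_base: "subring A \<Longrightarrow> A \<subseteq> (\<lambda>p. poly p y) ` polys_over A"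
proof
  fix a assume "subring A" "a \<in> A"
  then have "[:a:] \<in> polys_over A" "a = poly [:a:] y" by (simp_all add: const_polys_over)
  then show "a \<in> (\<lambda>p. poly p y) ` polys_over A" by blast
qed

lemma poly_image_gen: "subring A \<Longrightarrow> y \<in> (\<lambda>p. poly p y) ` polys_over A"
proof -
  assume "subring A"
  then have "monom 1 1 \<in> polys_over A" "y = poly (monom 1 1) y"
    by (simp_all add: monom_polys_over subringD poly_monom)
  then show ?thesis by blast
qed

context
  fixes \<kappa> :: "'k::field \<Rightarrow> 'r::comm_ring_1"
  assumes \<kappa>: "hom_on UNIV \<kappa>"
begin

lemmas \<kappa>_simps = hom_onD[OF \<kappa> subring_UNIV, simplified]

lemma subring_gen_alg: "subring (gen_alg \<kappa> gs)"
proof (induction gs)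
  case Nil
  show ?case
    by (auto simp: subring_def image_iff intro: exI[of _ 1] simp flip: \<kappa>_simps)
qed (auto intro: poly_image_subring)

lemma range_gen_alg: "\<kappa> c \<in> gen_alg \<kappa> gs"
proof (induction gs)
  case (Cons y gs)
  then show ?case using poly_image_base[OF subring_gen_alg] by (metis gen_alg.simps(2) subsetD)
qed simp

lemma set_gen_alg: "set gs \<subseteq> gen_alg \<kappa> gs"
proof (induction gs)
  case (Cons y gs)
  then show ?case
    using poly_image_base[OF subring_gen_alg, of gs y] poly_image_gen[OF subring_gen_alg, of y gs] by auto
qed simp

lemma gen_alg_least:
  assumes "subring S" "range \<kappa> \<subseteq> S" "set gs \<subseteq> S"
  shows "gen_alg \<kappa> gs \<subseteq> S"
  using assms(3)
proof (induction gs)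
  case (Cons y gs)
  then have "polys_over (gen_alg \<kappa> gs) \<subseteq> polys_over S" by (auto simp: polys_over_def)
  then show ?case using Cons.prems assms(1) by (auto intro!: poly_in_subring)
qed (use assms in simp)

fun mon :: "'r list \<Rightarrow> nat list \<Rightarrow> 'r" where
  "mon (y # gs) (k # e) = y ^ k * mon gs e"
| "mon _ _ = 1"

lemma mon_zero: "mon gs (replicate n 0) = 1"
proof (induction gs arbitrary: n)
  case (Cons y gs)
  then show ?case by (cases n) auto
qed simp

lemma gen_alg_expand:
  assumes "a \<in> gen_alg \<kappa> gs"
  shows "\<exists>E c. finite E \<and> (\<forall>e\<in>E. length e = length gs) \<and> a = (\<Sum>e\<in>E. \<kappa> (c e) * mon gs e)"
  using assms
proof (induction gs arbitrary: a)
  case Nil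
  then obtain k where "a = \<kappa> k" by auto
  then show ?case by (intro exI[of _ "{[]}"] exI[of _ "\<lambda>_. k"]) auto
next
  case (Cons y gs)
  then obtain p where p: "\<And>i. coeff p i \<in> gen_alg \<kappa> gs" "a = poly p y" by (auto simp: polys_over_def)
  have "\<forall>i. \<exists>E c. finite E \<and> (\<forall>e\<in>E. length e = length gs) \<and> coeff p i = (\<Sum>e\<in>E. \<kappa> (c e) * mon gs e)"
    using Cons.IH p(1) by blast
  then obtain E c where E: "\<And>i. finite (E i)" "\<And>i e. e \<in> E i \<Longrightarrow> length e = length gs"
    "\<And>i. coeff p i = (\<Sum>e\<in>E i. \<kappa> (c i e) * mon gs e)"
    by metis
  define E' where "E' = (\<lambda>(i, e). i # e) ` (SIGMA i:{..degree p}. E i)"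
  have inj: "inj_on (\<lambda>(i, e). i # e) S" for S :: "(nat \<times> nat list) set" by (auto simp: inj_on_def)
  have "(\<Sum>e\<in>E'. \<kappa> (c (hd e) (tl e)) * mon (y # gs) e) =
      (\<Sum>(i, e)\<in>(SIGMA i:{..degree p}. E i). \<kappa> (c i e) * (y ^ i * mon gs e))"
    unfolding E'_def by (subst sum.reindex[OF inj]) (auto intro!: sum.cong)
  also have "\<dots> = (\<Sum>i\<le>degree p. \<Sum>e\<in>E i. \<kappa> (c i e) * (y ^ i * mon gs e))"
    by (rule sum.Sigma[symmetric]) (use E in auto)
  also have "\<dots> = a" by (simp add: p(2) poly_altdef E(3) sum_distrib_left mult_ac)
  finally show ?case
    using E(1,2) by (intro exI[of _ E'] exI[of _ "\<lambda>e. c (hd e) (tl e)"]) (auto simp: E'_def)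
qed

text \<open>\<open>a\<close> is the value at the generators of a non-zero polynomial over the field. For \<open>a \<noteq> 0\<close> this only says
  that \<open>a\<close> lies in the algebra, for \<open>a = 0\<close> it says that the generators are algebraically dependent.\<close>

definition nontrivial_rep :: "'r list \<Rightarrow> 'r \<Rightarrow> bool" where
  "nontrivial_rep gs a \<longleftrightarrow> (\<exists>E c. finite E \<and> E \<noteq> {} \<and> (\<forall>e\<in>E. length e = length gs \<and> c e \<noteq> 0) \<and>
     a = (\<Sum>e\<in>E. \<kappa> (c e) * mon gs e))"

lemma nontrivial_rep_nonzero:
  assumes "a \<in> gen_alg \<kappa> gs" "a \<noteq> 0"
  shows "nontrivial_rep gs a"
proof -
  obtain E c where E: "finite E" "\<forall>e\<in>E. length e = length gs" "a = (\<Sum>e\<in>E. \<kappa> (c e) * mon gs e)"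
    using gen_alg_expand[OF assms(1)] by metis
  have a: "a = (\<Sum>e\<in>{e\<in>E. c e \<noteq> 0}. \<kappa> (c e) * mon gs e)"
    unfolding E(3) by (rule sum.mono_neutral_right) (use E in \<open>auto simp: \<kappa>_simps\<close>)
  then have "{e\<in>E. c e \<noteq> 0} \<noteq> {}" using assms(2) by (metis sum.empty)
  then show ?thesis
    unfolding nontrivial_rep_def using E a by (intro exI[of _ "{e\<in>E. c e \<noteq> 0}"] exI[of _ c]) auto
qed

lemma nontrivial_rep_generator: "nontrivial_rep (y # gs) y"
  unfolding nontrivial_rep_def
  by (rule exI[of _ "{1 # replicate (length gs) 0}"], rule exI[of _ "\<lambda>_. 1"])
    (auto simp: \<kappa>_simps mon_zero)

text \<open>If \<open>h = \<Sum> \<kappa> (c e) x\<^sup>e\<close> is inverse to the generator \<open>y\<close>, the relation \<open>y h - 1 = 0\<close> is not trivial, because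
  every monomial of \<open>y h\<close> contains \<open>y\<close> and so none of them cancels the constant.\<close>

lemma nontrivial_rep_unit:
  assumes "h \<in> gen_alg \<kappa> (y # gs)" "y * h = 1"
  shows "nontrivial_rep (y # gs) 0"
proof -
  obtain E c where E: "finite E" "\<forall>e\<in>E. length e = length (y # gs)" 
    "h = (\<Sum>e\<in>E. \<kappa> (c e) * mon (y # gs) e)"
    using gen_alg_expand[OF assms(1)] by metis
  define S where "S = {e\<in>E. c e \<noteq> 0}"
  have h: "h = (\<Sum>e\<in>S. \<kappa> (c e) * mon (y # gs) e)"
    unfolding E(3) S_def by (rule sum.mono_neutral_right) (use E in \<open>auto simp: \<kappa>_simps\<close>)
  define z where "z = replicate (Suc (length gs)) (0::nat)"
  define s where "s = (\<lambda>e::nat list. Suc (hd e) # tl e)"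
  define c' where "c' = (\<lambda>e. if e = z then - 1 else c ((hd e - 1) # tl e))"
  have S: "finite S" "\<And>e. e \<in> S \<Longrightarrow> length e = Suc (length gs)" "\<And>e. e \<in> S \<Longrightarrow> c e \<noteq> 0"
    using E by (auto simp: S_def)
  have shape: "\<exists>k e'. e = k # e'" if "e \<in> S" for e using S(2)[OF that] by (cases e) auto
  have inj: "inj_on s S"
  proof (rule inj_onI)
    fix e e' assume "e \<in> S" "e' \<in> S" "s e = s e'"
    then show "e = e'" using shape[of e] shape[of e'] by (auto simp: s_def)
  qed
  have z: "z \<notin> s ` S" by (auto simp: z_def s_def)
  have c's: "c' (s e) = c e" if "e \<in> S" for e
    using shape[OF that] z that by (auto simp: c'_def s_def z_def)
  have "(\<Sum>e\<in>insert z (s ` S). \<kappa> (c' e) * mon (y # gs) e) =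
      \<kappa> (c' z) * mon (y # gs) z + (\<Sum>e\<in>S. \<kappa> (c' (s e)) * mon (y # gs) (s e))"
    using S(1) z by (simp add: sum.reindex[OF inj])
  also have "mon (y # gs) z = 1" unfolding z_def by (rule mon_zero)
  also have "\<kappa> (c' z) = - 1" by (simp add: c'_def \<kappa>_simps)
  also have "(\<Sum>e\<in>S. \<kappa> (c' (s e)) * mon (y # gs) (s e)) = y * h"
    unfolding h sum_distrib_left
    by (rule sum.cong) (use shape c's in \<open>fastforce simp: s_def mult_ac\<close>)+
  finally have "0 = (\<Sum>e\<in>insert z (s ` S). \<kappa> (c' e) * mon (y # gs) e)" by (simp add: assms(2))
  moreover have "length e = length (y # gs) \<and> c' e \<noteq> 0" if "e \<in> insert z (s ` S)" for e
    using that S c's by (auto simp: z_def s_def c'_def)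
  ultimately show ?thesis
    unfolding nontrivial_rep_def using S(1) by (intro exI[of _ "insert z (s ` S)"] exI[of _ c']) auto
qed

fun digits_value :: "nat \<Rightarrow> nat list \<Rightarrow> nat" where
  "digits_value N [] = 0"
| "digits_value N (k # e) = k + N * digits_value N e"

lemma digits_value_inj:
  assumes "length e = length e'" "\<forall>k\<in>set e. k < N" "\<forall>k\<in>set e'. k < N" "digits_value N e = digits_value N e'"
  shows "e = e'"
  using assms
proof (induction e e' rule: list_induct2)
  case (Cons k e k' e')
  then have N: "k < N" "k' < N" and eq: "k + N * digits_value N e = k' + N * digits_value N e'" by auto
  have "k = k'" using arg_cong[OF eq, of "\<lambda>x. x mod N"] N by simp
  then have "digits_value N e = digits_value N e'" using eq N by simp
  then show ?case using Cons \<open>k = k'\<close> by simp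
qed simp

definition monic_of_degree :: "'a::comm_ring_1 poly \<Rightarrow> nat \<Rightarrow> bool" where
  "monic_of_degree p d \<longleftrightarrow> coeff p d = 1 \<and> (\<forall>i>d. coeff p i = 0)"

lemma monic_of_degree_mult:
  assumes "monic_of_degree p d" "monic_of_degree q e"
  shows "monic_of_degree (p * q) (d + e)"
proof -
  have "coeff (p * q) i = (if i = d + e then 1 else 0)" if i: "i \<ge> d + e" for i
  proof -
    have "coeff (p * q) i = (\<Sum>j\<le>i. coeff p j * coeff q (i - j))" by (rule coeff_mult)
    also have "\<dots> = (\<Sum>j\<le>i. if j = d \<and> i = d + e then 1 else 0)"
    proof (rule sum.cong)
      fix j assume "j \<in> {..i}"
      then consider "j > d" | "j \<le> d" "i - j > e" | "j = d" "i = d + e" using i by fastforce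
      then show "coeff p j * coeff q (i - j) = (if j = d \<and> i = d + e then 1 else 0)"
        using assms by cases (auto simp: monic_of_degree_def)
    qed simp
    also have "\<dots> = (if i = d + e then 1 else 0)" by (cases "i = d + e") auto
    finally show ?thesis .
  qed
  then show ?thesis by (auto simp: monic_of_degree_def)
qed

lemma monic_of_degree_power:
  assumes "monic_of_degree p d"
  shows "monic_of_degree (p ^ n) (d * n)"
proof (induction n)
  case 0
  then show ?case by (auto simp: monic_of_degree_def)
next
  case (Suc n)
  then show ?case using monic_of_degree_mult[OF assms Suc] by simp
qed

text \<open>Nagata's change of variables affects the generators \<open>g\<^sub>1, g\<^sub>2, \<dots>\<close> other than \<open>y\<close>: from \<open>g\<^sub>i\<close> it
  subtracts the \<open>N\<^sup>i\<close>-th power of \<open>y\<close>. In terms of the new generators, a monomial in the old ones is a monic polynomial in \<open>y\<close> whose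
  degree is the number with base \<open>N\<close> digits the exponents, the exponent of \<open>y\<close> being the last digit.\<close>

fun nagata_shift :: "nat \<Rightarrow> nat \<Rightarrow> 'r \<Rightarrow> 'r list \<Rightarrow> 'r list" where
  "nagata_shift N M y [] = []"
| "nagata_shift N M y (g # gs) = (g - y ^ M) # nagata_shift N (M * N) y gs"

fun nagata_poly :: "nat \<Rightarrow> nat \<Rightarrow> 'r list \<Rightarrow> nat list \<Rightarrow> 'r poly" where
  "nagata_poly N M (g # gs) (j # e) = ([:g:] + monom 1 M) ^ j * nagata_poly N (M * N) gs e"
| "nagata_poly N M _ _ = 1"

lemma length_nagata_shift [simp]: "length (nagata_shift N M y gs) = length gs"
  by (induction gs arbitrary: M) auto

lemma poly_nagata_poly:
  "length e = length gs \<Longrightarrow> poly (nagata_poly N M (nagata_shift N M y gs) e) y = mon gs e"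
  by (induction e gs arbitrary: M rule: list_induct2) (auto simp: poly_monom)

lemma nagata_poly_monic:
  assumes "N > 0"
  shows "length e = length gs \<Longrightarrow> M > 0 \<Longrightarrow> monic_of_degree (nagata_poly N M gs e) (M * digits_value N e)"
proof (induction e gs arbitrary: M rule: list_induct2)
  case Nil
  then show ?case by (auto simp: monic_of_degree_def)
next
  case (Cons j e g gs)
  have "monic_of_degree ([:g:] + monom 1 M) M"
    using Cons.prems by (auto simp: monic_of_degree_def coeff_pCons split: nat.splits)
  then have "monic_of_degree (([:g:] + monom 1 M) ^ j * nagata_poly N (M * N) gs e) (M * j + M * N * digits_value N e)"
    using Cons.prems assms by (intro monic_of_degree_mult monic_of_degree_power Cons.IH) auto
  then show ?case by (simp add: algebra_simps)
qed

lemma nagata_poly_over: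
  assumes A: "subring A"
  shows "length e = length gs \<Longrightarrow> set gs \<subseteq> A \<Longrightarrow> nagata_poly N M gs e \<in> polys_over A"
proof (induction e gs arbitrary: M rule: list_induct2)
  case Nil
  then show ?case using subringD(1)[OF subring_polys_over[OF A]] by simp
next
  case (Cons j e g gs)
  then show ?case
    using subringD[OF A]
    by (auto intro!: subringD(4,6,7)[OF subring_polys_over[OF A]] const_polys_over[OF A] monom_polys_over[OF A])
qed

lemma nagata_shift_subset:
  assumes "subring A" "y \<in> A"
  shows "set (nagata_shift N M y gs) \<subseteq> A \<longleftrightarrow> set gs \<subseteq> A"
proof (induction gs arbitrary: M)
  case (Cons g gs)
  have "g - y ^ M \<in> A \<longleftrightarrow> g \<in> A"
    using subringD(4)[OF assms(1), of "g - y ^ M" "y ^ M"] subringD(5,7)[OF assms(1)] assms(2) by auto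
  then show ?case using Cons by auto
qed simp

lemma gen_alg_nagata_shift: "gen_alg \<kappa> (y # nagata_shift N M y gs) = gen_alg \<kappa> (y # gs)"
proof (rule antisym)
  have "set (nagata_shift N M y gs) \<subseteq> gen_alg \<kappa> (y # gs)"
    using set_gen_alg[of "y # gs"] by (subst nagata_shift_subset[OF subring_gen_alg]) auto
  then show "gen_alg \<kappa> (y # nagata_shift N M y gs) \<subseteq> gen_alg \<kappa> (y # gs)"
    using set_gen_alg[of "y # gs"] range_gen_alg[of _ "y # gs"]
    by (intro gen_alg_least subring_gen_alg) auto
  let ?B = "gen_alg \<kappa> (y # nagata_shift N M y gs)"
  have y: "y \<in> ?B" and "set (nagata_shift N M y gs) \<subseteq> ?B"
    using set_gen_alg[of "y # nagata_shift N M y gs"] by auto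
  then have "set gs \<subseteq> ?B" using nagata_shift_subset[OF subring_gen_alg y] by blast
  then show "gen_alg \<kappa> (y # gs) \<subseteq> ?B"
    using y range_gen_alg[of _ "y # nagata_shift N M y gs"] by (intro gen_alg_least subring_gen_alg) auto
qed

text \<open>If \<open>N\<close> exceeds all exponents, different monomials become polynomials in \<open>y\<close> of different degrees, so
  the leading coefficient of their linear combination is one of its non-zero coefficients.\<close>

lemma nagata_normalization:
  assumes "nontrivial_rep (y # gs) a"
  obtains gs' P d u where "length gs' = length gs" "gen_alg \<kappa> (y # gs') = gen_alg \<kappa> (y # gs)"
    "P \<in> polys_over (gen_alg \<kappa> gs')" "u \<noteq> 0" "coeff P d = \<kappa> u" "\<And>i. i > d \<Longrightarrow> coeff P i = 0" "poly P y = a"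
proof -
  obtain E c where E: "finite E" "E \<noteq> {}" "\<And>e. e \<in> E \<Longrightarrow> length e = Suc (length gs)" "\<And>e. e \<in> E \<Longrightarrow> c e \<noteq> 0"
    "a = (\<Sum>e\<in>E. \<kappa> (c e) * mon (y # gs) e)"
    using assms by (auto simp: nontrivial_rep_def)
  have fin: "finite (\<Union>e\<in>E. set e)" using E(1) by blast
  define N where "N = Suc (Max (insert 0 (\<Union>e\<in>E. set e)))"
  have N: "N > 0" by (simp add: N_def)
  have small: "\<forall>k\<in>set e. k < N" if "e \<in> E" for e
  proof
    fix k assume "k \<in> set e"
    then have "k \<le> Max (insert 0 (\<Union>e\<in>E. set e))" using that fin by (intro Max_ge) auto
    then show "k < N" by (simp add: N_def)
  qed
  define gs' where "gs' = nagata_shift N N y gs"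
  let ?w = "digits_value N"
  define Q where "Q = (\<lambda>e. monom 1 (hd e) * nagata_poly N N gs' (tl e))"
  define P where "P = (\<Sum>e\<in>E. [:\<kappa> (c e):] * Q e)"
  have shape: "\<exists>k e'. e = k # e' \<and> length e' = length gs" if "e \<in> E" for e using E(3)[OF that] by (cases e) auto
  have Q_monic: "monic_of_degree (Q e) (?w e)" if "e \<in> E" for e
  proof -
    obtain k e' where e: "e = k # e'" "length e' = length gs" using shape \<open>e \<in> E\<close> by blast
    have "monic_of_degree (monom 1 k * nagata_poly N N gs' e') (k + N * ?w e')"
      by (intro monic_of_degree_mult nagata_poly_monic[OF N])
        (use N e in \<open>auto simp: monic_of_degree_def gs'_def\<close>)
    then show ?thesis by (simp add: Q_def e)
  qed
  have sub': "subring (gen_alg \<kappa> gs')" by (rule subring_gen_alg)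
  have Q_over: "Q e \<in> polys_over (gen_alg \<kappa> gs')" if "e \<in> E" for e
    using shape[OF that] set_gen_alg[of gs']
    by (auto simp: Q_def gs'_def intro!: subringD(6)[OF subring_polys_over[OF sub'[unfolded gs'_def]]]
        monom_polys_over nagata_poly_over subring_gen_alg subringD(1))
  define d where "d = Max (?w ` E)"
  have "d \<in> ?w ` E" unfolding d_def using E by (intro Max_in) auto
  then obtain e0 where e0: "e0 \<in> E" "?w e0 = d" by blast
  have d_max: "?w e < d" if "e \<in> E" "e \<noteq> e0" for e
  proof -
    have "?w e \<le> d" unfolding d_def using E that by (intro Max_ge) auto
    moreover have "?w e \<noteq> ?w e0"
      using digits_value_inj[of e e0 N] that e0(1) E(3) small by auto
    ultimately show ?thesis using e0(2) by simp
  qed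
  show ?thesis
  proof (rule that)
    show "length gs' = length gs" by (simp add: gs'_def)
    show "gen_alg \<kappa> (y # gs') = gen_alg \<kappa> (y # gs)" unfolding gs'_def by (rule gen_alg_nagata_shift)
    show "P \<in> polys_over (gen_alg \<kappa> gs')"
      unfolding P_def
      by (intro subring_sum subring_polys_over[OF sub'] subringD(6)[OF subring_polys_over[OF sub']]
          const_polys_over[OF sub'] range_gen_alg Q_over)
    show "c e0 \<noteq> 0" using e0 E by blast
    have coeff_P: "coeff P i = (\<Sum>e\<in>E. \<kappa> (c e) * coeff (Q e) i)" for i by (simp add: P_def coeff_sum)
    have "coeff P d = (\<Sum>e\<in>E. if e = e0 then \<kappa> (c e0) else 0)"
      unfolding coeff_P
    proof (rule sum.cong)
      fix e assume e: "e \<in> E"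
      show "\<kappa> (c e) * coeff (Q e) d = (if e = e0 then \<kappa> (c e0) else 0)"
        using Q_monic[OF e] d_max[OF e] e0(2) by (auto simp: monic_of_degree_def)
    qed simp
    then show "coeff P d = \<kappa> (c e0)" using E(1) e0(1) by simp
    show "coeff P i = 0" if i: "i > d" for i
      unfolding coeff_P
    proof (rule sum.neutral, rule ballI)
      fix e assume e: "e \<in> E"
      then have "?w e < i" using d_max[OF e] e0(2) i by (cases "e = e0") auto
      then show "\<kappa> (c e) * coeff (Q e) i = 0" using Q_monic[OF e] by (simp add: monic_of_degree_def)
    qed
    show "poly P y = a"
      unfolding P_def E(5) poly_sum
    proof (rule sum.cong)
      fix e assume "e \<in> E"
      then obtain k e' where "e = k # e'" "length e' = length gs" using shape by blast
      then show "poly ([:\<kappa> (c e):] * Q e) y = \<kappa> (c e) * mon (y # gs) e"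
        by (simp add: Q_def gs'_def poly_monom poly_nagata_poly)
    qed simp
  qed
qed

end

section \<open>The Nullstellensatz over the valuation ring\<close>

lemma pps_t_over: "subring A \<Longrightarrow> q \<ge> 0 \<Longrightarrow> pps_t q \<in> pps_over A"
  by (auto simp: pps_over_def nth_pps_t subringD)

lemma pps_const_over: "subring A \<Longrightarrow> a \<in> A \<Longrightarrow> pps_const a \<in> pps_over A"
  by (auto simp: pps_over_def nth_pps_const subringD)

lemma pps_map_hom:
  assumes "hom_on UNIV h"
  shows "hom_on UNIV (pps_map h)"
proof -
  have sub: "subring UNIV" by (simp add: subring_def)
  note h = hom_onD[OF assms sub, simplified]
  have "pps_map h 1 = 1" by (rule pps_eqI) (simp add: nth_pps_map h nth_one_pps)
  moreover have "pps_map h (x + y) = pps_map h x + pps_map h y" for x y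
    by (rule pps_eqI) (simp add: nth_pps_map h nth_plus_pps)
  moreover have "pps_map h (x * y) = pps_map h x * pps_map h y" for x y
  proof (rule pps_eqI)
    fix q
    let ?S = "{a. pps_nth x a \<noteq> 0 \<and> a \<le> q}"
    have pos: "\<And>a z. pps_nth z (q - a) \<noteq> 0 \<Longrightarrow> a \<le> q" using nth_neg_pps by (metis diff_less_0_iff_less not_le)
    have "pps_nth (x * y) q = (\<Sum>a\<in>?S. pps_nth x a * pps_nth y (q - a))"
      by (rule nth_times_pps) (auto simp: finite_pps_support_below intro: pos)
    moreover have "pps_nth (pps_map h x * pps_map h y) q =
        (\<Sum>a\<in>?S. pps_nth (pps_map h x) a * pps_nth (pps_map h y) (q - a))"
    proof (rule nth_times_pps)
      fix a assume "pps_nth (pps_map h x) a \<noteq> 0" "pps_nth (pps_map h y) (q - a) \<noteq> 0"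
      then have "pps_nth x a \<noteq> 0" "pps_nth y (q - a) \<noteq> 0" by (auto simp: nth_pps_map h)
      then show "a \<in> ?S" using pos by blast
    qed (rule finite_pps_support_below)
    ultimately show "pps_nth (pps_map h (x * y)) q = pps_nth (pps_map h x * pps_map h y) q"
      by (simp add: nth_pps_map h hom_on_sum[OF assms sub])
  qed
  ultimately show ?thesis by (simp add: hom_on_def)
qed

text \<open>Saturation with respect to the powers of \<open>t\<close>; together with \<open>1 \<notin> I\<close> it says that \<open>I\<close> is proper even
  after \<open>t\<close> is inverted.\<close>

definition t_saturated :: "'a::comm_ring_1 pps set \<Rightarrow> 'a pps set \<Rightarrow> bool" where
  "t_saturated T I \<longleftrightarrow> (\<forall>q\<ge>0. \<forall>x\<in>T. pps_t q * x \<in> I \<longrightarrow> x \<in> I)"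

text \<open>An ideal that contains some \<open>x \<noteq> 0\<close> contains, by saturation, an element with non-zero constant term.
  For the zero ideal there are two cases. If \<open>y\<close> is invertible, its inverse gives a relation between
  the generators, and \<open>f = 0\<close> will do. Otherwise the saturation of the ideal generated by \<open>y\<close> is still
  proper, and \<open>f = y\<close> will do: imposing \<open>y = 0\<close> is an arbitrary way of cutting the dimension down.\<close>

lemma exists_algebraic_relation:
  fixes \<kappa> :: "'k::field \<Rightarrow> 'r::comm_ring_1"
  assumes \<kappa>: "hom_on UNIV \<kappa>"
    and I: "ideal_on (pps_over (gen_alg \<kappa> (y # gs))) I" "1 \<notin> I" "t_saturated (pps_over (gen_alg \<kappa> (y # gs))) I"
  obtains I' f where "I \<subseteq> I'" "ideal_on (pps_over (gen_alg \<kappa> (y # gs))) I'" "1 \<notin> I'"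
    "t_saturated (pps_over (gen_alg \<kappa> (y # gs))) I'" "f \<in> I'" "nontrivial_rep \<kappa> (y # gs) (pps_nth f 0)"
proof -
  define A where "A = gen_alg \<kappa> (y # gs)"
  have A: "subring A" unfolding A_def by (rule subring_gen_alg[OF \<kappa>])
  note T = subring_pps_over[OF A]
  note Ts = subringD[OF T] and I' = I[folded A_def]
  note Is = ideal_onD[OF I'(1) T]
  have yA: "y \<in> A" unfolding A_def using set_gen_alg[OF \<kappa>, of "y # gs"] by simp
  note yT = pps_const_over[OF A yA]
  consider x where "x \<in> I" "x \<noteq> 0" | "I = {0}" "\<exists>h\<in>A. y * h = 1" | "I = {0}" "\<not> (\<exists>h\<in>A. y * h = 1)"
    using Is(2) by blast
  then show ?thesis
  proof cases
    case 1
    obtain q f where f: "q \<ge> 0" "x = pps_t q * f" "pps_nth f 0 \<noteq> 0"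
      "\<And>e. e \<ge> 0 \<Longrightarrow> pps_nth f e = pps_nth x (e + q)"
      using pps_factor_t[OF 1(2)] by blast
    have fT: "f \<in> pps_over A"
      unfolding pps_over_def
    proof (intro CollectI allI)
      fix e
      show "pps_nth f e \<in> A"
        using f(4)[of e] Is(1)[OF 1(1)] nth_neg_pps[of e f] subringD(2)[OF A]
        by (cases "e \<ge> 0") (auto simp: pps_over_def)
    qed
    then have "f \<in> I" using I'(3) f(1,2) 1(1) by (auto simp: t_saturated_def)
    moreover have "nontrivial_rep \<kappa> (y # gs) (pps_nth f 0)"
      using fT f(3) by (intro nontrivial_rep_nonzero[OF \<kappa>]) (auto simp: pps_over_def A_def)
    ultimately show ?thesis using that[of I f] I by blast
  next
    case 2
    then have "nontrivial_rep \<kappa> (y # gs) (pps_nth 0 0)"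
      using nontrivial_rep_unit[OF \<kappa>] by (auto simp: A_def)
    then show ?thesis using that[of I 0] I Is(2) by blast
  next
    case 3
    define I2 where "I2 = {x \<in> pps_over A. \<exists>q\<ge>0. \<exists>z\<in>pps_over A. pps_t q * x = pps_const y * z}"
    have "ideal_on (pps_over A) I2"
      unfolding ideal_on_def
    proof (intro conjI ballI)
      show "I2 \<subseteq> pps_over A" by (auto simp: I2_def)
      show "0 \<in> I2" using Ts by (auto simp: I2_def intro!: exI[of _ 0] bexI[of _ 0])
      fix a x assume a: "a \<in> pps_over A" and "x \<in> I2"
      then obtain q z where z: "q \<ge> 0" "x \<in> pps_over A" "z \<in> pps_over A" "pps_t q * x = pps_const y * z"
        by (auto simp: I2_def)
      have "pps_t q * (a * x) = pps_const y * (a * z)" using z(4) by (metis mult.left_commute)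
      moreover have "a * x \<in> pps_over A" "a * z \<in> pps_over A" by (simp_all add: Ts(6) a z)
      ultimately show "a * x \<in> I2" using z(1) by (auto simp: I2_def)
    next
      fix x1 x2 assume "x1 \<in> I2" "x2 \<in> I2"
      then obtain q1 z1 q2 z2 where z: "q1 \<ge> 0" "x1 \<in> pps_over A" "z1 \<in> pps_over A" "pps_t q1 * x1 = pps_const y * z1"
        "q2 \<ge> 0" "x2 \<in> pps_over A" "z2 \<in> pps_over A" "pps_t q2 * x2 = pps_const y * z2"
        by (auto simp: I2_def)
      have "pps_t (q1 + q2) * (x1 + x2) = pps_t q2 * (pps_t q1 * x1) + pps_t q1 * (pps_t q2 * x2)"
        unfolding pps_t_add[OF z(1,5), symmetric] by (simp only: algebra_simps)
      also have "\<dots> = pps_const y * (pps_t q2 * z1 + pps_t q1 * z2)"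
        unfolding z(4,8) by (simp add: algebra_simps)
      finally have "pps_t (q1 + q2) * (x1 + x2) = pps_const y * (pps_t q2 * z1 + pps_t q1 * z2)" .
      moreover have "pps_t q2 * z1 + pps_t q1 * z2 \<in> pps_over A"
        using z by (intro Ts pps_t_over[OF A])
      moreover have "x1 + x2 \<in> pps_over A" by (simp add: Ts(4) z)
      ultimately show "x1 + x2 \<in> I2" using z by (auto simp: I2_def intro!: exI[of _ "q1 + q2"])
    qed
    moreover have "1 \<notin> I2"
    proof
      assume "1 \<in> I2"
      then obtain q z where z: "q \<ge> 0" "z \<in> pps_over A" "pps_t q * 1 = pps_const y * z"
        by (auto simp: I2_def)
      have "pps_nth (pps_t q * 1) q = y * pps_nth z q" unfolding z(3) by simp
      then have "1 = y * pps_nth z q" using z(1) by (simp add: nth_pps_t)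
      moreover have "pps_nth z q \<in> A" using z(2) by (simp add: pps_over_def)
      ultimately show False using 3(2) by metis
    qed
    moreover have "t_saturated (pps_over A) I2"
      unfolding t_saturated_def
    proof (intro allI ballI impI)
      fix q :: rat and x assume q: "q \<ge> 0" "x \<in> pps_over A" "pps_t q * x \<in> I2"
      then obtain q' z where "q' \<ge> 0" "z \<in> pps_over A" "pps_t q' * (pps_t q * x) = pps_const y * z"
        by (auto simp: I2_def)
      then show "x \<in> I2" using q by (auto simp: I2_def pps_t_add simp flip: mult.assoc intro!: exI[of _ "q' + q"])
    qed
    moreover have "pps_const y \<in> I2"
      using yT Ts by (auto simp: I2_def intro!: exI[of _ 0] bexI[of _ 1])
    moreover have "nontrivial_rep \<kappa> (y # gs) (pps_nth (pps_const y) 0)"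
      using nontrivial_rep_generator[OF \<kappa>] by (simp add: nth_pps_const)
    moreover have "I \<subseteq> I2" using 3(1) \<open>ideal_on (pps_over A) I2\<close> by (simp add: ideal_on_def)
    ultimately show ?thesis using that[of I2 "pps_const y"] unfolding A_def by blast
  qed
qed

text \<open>A weak Nullstellensatz for algebras over the valuation ring: a non-empty generic fibre has a point
  with coordinates in the valuation ring. The proof is Noether normalization. After adding an
  element \<open>f\<close> to the ideal and changing generators, the constant term of \<open>f\<close> is monic in \<open>y\<close> up to a
  constant, so by Weierstrass division the quotient ring is finite over the series with one
  generator fewer. There a point exists by induction, and it extends because the Puiseux series
  are algebraically closed. The image of \<open>y\<close> satisfies a monic equation over the valuation ring and
  hence belongs to it.\<close>

theorem affinoid_nullstellensatz:
  fixes \<kappa> :: "'k::{alg_closed_field, field_char_0} \<Rightarrow> 'r::comm_ring_1"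
  assumes \<kappa>: "hom_on UNIV \<kappa>"
    and I: "ideal_on (pps_over (gen_alg \<kappa> gs)) I" "1 \<notin> I" "t_saturated (pps_over (gen_alg \<kappa> gs)) I"
  shows "\<exists>\<psi>. hom_on (pps_over (gen_alg \<kappa> gs)) \<psi> \<and> (\<forall>x\<in>I. \<psi> x = 0) \<and>
    (\<forall>x\<in>pps_over (gen_alg \<kappa> gs). \<psi> x \<in> puiseux_O) \<and> (\<forall>h. \<psi> (pps_map \<kappa> h) = puiseux_emb h)"
  using I
proof (induction "length gs" arbitrary: gs I)
  case 0
  note sub_UNIV = subring_UNIV
  note \<kappa>s = hom_onD[OF \<kappa> sub_UNIV, simplified]
  have map_hom: "hom_on UNIV (pps_map \<kappa>)" by (rule pps_map_hom[OF \<kappa>])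
  note maps = hom_onD[OF map_hom sub_UNIV, simplified]
  have gs: "gen_alg \<kappa> gs = range \<kappa>" using 0 by simp
  have inj_\<kappa>: "inj \<kappa>"
  proof (rule injI, rule ccontr)
    fix a b assume "\<kappa> a = \<kappa> b" "a \<noteq> b"
    then have "\<kappa> ((a - b) * inverse (a - b)) = 0" by (simp only: \<kappa>s diff_self mult_zero_left)
    then show False using \<open>a \<noteq> b\<close> by (simp add: \<kappa>s)
  qed
  define inv\<kappa> where "inv\<kappa> = inv \<kappa>"
  have inv\<kappa>: "inv\<kappa> (\<kappa> a) = a" "x \<in> range \<kappa> \<Longrightarrow> \<kappa> (inv\<kappa> x) = x" for a x
    using inj_\<kappa> by (auto simp: inv\<kappa>_def f_inv_into_f)
  have inv\<kappa>0: "inv\<kappa> 0 = 0" using inv\<kappa>(1)[of 0] by (simp add: \<kappa>s)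
  \<comment> \<open>Without generators, series over the algebra are the valuation ring, via \<open>\<mu>\<close>; a non-zero element of
    \<open>I\<close> would be a power of \<open>t\<close> times a unit, so \<open>I = 0\<close>.\<close>
  define \<mu> where "\<mu> = pps_map inv\<kappa>"
  have \<mu>: "\<mu> (pps_map \<kappa> h) = h" for h
    by (rule pps_eqI) (simp add: \<mu>_def nth_pps_map inv\<kappa>0 inv\<kappa> \<kappa>s)
  have \<mu>': "pps_map \<kappa> (\<mu> x) = x" if "x \<in> pps_over (range \<kappa>)" for x
    using that by (intro pps_eqI) (auto simp: \<mu>_def nth_pps_map inv\<kappa>0 inv\<kappa> \<kappa>s pps_over_def)
  have map_over: "pps_map \<kappa> h \<in> pps_over (range \<kappa>)" for h by (simp add: pps_over_def nth_pps_map \<kappa>s)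
  have T: "subring (pps_over (gen_alg \<kappa> gs))" by (intro subring_pps_over subring_gen_alg[OF \<kappa>])
  note Is = ideal_onD[OF 0(2) T]
  have "I \<subseteq> {0}"
  proof (rule subsetI, rule ccontr)
    fix x assume x: "x \<in> I" "x \<notin> {0}"
    define h where "h = \<mu> x"
    have xh: "x = pps_map \<kappa> h" using \<mu>' Is(1)[OF x(1)] by (simp add: h_def gs)
    have "h \<noteq> 0" using x(2) xh maps by auto
    then obtain q y where y: "q \<ge> 0" "h = pps_t q * y" "pps_nth y 0 \<noteq> 0" using pps_factor_t by metis
    obtain N F where N: "N > 0" "y = pps_of N F" using pps_of_exists by blast
    have "fps_nth F 0 \<noteq> 0" using y(3) nth_pps_of_div[OF N(1), of F 0] by (simp add: N)
    then have "inverse F * F = 1" by (rule inverse_mult_eq_1)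
    then have inv: "pps_of N (inverse F) * y = 1" using N by (simp add: pps_of_times pps_of_1)
    have "x = pps_map \<kappa> (pps_t q) * pps_map \<kappa> y" by (simp add: xh y(2) maps)
    also have "pps_map \<kappa> (pps_t q) = pps_t q"
      by (rule pps_eqI) (simp add: nth_pps_map \<kappa>s nth_pps_t y(1))
    finally have "pps_t q * pps_map \<kappa> y \<in> I" using x(1) by simp
    then have "pps_map \<kappa> y \<in> I" using 0(4) y(1) map_over by (auto simp: t_saturated_def gs)
    then have "pps_map \<kappa> (pps_of N (inverse F)) * pps_map \<kappa> y \<in> I"
      using map_over by (intro Is(4)) (auto simp: gs)
    then show False using 0(3) inv by (simp flip: maps)
  qed
  moreover have "hom_on (pps_over (range \<kappa>)) (\<lambda>x. puiseux_emb (\<mu> x))"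
    unfolding hom_on_def
  proof (intro conjI ballI)
    show "puiseux_emb (\<mu> 1) = 1" using \<mu>[of 1] by (simp add: maps)
    fix x y assume "x \<in> pps_over (range \<kappa>)" "y \<in> pps_over (range \<kappa>)"
    then obtain a b where "x = pps_map \<kappa> a" "y = pps_map \<kappa> b" using \<mu>' by metis
    then show "puiseux_emb (\<mu> (x + y)) = puiseux_emb (\<mu> x) + puiseux_emb (\<mu> y)"
      "puiseux_emb (\<mu> (x * y)) = puiseux_emb (\<mu> x) * puiseux_emb (\<mu> y)"
      by (simp_all add: \<mu> flip: maps)
  qed
  moreover have "\<mu> 0 = 0" using \<mu>[of 0] by (simp add: maps)
  ultimately show ?case
    by (intro exI[of _ "\<lambda>x. puiseux_emb (\<mu> x)"]) (auto simp: gs \<mu>)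
next
  case (Suc n)
  then obtain y gs0 where gs: "gs = y # gs0" "length gs0 = n" by (cases gs) auto
  obtain I' f where I': "I \<subseteq> I'" "ideal_on (pps_over (gen_alg \<kappa> gs)) I'" "1 \<notin> I'"
    "t_saturated (pps_over (gen_alg \<kappa> gs)) I'" and f: "f \<in> I'" "nontrivial_rep \<kappa> gs (pps_nth f 0)"
    using exists_algebraic_relation[OF \<kappa> Suc.prems[unfolded gs(1)]] unfolding gs(1) by metis
  obtain gs' P d u where gs': "length gs' = length gs0" "gen_alg \<kappa> (y # gs') = gen_alg \<kappa> gs"
    and P: "P \<in> polys_over (gen_alg \<kappa> gs')" "u \<noteq> 0" "coeff P d = \<kappa> u" "\<And>i. i > d \<Longrightarrow> coeff P i = 0"
      "poly P y = pps_nth f 0"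
    using nagata_normalization[OF \<kappa> f(2)[unfolded gs(1)]] unfolding gs(1) by metis
  define A A' where "A = gen_alg \<kappa> gs" and "A' = gen_alg \<kappa> gs'"
  have A: "subring A" and A': "subring A'" by (simp_all add: A_def A'_def subring_gen_alg[OF \<kappa>])
  have AA': "A = (\<lambda>p. poly p y) ` polys_over A'" using gs'(2) by (simp add: A_def A'_def)
  have "A' \<subseteq> A" unfolding AA' by (rule poly_image_base[OF A'])
  then have sub: "pps_over A' \<subseteq> pps_over A" by (auto simp: pps_over_def)
  note T = subring_pps_over[OF A] and T' = subring_pps_over[OF A']
  note Is = ideal_onD[OF I'(2)[folded A_def] T] and Ts = subringD[OF T] and T's = subringD[OF T']
  have yA: "y \<in> A" unfolding AA' by (rule poly_image_gen[OF A'])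
  note yT = pps_const_over[OF A yA]
  note \<kappa>s = hom_onD[OF \<kappa> subring_UNIV, simplified]
  have span: "\<exists>p\<in>polys_over (pps_over A'). (\<forall>i\<ge>d. coeff p i = 0) \<and> g - poly p (pps_const y) \<in> I'"
    if g: "g \<in> pps_over A" for g
  proof -
    have "\<kappa> (inverse u) * coeff P d = 1" using P(2) by (simp add: P(3) \<kappa>s flip: \<kappa>s(4))
    moreover have "\<kappa> (inverse u) \<in> A'" unfolding A'_def by (rule range_gen_alg[OF \<kappa>])
    ultimately obtain q p where "q \<in> pps_over A" "p \<in> polys_over (pps_over A')" "\<forall>i\<ge>d. coeff p i = 0"
      "g = q * f + poly p (pps_const y)"
      using weierstrass_division[OF A' A AA' P(1)[folded A'_def] P(4) _ _ Is(1)[OF f(1)] P(5)[symmetric] g]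
      by blast
    then show ?thesis using Is(4)[OF _ f(1)] by (intro bexI[of _ p]) auto
  qed
  have ideal': "ideal_on (pps_over A') (I' \<inter> pps_over A')"
    using Is T's sub by (auto simp: ideal_on_def)
  have "\<exists>\<psi>. hom_on (pps_over A') \<psi> \<and> (\<forall>x\<in>I' \<inter> pps_over A'. \<psi> x = 0) \<and>
    (\<forall>x\<in>pps_over A'. \<psi> x \<in> puiseux_O) \<and> (\<forall>h. \<psi> (pps_map \<kappa> h) = puiseux_emb h)"
    unfolding A'_def
  proof (rule Suc.hyps(1))
    show "n = length gs'" using gs gs' by simp
    show "ideal_on (pps_over (gen_alg \<kappa> gs')) (I' \<inter> pps_over (gen_alg \<kappa> gs'))" using ideal' by (simp add: A'_def)
    show "1 \<notin> I' \<inter> pps_over (gen_alg \<kappa> gs')" using I'(3) by simp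
    show "t_saturated (pps_over (gen_alg \<kappa> gs')) (I' \<inter> pps_over (gen_alg \<kappa> gs'))"
      using I'(4) sub by (auto simp: t_saturated_def A_def A'_def)
  qed
  then obtain \<psi> where \<psi>: "hom_on (pps_over A') \<psi>" "\<And>x. x \<in> pps_over A' \<Longrightarrow> x \<in> I' \<Longrightarrow> \<psi> x = 0"
    "\<And>x. x \<in> pps_over A' \<Longrightarrow> \<psi> x \<in> puiseux_O" "\<And>h. \<psi> (pps_map \<kappa> h) = puiseux_emb h"
    by auto
  obtain \<Psi> where \<Psi>: "hom_on (pps_over A) \<Psi>" "\<And>x. x \<in> pps_over A' \<Longrightarrow> \<Psi> x = \<psi> x" "\<And>x. x \<in> I' \<Longrightarrow> \<Psi> x = 0"
    using extend_hom_finite[OF T' sub T I'(2)[folded A_def] yT \<psi>(1,2) span] by metis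
  note \<Psi>s = hom_onD[OF \<Psi>(1) T]
  define b where "b = \<Psi> (pps_const y)"
  have rep: "\<exists>r. (\<forall>i. r i \<in> puiseux_O) \<and> \<Psi> g = (\<Sum>i<d. r i * b ^ i)" if g: "g \<in> pps_over A" for g
  proof -
    obtain p where p: "\<And>i. coeff p i \<in> pps_over A'" "\<And>i. i \<ge> d \<Longrightarrow> coeff p i = 0"
      "g - poly p (pps_const y) \<in> I'"
      using span[OF g] by (auto simp: polys_over_def)
    have pA: "coeff p i \<in> pps_over A" for i using p(1) sub by blast
    have eval: "poly p (pps_const y) = (\<Sum>i<d. coeff p i * pps_const y ^ i)"
      by (rule poly_eq_sum_lessThan) (rule p(2))
    have "poly p (pps_const y) \<in> pps_over A"
      using pA yT by (intro poly_in_subring[OF T]) (auto simp: polys_over_def)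
    then have "\<Psi> g = \<Psi> (poly p (pps_const y))"
      using \<Psi>(3)[OF p(3)] \<Psi>s(6)[OF g] by simp
    also have "\<dots> = (\<Sum>i<d. \<Psi> (coeff p i * pps_const y ^ i))"
      unfolding eval by (rule hom_on_sum[OF \<Psi>(1) T]) (simp add: Ts(6,7) pA yT)
    also have "\<dots> = (\<Sum>i<d. \<psi> (coeff p i) * b ^ i)"
      by (simp add: \<Psi>s(4,7) pA yT Ts(7) \<Psi>(2) p(1) b_def)
    finally show ?thesis using \<psi>(3)[OF p(1)] by (intro exI[of _ "\<lambda>i. \<psi> (coeff p i)"]) simp
  qed
  have b_power: "\<Psi> (pps_const y ^ d) = b ^ d" unfolding b_def by (rule \<Psi>s(7)[OF yT])
  have bO: "b \<in> puiseux_O"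
  proof -
    obtain r where "\<And>i. r i \<in> puiseux_O" "b ^ d = (\<Sum>i<d. r i * b ^ i)"
      using rep[OF Ts(7)[OF yT, of d]] unfolding b_power by blast
    then show ?thesis by (intro puiseux_O_integrally_closed[of d r b]) auto
  qed
  have "\<Psi> x \<in> puiseux_O" if x: "x \<in> pps_over A" for x
  proof -
    obtain r where "\<And>i. r i \<in> puiseux_O" "\<Psi> x = (\<Sum>i<d. r i * b ^ i)" using rep[OF x] by blast
    then show ?thesis using bO by (auto intro!: puiseux_O_sum puiseux_O_closed puiseux_O_power)
  qed
  moreover have "\<Psi> (pps_map \<kappa> h) = puiseux_emb h" for h
  proof -
    have "pps_map \<kappa> h \<in> pps_over A'"
      using range_gen_alg[OF \<kappa>] by (simp add: pps_over_def nth_pps_map \<kappa>s A'_def)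
    then show ?thesis using \<Psi>(2) \<psi>(4) by simp
  qed
  ultimately show ?case
    unfolding A_def[symmetric] using \<Psi>(1,3) I'(1) by (intro exI[of _ \<Psi>]) auto
qed

section \<open>Additive maps on polynomials given on terms\<close>

text \<open>Evaluation, slices and the passage to Laurent polynomials are all additive maps prescribed on
  terms, and multiplicative if they are multiplicative on terms.\<close>

definition on_terms :: "('b \<Rightarrow> 'a \<Rightarrow> 'c::comm_monoid_add) \<Rightarrow> ('b \<Rightarrow>\<^sub>0 'a::zero) \<Rightarrow> 'c" where
  "on_terms F h = (\<Sum>\<beta>\<in>Poly_Mapping.keys h. F \<beta> (Poly_Mapping.lookup h \<beta>))"

lemma on_terms_superset:
  assumes "finite S" "Poly_Mapping.keys h \<subseteq> S" "\<And>\<beta>. F \<beta> 0 = 0"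
  shows "on_terms F h = (\<Sum>\<beta>\<in>S. F \<beta> (Poly_Mapping.lookup h \<beta>))"
  unfolding on_terms_def by (rule sum.mono_neutral_left) (use assms in \<open>auto simp: in_keys_iff\<close>)

lemma on_terms_single: "(\<And>\<beta>. F \<beta> 0 = 0) \<Longrightarrow> on_terms F (Poly_Mapping.single \<beta> a) = F \<beta> a"
  by (cases "a = 0") (auto simp: on_terms_def)

lemma on_terms_add:
  assumes "\<And>\<beta>. F \<beta> 0 = 0" "\<And>\<beta> a b. F \<beta> (a + b) = F \<beta> a + F \<beta> b"
  shows "on_terms F (g + h) = on_terms F g + on_terms F h"
proof -
  let ?S = "Poly_Mapping.keys g \<union> Poly_Mapping.keys h"
  have S: "finite ?S" by simp
  show ?thesis
    using on_terms_superset[OF S, of "g + h" F] on_terms_superset[OF S, of g F]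
      on_terms_superset[OF S, of h F] assms keys_add[of g h]
    by (simp add: lookup_add sum.distrib)
qed

lemma on_terms_sum:
  assumes "\<And>\<beta>. F \<beta> 0 = 0" "\<And>\<beta> a b. F \<beta> (a + b) = F \<beta> a + F \<beta> b"
  shows "on_terms F (sum g S) = (\<Sum>i\<in>S. on_terms F (g i))"
proof (induction S rule: infinite_finite_induct)
  case (insert x S)
  then show ?case by (simp add: on_terms_add[of F, OF assms])
qed (simp_all add: on_terms_def)

lemma poly_mapping_sum_single:
  "h = (\<Sum>\<beta>\<in>Poly_Mapping.keys h. Poly_Mapping.single \<beta> (Poly_Mapping.lookup h \<beta>))"
proof (rule poly_mapping_eqI)
  fix \<gamma>
  have "Poly_Mapping.lookup (\<Sum>\<beta>\<in>Poly_Mapping.keys h. Poly_Mapping.single \<beta> (Poly_Mapping.lookup h \<beta>)) \<gamma> =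
      (\<Sum>\<beta>\<in>Poly_Mapping.keys h. if \<beta> = \<gamma> then Poly_Mapping.lookup h \<gamma> else 0)"
    by (auto simp: lookup_sum lookup_single when_def intro!: sum.cong)
  then show "Poly_Mapping.lookup h \<gamma> =
      Poly_Mapping.lookup (\<Sum>\<beta>\<in>Poly_Mapping.keys h. Poly_Mapping.single \<beta> (Poly_Mapping.lookup h \<beta>)) \<gamma>"
    by (simp add: in_keys_iff)
qed

lemma poly_mapping_times_expand:
  fixes g h :: "'b::monoid_add \<Rightarrow>\<^sub>0 'a::semiring_0"
  shows "g * h = (\<Sum>\<beta>\<in>Poly_Mapping.keys g. \<Sum>\<gamma>\<in>Poly_Mapping.keys h.
    Poly_Mapping.single (\<beta> + \<gamma>) (Poly_Mapping.lookup g \<beta> * Poly_Mapping.lookup h \<gamma>))"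
  by (subst poly_mapping_sum_single[of g], subst poly_mapping_sum_single[of h])
    (simp only: sum_product mult_single)

lemma on_terms_mult:
  fixes F :: "'b::monoid_add \<Rightarrow> 'a::semiring_0 \<Rightarrow> 'c::semiring_0"
  assumes "\<And>\<beta>. F \<beta> 0 = 0" "\<And>\<beta> a b. F \<beta> (a + b) = F \<beta> a + F \<beta> b"
    and "\<And>\<beta> \<gamma> a b. F (\<beta> + \<gamma>) (a * b) = F \<beta> a * F \<gamma> b"
  shows "on_terms F (g * h) = on_terms F g * on_terms F h"
  by (subst poly_mapping_times_expand)
    (simp add: on_terms_sum[of F, OF assms(1,2)] on_terms_single[of F, OF assms(1)] assms(3)
      on_terms_def[of F g] on_terms_def[of F h] sum_product)

lemma mpoly_eval_on_terms:
  "mpoly_eval f p = on_terms (\<lambda>\<beta> a. a * (\<Prod>i\<in>UNIV. (p $ i) ^ Poly_Mapping.lookup \<beta> i)) f"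
  by (simp add: mpoly_eval_def on_terms_def)

lemma mpoly_eval_add: "mpoly_eval (f + g) p = mpoly_eval f p + mpoly_eval g p"
  unfolding mpoly_eval_on_terms by (rule on_terms_add) (simp_all add: algebra_simps)

lemma mpoly_eval_mult: "mpoly_eval (f * g) p = mpoly_eval f p * mpoly_eval g p"
  unfolding mpoly_eval_on_terms
  by (rule on_terms_mult) (simp_all add: algebra_simps lookup_add power_add prod.distrib)

section \<open>Slices of a polynomial\<close>

definition puiseux_const :: "'a::field \<Rightarrow> 'a puiseux" where
  "puiseux_const c = puiseux_emb (pps_const c)"

lemma nth_puiseux_const_times: "puiseux_nth (puiseux_const c * x) q = c * puiseux_nth x q"
proof (cases "x = 0")
  case False
  then obtain m u where "x = tpow m * u" "u \<in> puiseux_O" using puiseux_normal_form by metis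
  then obtain y where "x = tpow m * puiseux_emb y" using puiseux_O_emb by metis
  moreover have "puiseux_const c * (tpow m * puiseux_emb y) = tpow m * puiseux_emb (pps_const c * y)"
    by (simp add: puiseux_const_def mult_ac)
  ultimately show ?thesis by (simp only: puiseux_nth_tpow_times nth_puiseux_emb nth_pps_const_times)
qed simp

definition rwt :: "('n::finite \<Rightarrow> rat) \<Rightarrow> ('n \<Rightarrow>\<^sub>0 nat) \<Rightarrow> rat" where
  "rwt w \<beta> = (\<Sum>i\<in>UNIV. w i * of_nat (Poly_Mapping.lookup \<beta> i))"

lemma rwt_add: "rwt w (\<beta> + \<gamma>) = rwt w \<beta> + rwt w \<gamma>"
  by (simp add: rwt_def lookup_add algebra_simps sum.distrib)

lemma rwt_0 [simp]: "rwt w 0 = 0"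
  by (simp add: rwt_def)

text \<open>The coefficient of \<open>t\<^sup>e\<close> in the polynomial that arises from \<open>f\<close> by substituting \<open>t\<close> to the power \<open>- w i\<close>
  times \<open>x\<^sub>i\<close> for every \<open>x\<^sub>i\<close>. This substitution transforms the weight \<open>w\<close> into the weight \<open>0\<close>.\<close>

definition slice :: "('n::finite \<Rightarrow> rat) \<Rightarrow> rat \<Rightarrow> ('n, 'a::field puiseux) mpoly \<Rightarrow> ('n, 'a) mpoly" where
  "slice w e = on_terms (\<lambda>\<beta> a. Poly_Mapping.single \<beta> (puiseux_nth a (e + rwt w \<beta>)))"

lemma lookup_slice: "Poly_Mapping.lookup (slice w e f) \<beta> = puiseux_nth (Poly_Mapping.lookup f \<beta>) (e + rwt w \<beta>)"
proof -
  have "Poly_Mapping.lookup (slice w e f) \<beta> = (\<Sum>\<gamma>\<in>Poly_Mapping.keys f.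
      if \<gamma> = \<beta> then puiseux_nth (Poly_Mapping.lookup f \<beta>) (e + rwt w \<beta>) else 0)"
    by (auto simp: slice_def on_terms_def lookup_sum lookup_single when_def intro!: sum.cong)
  then show ?thesis by (simp add: in_keys_iff)
qed

lemma slice_add: "slice w e (f + g) = slice w e f + slice w e g"
  by (rule poly_mapping_eqI) (simp add: lookup_slice lookup_add puiseux_nth_add)

lemma slice_0 [simp]: "slice w e 0 = 0"
  by (rule poly_mapping_eqI) (simp add: lookup_slice)

lemma slice_sum: "slice w e (sum f S) = (\<Sum>i\<in>S. slice w e (f i))"
  by (induction S rule: infinite_finite_induct) (auto simp: slice_add)

lemma slice_single: "slice w e (Poly_Mapping.single \<beta> a) = Poly_Mapping.single \<beta> (puiseux_nth a (e + rwt w \<beta>))"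
  by (simp add: slice_def on_terms_single)

text \<open>The polynomial that the substitution behind slices transforms into \<open>t\<^sup>a k(x)\<close>.\<close>

definition twisted :: "('n::finite \<Rightarrow> rat) \<Rightarrow> rat \<Rightarrow> ('n, 'a::field) mpoly \<Rightarrow> ('n, 'a puiseux) mpoly" where
  "twisted w a = on_terms (\<lambda>\<nu> c. Poly_Mapping.single \<nu> (puiseux_const c * tpow (rwt w \<nu> + a)))"

lemma slice_twisted_mult: "slice w e (twisted w a k * f) = k * slice w (e - a) f"
proof -
  have term_eq: "slice w e (Poly_Mapping.single \<nu> (puiseux_const c * tpow (rwt w \<nu> + a)) * Poly_Mapping.single \<beta> b) =
      Poly_Mapping.single \<nu> c * Poly_Mapping.single \<beta> (puiseux_nth b (e - a + rwt w \<beta>))" for \<nu> c \<beta> b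
  proof -
    have "puiseux_nth (puiseux_const c * tpow (rwt w \<nu> + a) * b) (e + rwt w (\<nu> + \<beta>)) =
        c * puiseux_nth b (e - a + rwt w \<beta>)"
      by (simp only: mult.assoc nth_puiseux_const_times puiseux_nth_tpow_times rwt_add)
        (simp add: algebra_simps)
    then show ?thesis by (simp add: mult_single slice_single)
  qed
  have "slice w e (twisted w a k * f) = (\<Sum>\<nu>\<in>Poly_Mapping.keys k. \<Sum>\<beta>\<in>Poly_Mapping.keys f.
      slice w e (Poly_Mapping.single \<nu> (puiseux_const (Poly_Mapping.lookup k \<nu>) * tpow (rwt w \<nu> + a)) *
        Poly_Mapping.single \<beta> (Poly_Mapping.lookup f \<beta>)))"
    unfolding twisted_def on_terms_def
    by (subst poly_mapping_sum_single[of f]) (simp only: sum_product slice_sum)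
  also have "\<dots> = (\<Sum>\<nu>\<in>Poly_Mapping.keys k. Poly_Mapping.single \<nu> (Poly_Mapping.lookup k \<nu>)) *
      (\<Sum>\<beta>\<in>Poly_Mapping.keys f. Poly_Mapping.single \<beta> (puiseux_nth (Poly_Mapping.lookup f \<beta>) (e - a + rwt w \<beta>)))"
    unfolding term_eq by (simp only: sum_product)
  also have "\<dots> = k * slice w (e - a) f"
    unfolding poly_mapping_sum_single[symmetric] slice_def on_terms_def ..
  finally show ?thesis .
qed

lemma wdeg_rat:
  fixes \<omega> :: "real ^ 'n::finite"
  assumes "\<And>i. \<omega> $ i = of_rat (w i)"
  shows "wdeg \<omega> (\<alpha>, \<beta>) = - of_rat (\<alpha> - rwt w \<beta>)"
  by (simp add: wdeg_def assms rwt_def of_rat_diff of_rat_sum of_rat_mult)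

text \<open>The \<open>(-1, \<omega>)\<close>-degree of a term is the negative of the exponent of \<open>t\<close> after the substitution, so the
  terms of maximal degree are those of the first slice that does not vanish.\<close>

lemma t_in_slice:
  fixes f :: "('n::finite, 'a::field puiseux) mpoly" and \<omega> :: "real ^ 'n"
  assumes \<omega>: "\<And>i. \<omega> $ i = of_rat (w i)"
    and m: "slice w m f \<noteq> 0" "\<And>e. e < m \<Longrightarrow> slice w e f = 0"
  shows "t_in \<omega> f = slice w m f"
proof -
  let ?t = "\<lambda>\<beta>. (m + rwt w \<beta>, \<beta>)"
  have terms_iff: "(\<alpha>, \<beta>) \<in> terms f \<longleftrightarrow> Poly_Mapping.lookup (slice w (\<alpha> - rwt w \<beta>) f) \<beta> \<noteq> 0" for \<alpha> \<beta>
    by (simp add: terms_def term_coeff_def lookup_slice)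
  have ge: "m \<le> \<alpha> - rwt w \<beta>" if "(\<alpha>, \<beta>) \<in> terms f" for \<alpha> \<beta>
    using that m(2)[of "\<alpha> - rwt w \<beta>"] by (force simp: terms_iff)
  obtain \<beta>0 where \<beta>0: "Poly_Mapping.lookup (slice w m f) \<beta>0 \<noteq> 0"
    using m(1) by (metis lookup_zero poly_mapping_eqI)
  then have \<beta>0_terms: "?t \<beta>0 \<in> terms f" by (simp add: terms_iff)
  have top: "top_terms \<omega> f = ?t ` Poly_Mapping.keys (slice w m f)"
  proof (intro subset_antisym subsetI)
    fix \<tau> assume \<tau>: "\<tau> \<in> top_terms \<omega> f"
    obtain \<alpha> \<beta> where ab: "\<tau> = (\<alpha>, \<beta>)" by force
    have "(\<alpha>, \<beta>) \<in> terms f" and "wdeg \<omega> (?t \<beta>0) \<le> wdeg \<omega> (\<alpha>, \<beta>)"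
      using \<tau> \<beta>0_terms by (auto simp: top_terms_def ab)
    then have "\<alpha> - rwt w \<beta> = m" using ge by (auto simp: wdeg_rat[of \<omega> w, OF \<omega>] of_rat_less_eq intro: antisym)
    moreover from this have "\<beta> \<in> Poly_Mapping.keys (slice w m f)"
      using \<open>(\<alpha>, \<beta>) \<in> terms f\<close> by (simp add: terms_iff in_keys_iff)
    ultimately show "\<tau> \<in> ?t ` Poly_Mapping.keys (slice w m f)" by (auto simp: ab)
  next
    fix \<tau> assume "\<tau> \<in> ?t ` Poly_Mapping.keys (slice w m f)"
    then obtain \<beta> where \<beta>: "\<tau> = ?t \<beta>" "Poly_Mapping.lookup (slice w m f) \<beta> \<noteq> 0" by (auto simp: in_keys_iff)
    have "wdeg \<omega> \<sigma> \<le> wdeg \<omega> \<tau>" if "\<sigma> \<in> terms f" for \<sigma>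
      using that ge[of "fst \<sigma>" "snd \<sigma>"] wdeg_rat[of \<omega> w, OF \<omega>, of "fst \<sigma>" "snd \<sigma>"]
      by (simp add: \<beta>(1) wdeg_rat[of \<omega> w, OF \<omega>] of_rat_less_eq)
    then show "\<tau> \<in> top_terms \<omega> f" using \<beta> by (simp add: top_terms_def terms_iff)
  qed
  have inj: "inj_on ?t S" for S by (auto simp: inj_on_def)
  have "t_in \<omega> f = (\<Sum>\<beta>\<in>Poly_Mapping.keys (slice w m f). Poly_Mapping.single \<beta> (term_coeff f (?t \<beta>)))"
    unfolding t_in_eq set_t_1_in_form top by (simp add: sum.reindex[OF inj])
  also have "\<dots> = (\<Sum>\<beta>\<in>Poly_Mapping.keys (slice w m f). Poly_Mapping.single \<beta> (Poly_Mapping.lookup (slice w m f) \<beta>))"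
    by (simp add: lookup_slice term_coeff_def)
  finally show ?thesis by (simp flip: poly_mapping_sum_single)
qed

lemma least_slice:
  fixes f :: "('n::finite, 'a::field puiseux) mpoly"
  assumes "f \<noteq> 0"
  obtains m where "slice w m f \<noteq> 0" "\<And>e. e < m \<Longrightarrow> slice w e f = 0"
proof -
  define \<omega> :: "real ^ 'n" where "\<omega> = (\<chi> i. of_rat (w i))"
  have \<omega>: "\<omega> $ i = of_rat (w i)" for i by (simp add: \<omega>_def)
  obtain \<alpha> \<beta> where top: "(\<alpha>, \<beta>) \<in> top_terms \<omega> f" using top_terms_nonempty[OF assms, of \<omega>] by force
  show ?thesis
  proof (rule that[of "\<alpha> - rwt w \<beta>"])
    have "Poly_Mapping.lookup (slice w (\<alpha> - rwt w \<beta>) f) \<beta> \<noteq> 0"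
      using top by (simp add: lookup_slice top_terms_def terms_def term_coeff_def)
    then show "slice w (\<alpha> - rwt w \<beta>) f \<noteq> 0" by auto
    fix e assume e: "e < \<alpha> - rwt w \<beta>"
    show "slice w e f = 0"
    proof (rule poly_mapping_eqI, rule ccontr)
      fix \<gamma> assume "Poly_Mapping.lookup (slice w e f) \<gamma> \<noteq> Poly_Mapping.lookup 0 \<gamma>"
      then have "(e + rwt w \<gamma>, \<gamma>) \<in> terms f" by (simp add: lookup_slice terms_def term_coeff_def)
      then have "wdeg \<omega> (e + rwt w \<gamma>, \<gamma>) \<le> wdeg \<omega> (\<alpha>, \<beta>)" using top by (simp add: top_terms_def)
      then show False using e by (simp add: wdeg_rat[of \<omega> w, OF \<omega>] of_rat_less_eq)
    qed
  qed
qed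

lemma tpow_prod: "(\<Prod>i\<in>S. tpow (a i)) = tpow (\<Sum>i\<in>S. a i)"
  by (induction S rule: infinite_finite_induct) (auto simp: tpow_add)

lemma mpoly_eval_tpow_times:
  fixes f :: "('n::finite, 'a::field puiseux) mpoly" and p :: "'a puiseux ^ 'n"
  assumes "\<And>i. p $ i = tpow (- w i) * u i"
  shows "mpoly_eval f p = (\<Sum>\<beta>\<in>Poly_Mapping.keys f.
    (tpow (- rwt w \<beta>) * Poly_Mapping.lookup f \<beta>) * (\<Prod>i\<in>UNIV. u i ^ Poly_Mapping.lookup \<beta> i))"
proof -
  have "(\<Prod>i\<in>UNIV. (p $ i) ^ Poly_Mapping.lookup \<beta> i) =
      tpow (- rwt w \<beta>) * (\<Prod>i\<in>UNIV. u i ^ Poly_Mapping.lookup \<beta> i)" for \<beta>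
    unfolding assms power_mult_distrib prod.distrib tpow_power tpow_prod
    by (simp add: rwt_def sum_negf mult.commute)
  then show ?thesis by (simp add: mpoly_eval_def mult_ac)
qed

section \<open>Zeros give points of the tropical variety\<close>

lemma puiseux_O_prod: "(\<And>i. i \<in> S \<Longrightarrow> f i \<in> puiseux_O) \<Longrightarrow> prod f S \<in> puiseux_O"
  by (induction S rule: infinite_finite_induct) auto

lemma puiseux_res_prod:
  "(\<And>i. i \<in> S \<Longrightarrow> f i \<in> puiseux_O) \<Longrightarrow> puiseux_nth (prod f S) 0 = (\<Prod>i\<in>S. puiseux_nth (f i) 0)"
  by (induction S rule: infinite_finite_induct)
    (auto simp: puiseux_nth_one puiseux_res_mult puiseux_O_prod)

text \<open>Let \<open>m\<close> be the index of the first non-zero slice. The terms of \<open>f(p) = 0\<close> have valuation at least \<open>m\<close>,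
  and the coefficient of \<open>t\<^sup>m\<close> in their sum is the value of the initial form at the residues of the
  \<open>u i\<close>.\<close>

lemma t_in_vanishes:
  fixes f :: "('n::finite, 'a::field puiseux) mpoly" and \<omega> :: "real ^ 'n" and p :: "'a puiseux ^ 'n"
  assumes \<omega>: "\<And>i. \<omega> $ i = of_rat (w i)" and p: "\<And>i. p $ i = tpow (- w i) * u i" "\<And>i. u i \<in> puiseux_O"
    and zero: "mpoly_eval f p = 0"
  shows "mpoly_eval (t_in \<omega> f) (\<chi> i. puiseux_nth (u i) 0) = 0"
proof (cases "f = 0")
  case True
  then show ?thesis by (simp add: t_in_def mpoly_eval_def)
next
  case False
  then obtain m where m: "slice w m f \<noteq> 0" "\<And>e. e < m \<Longrightarrow> slice w e f = 0" using least_slice by metis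
  have keys: "Poly_Mapping.keys (slice w m f) \<subseteq> Poly_Mapping.keys f"
    by (auto simp: in_keys_iff lookup_slice)
  let ?c = "\<lambda>i. puiseux_nth (u i) 0"
  have coeff: "puiseux_nth (tpow (- rwt w \<beta>) * Poly_Mapping.lookup f \<beta> * (\<Prod>i\<in>UNIV. u i ^ Poly_Mapping.lookup \<beta> i)) m =
      Poly_Mapping.lookup (slice w m f) \<beta> * (\<Prod>i\<in>UNIV. ?c i ^ Poly_Mapping.lookup \<beta> i)" for \<beta>
  proof -
    define b where "b = tpow (- m) * (tpow (- rwt w \<beta>) * Poly_Mapping.lookup f \<beta>)"
    have nth_b: "puiseux_nth b e = Poly_Mapping.lookup (slice w (e + m) f) \<beta>" for e
      by (simp add: b_def puiseux_nth_tpow_times lookup_slice)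
    have b: "b \<in> puiseux_O" by (simp add: puiseux_O_def nth_b m(2))
    let ?U = "\<Prod>i\<in>UNIV. u i ^ Poly_Mapping.lookup \<beta> i"
    have U: "?U \<in> puiseux_O" by (intro puiseux_O_prod puiseux_O_power p(2))
    have "tpow (- rwt w \<beta>) * Poly_Mapping.lookup f \<beta> * ?U = tpow m * (b * ?U)"
      by (simp add: b_def tpow_add flip: mult.assoc)
    then have "puiseux_nth (tpow (- rwt w \<beta>) * Poly_Mapping.lookup f \<beta> * ?U) m = puiseux_nth (b * ?U) 0"
      by (simp only: puiseux_nth_tpow_times diff_self)
    also have "\<dots> = puiseux_nth b 0 * puiseux_nth ?U 0" by (rule puiseux_res_mult[OF b U])
    also have "puiseux_nth ?U 0 = (\<Prod>i\<in>UNIV. ?c i ^ Poly_Mapping.lookup \<beta> i)"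
      using p(2) by (simp add: puiseux_res_prod puiseux_O_power puiseux_res_power)
    finally show ?thesis by (simp add: nth_b)
  qed
  have "0 = puiseux_nth (mpoly_eval f p) m" using zero by simp
  also have "\<dots> = (\<Sum>\<beta>\<in>Poly_Mapping.keys f.
      Poly_Mapping.lookup (slice w m f) \<beta> * (\<Prod>i\<in>UNIV. ?c i ^ Poly_Mapping.lookup \<beta> i))"
    unfolding mpoly_eval_tpow_times[of p w u, OF p(1)] puiseux_nth_sum coeff ..
  also have "\<dots> = mpoly_eval (slice w m f) (\<chi> i. ?c i)"
    unfolding mpoly_eval_on_terms by (subst on_terms_superset[OF finite_keys keys]) auto
  finally show ?thesis by (simp add: t_in_slice[OF \<omega> m])
qed

text \<open>All initial forms vanish at the leading coefficients of \<open>p\<close>, and hence so does the ideal that they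
  generate; a monomial does not, as the leading coefficients are not zero.\<close>

lemma zero_imp_Trop:
  fixes J :: "('n::finite, 'a::field puiseux) mpoly set" and \<omega> :: "real ^ 'n"
  assumes p: "p \<in> zero_set J" and val: "\<And>i. - pval (p $ i) = ereal (\<omega> $ i)"
  shows "\<omega> \<in> Trop J"
proof -
  have "\<exists>m u. p $ i = tpow m * u \<and> u \<in> puiseux_O \<and> puiseux_nth u 0 \<noteq> 0 \<and> \<omega> $ i = of_rat (- m)" for i
  proof -
    have "p $ i \<noteq> 0" using val[of i] by (auto simp: pval_def)
    then obtain m u where mu: "p $ i = tpow m * u" "u \<in> puiseux_O" "puiseux_nth u 0 \<noteq> 0"
      "pval (p $ i) = ereal (of_rat m)" by (rule puiseux_normal_form)
    then show ?thesis using val[of i] by (intro exI[of _ m] exI[of _ u]) (simp add: of_rat_minus)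
  qed
  then obtain m u where mu: "\<And>i. p $ i = tpow (m i) * u i" "\<And>i. u i \<in> puiseux_O"
    "\<And>i. puiseux_nth (u i) 0 \<noteq> 0" "\<And>i. \<omega> $ i = of_rat (- m i)"
    by metis
  define c where "c = (\<chi> i. puiseux_nth (u i) 0)"
  interpret M: module "(*) :: ('n, 'a) mpoly \<Rightarrow> ('n, 'a) mpoly \<Rightarrow> ('n, 'a) mpoly" by (rule module_times)
  have sub: "M.subspace {h. mpoly_eval h c = 0}"
    unfolding M.subspace_def by (auto simp: mpoly_eval_add mpoly_eval_mult) (simp add: mpoly_eval_def)
  have "mpoly_eval (t_in \<omega> f) c = 0" if "f \<in> J" for f
    unfolding c_def
    by (rule t_in_vanishes[of \<omega> "\<lambda>i. - m i" p u]) (use mu p that in \<open>auto simp: zero_set_def\<close>)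
  then have "t_in_ideal \<omega> J \<subseteq> {h. mpoly_eval h c = 0}"
    unfolding t_in_ideal_def by (intro M.span_minimal sub) auto
  moreover have "mpoly_eval (monom_x \<beta>) c \<noteq> 0" for \<beta> :: "'n \<Rightarrow>\<^sub>0 nat"
    using mu(3) by (simp add: mpoly_eval_def c_def)
  ultimately show ?thesis by (auto simp: Trop_def)
qed

section \<open>Laurent polynomials\<close>

type_synonym ('n, 'a) laurent = "('n \<Rightarrow>\<^sub>0 int) \<Rightarrow>\<^sub>0 'a"

definition int_exps :: "('n \<Rightarrow>\<^sub>0 nat) \<Rightarrow> ('n \<Rightarrow>\<^sub>0 int)" where
  "int_exps \<beta> = Poly_Mapping.map int \<beta>"

lemma lookup_int_exps [simp]: "Poly_Mapping.lookup (int_exps \<beta>) i = int (Poly_Mapping.lookup \<beta> i)"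
  by (simp add: int_exps_def map.rep_eq when_def)

lemma int_exps_add: "int_exps (\<beta> + \<gamma>) = int_exps \<beta> + int_exps \<gamma>"
  by (rule poly_mapping_eqI) (simp add: lookup_add)

lemma int_exps_eq_iff [simp]: "int_exps \<beta> = int_exps \<gamma> \<longleftrightarrow> \<beta> = \<gamma>"
  by (metis lookup_int_exps of_nat_eq_iff poly_mapping_eqI)

lemma int_exps_0 [simp]: "int_exps 0 = 0"
  by (rule poly_mapping_eqI) simp

definition to_laurent :: "('n, 'a::field) mpoly \<Rightarrow> ('n, 'a) laurent" where
  "to_laurent = on_terms (\<lambda>\<beta> a. Poly_Mapping.single (int_exps \<beta>) a)"

lemma to_laurent_single: "to_laurent (Poly_Mapping.single \<beta> a) = Poly_Mapping.single (int_exps \<beta>) a"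
  by (simp add: to_laurent_def on_terms_single)

lemma to_laurent_add: "to_laurent (f + g) = to_laurent f + to_laurent g"
  unfolding to_laurent_def by (rule on_terms_add) (simp_all add: single_add)

lemma to_laurent_0 [simp]: "to_laurent 0 = 0"
  by (simp add: to_laurent_def on_terms_def)

lemma to_laurent_1 [simp]: "to_laurent 1 = 1"
  using to_laurent_single[of 0 1] by simp

lemma to_laurent_sum: "to_laurent (sum f S) = (\<Sum>i\<in>S. to_laurent (f i))"
  by (induction S rule: infinite_finite_induct) (auto simp: to_laurent_add)

lemma to_laurent_mult: "to_laurent (f * g) = to_laurent f * to_laurent g"
  unfolding to_laurent_def by (rule on_terms_mult) (simp_all add: single_add mult_single int_exps_add)

lemma lookup_to_laurent: "Poly_Mapping.lookup (to_laurent f) (int_exps \<beta>) = Poly_Mapping.lookup f \<beta>"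
proof -
  have "Poly_Mapping.lookup (to_laurent f) (int_exps \<beta>) = (\<Sum>\<gamma>\<in>Poly_Mapping.keys f.
      if \<gamma> = \<beta> then Poly_Mapping.lookup f \<beta> else 0)"
    by (auto simp: to_laurent_def on_terms_def lookup_sum lookup_single when_def intro!: sum.cong)
  then show ?thesis by (simp add: in_keys_iff)
qed

lemma to_laurent_inject: "to_laurent f = to_laurent g \<Longrightarrow> f = g"
  by (metis lookup_to_laurent poly_mapping_eqI)

lemma clear_exponents:
  assumes "finite S"
  shows "\<exists>\<delta>. \<forall>\<nu>\<in>S. \<exists>\<mu>. int_exps \<delta> + \<nu> = int_exps \<mu>"
  using assms
proof (induction S)
  case (insert \<nu> S)
  then obtain \<delta> where \<delta>: "\<forall>\<nu>\<in>S. \<exists>\<mu>. int_exps \<delta> + \<nu> = int_exps \<mu>" by blast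
  define \<epsilon> where "\<epsilon> = Poly_Mapping.map (\<lambda>z. nat (- z)) \<nu>"
  define \<nu>p where "\<nu>p = Poly_Mapping.map nat \<nu>"
  have \<epsilon>: "int_exps \<epsilon> + \<nu> = int_exps \<nu>p"
    by (rule poly_mapping_eqI) (simp add: lookup_add \<epsilon>_def \<nu>p_def map.rep_eq when_def)
  have "\<exists>\<mu>. int_exps (\<delta> + \<epsilon>) + \<nu>' = int_exps \<mu>" if \<nu>': "\<nu>' \<in> insert \<nu> S" for \<nu>'
  proof (cases "\<nu>' = \<nu>")
    case True
    then have "int_exps (\<delta> + \<epsilon>) + \<nu>' = int_exps (\<delta> + \<nu>p)" using \<epsilon> by (simp add: int_exps_add add.assoc)
    then show ?thesis by blast
  next
    case False
    then obtain \<mu> where "int_exps \<delta> + \<nu>' = int_exps \<mu>" using \<delta> \<nu>' by blast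
    then have "int_exps (\<delta> + \<epsilon>) + \<nu>' = int_exps (\<mu> + \<epsilon>)" by (metis int_exps_add add.assoc add.commute)
    then show ?thesis by blast
  qed
  then show ?case by blast
qed simp

text \<open>Coefficients of series are Laurent polynomials, whereas multiples of elements of \<open>J\<close> may be formed
  with polynomials only; a monomial factor mediates between the two.\<close>

lemma clear_denominators:
  fixes H :: "('n, 'a::field) laurent set"
  assumes "finite H"
  obtains \<delta> where "\<And>h. h \<in> H \<Longrightarrow> \<exists>k. to_laurent (monom_x \<delta>) * h = to_laurent k"
proof -
  have "finite (\<Union>h\<in>H. Poly_Mapping.keys h)" using assms by simp
  then obtain \<delta> where \<delta>: "\<forall>\<nu>\<in>(\<Union>h\<in>H. Poly_Mapping.keys h). \<exists>\<mu>. int_exps \<delta> + \<nu> = int_exps \<mu>"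
    using clear_exponents by blast
  have "\<exists>k. to_laurent (monom_x \<delta>) * h = to_laurent k" if h: "h \<in> H" for h
  proof -
    have "\<forall>\<nu>\<in>Poly_Mapping.keys h. \<exists>\<mu>. int_exps \<delta> + \<nu> = int_exps \<mu>" using \<delta> h by blast
    then obtain \<mu> where \<mu>: "\<And>\<nu>. \<nu> \<in> Poly_Mapping.keys h \<Longrightarrow> int_exps \<delta> + \<nu> = int_exps (\<mu> \<nu>)" by metis
    have "to_laurent (monom_x \<delta>) * h =
        (\<Sum>\<nu>\<in>Poly_Mapping.keys h. Poly_Mapping.single (int_exps \<delta> + \<nu>) (Poly_Mapping.lookup h \<nu>))"
      by (subst poly_mapping_sum_single[of h]) (simp add: to_laurent_single sum_distrib_left mult_single)
    also have "\<dots> = to_laurent (\<Sum>\<nu>\<in>Poly_Mapping.keys h. Poly_Mapping.single (\<mu> \<nu>) (Poly_Mapping.lookup h \<nu>))"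
      by (simp add: to_laurent_sum to_laurent_single \<mu>)
    finally show ?thesis by blast
  qed
  then show ?thesis using that by blast
qed

lemma nth_pps_sum: "pps_nth (sum f S) q = (\<Sum>i\<in>S. pps_nth (f i) q)"
  by (induction S rule: infinite_finite_induct) (auto simp: nth_plus_pps)

section \<open>The closure of an ideal in the ring of Puiseux power series\<close>

text \<open>The series that agree with elements of \<open>J\<close> up to any prescribed power of \<open>t\<close> and up to monomial
  factors, after the substitution behind slices. The monomial may depend on \<open>q\<close>, because the
  coefficients of a series may have poles of unbounded order along \<open>x\<^sub>i = 0\<close>. The condition for negative \<open>e\<close>
  forces the substituted \<open>f\<close> to have coefficients in the valuation ring.\<close>

definition closure_ideal :: "('n::finite \<Rightarrow> rat) \<Rightarrow> ('n, 'a::field puiseux) mpoly set \<Rightarrow> ('n, 'a) laurent pps set" where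
  "closure_ideal w J = {g. \<forall>q. \<exists>\<gamma>. \<exists>f\<in>J. \<forall>e\<le>q. to_laurent (monom_x \<gamma>) * pps_nth g e = to_laurent (slice w e f)}"

lemma closure_idealE:
  assumes "g \<in> closure_ideal w J"
  obtains \<gamma> f where "f \<in> J"
    "\<And>e. e \<le> q \<Longrightarrow> to_laurent (monom_x \<gamma>) * pps_nth g e = to_laurent (slice w e f)"
proof -
  have "\<exists>\<gamma>. \<exists>f\<in>J. \<forall>e\<le>q. to_laurent (monom_x \<gamma>) * pps_nth g e = to_laurent (slice w e f)"
    using assms by (simp add: closure_ideal_def)
  then show ?thesis using that by metis
qed

context
  fixes J :: "('n::finite, 'a::field puiseux) mpoly set" and w :: "'n \<Rightarrow> rat"
  assumes J: "is_ideal J"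
begin

lemma is_ideal_closed:
  "0 \<in> J" "f \<in> J \<Longrightarrow> g \<in> J \<Longrightarrow> f + g \<in> J" "f \<in> J \<Longrightarrow> h * f \<in> J"
  using J by (auto simp: module.subspace_def[OF module_times])

lemma is_ideal_sum: "(\<And>i. i \<in> S \<Longrightarrow> f i \<in> J) \<Longrightarrow> sum f S \<in> J"
  by (induction S rule: infinite_finite_induct) (auto simp: is_ideal_closed)

lemma closure_ideal_shift:
  assumes "f \<in> J" "\<And>e. pps_nth g e = to_laurent (slice w (e - a) f)"
  shows "g \<in> closure_ideal w J"
proof -
  have "to_laurent (monom_x 0) * pps_nth g e = to_laurent (slice w e (twisted w a 1 * f))" for e
    using assms(2) by (simp add: slice_twisted_mult to_laurent_single)
  then show ?thesis unfolding closure_ideal_def using is_ideal_closed(3)[OF assms(1)] by blast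
qed

text \<open>In a product \<open>h * g\<close> only finitely many coefficients of \<open>h\<close> have an influence on the terms up to \<open>t\<^sup>q\<close>.
  These are Laurent polynomials with a common monomial denominator, so the truncated multiplication
  can be carried out in \<open>J\<close>.\<close>

lemma ideal_closure_ideal: "ideal_on UNIV (closure_ideal w J)"
  unfolding ideal_on_def
proof (intro conjI ballI)
  show "0 \<in> closure_ideal w J" by (rule closure_ideal_shift[OF is_ideal_closed(1), of _ 0]) simp
next
  fix g1 g2 assume g: "g1 \<in> closure_ideal w J" "g2 \<in> closure_ideal w J"
  show "g1 + g2 \<in> closure_ideal w J"
    unfolding closure_ideal_def
  proof (intro CollectI allI)
    fix q
    obtain \<gamma>1 f1 where f1: "f1 \<in> J"
      "\<And>e. e \<le> q \<Longrightarrow> to_laurent (monom_x \<gamma>1) * pps_nth g1 e = to_laurent (slice w e f1)"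
      using closure_idealE[OF g(1)] by metis
    obtain \<gamma>2 f2 where f2: "f2 \<in> J"
      "\<And>e. e \<le> q \<Longrightarrow> to_laurent (monom_x \<gamma>2) * pps_nth g2 e = to_laurent (slice w e f2)"
      using closure_idealE[OF g(2)] by metis
    define F where "F = twisted w 0 (monom_x \<gamma>2) * f1 + twisted w 0 (monom_x \<gamma>1) * f2"
    have "F \<in> J" unfolding F_def by (intro is_ideal_closed f1(1) f2(1))
    moreover have "to_laurent (monom_x (\<gamma>1 + \<gamma>2)) * pps_nth (g1 + g2) e = to_laurent (slice w e F)" if "e \<le> q" for e
    proof -
      have split: "(monom_x (\<gamma>1 + \<gamma>2) :: ('n, 'a) mpoly) = monom_x \<gamma>1 * monom_x \<gamma>2" by (simp add: mult_single)
      have "to_laurent (monom_x (\<gamma>1 + \<gamma>2)) * pps_nth (g1 + g2) e =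
          to_laurent (monom_x \<gamma>2) * (to_laurent (monom_x \<gamma>1) * pps_nth g1 e) +
          to_laurent (monom_x \<gamma>1) * (to_laurent (monom_x \<gamma>2) * pps_nth g2 e)"
        unfolding split to_laurent_mult nth_plus_pps by (simp only: algebra_simps)
      also have "\<dots> = to_laurent (slice w e F)"
        using that f1(2) f2(2) by (simp add: F_def slice_add slice_twisted_mult to_laurent_add to_laurent_mult)
      finally show ?thesis .
    qed
    ultimately show "\<exists>\<gamma>. \<exists>f\<in>J. \<forall>e\<le>q. to_laurent (monom_x \<gamma>) * pps_nth (g1 + g2) e = to_laurent (slice w e f)"
      by blast
  qed
next
  fix h g assume g: "g \<in> closure_ideal w J"
  show "h * g \<in> closure_ideal w J"
    unfolding closure_ideal_def
  proof (intro CollectI allI)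
    fix q
    obtain \<gamma> f where f: "f \<in> J"
      "\<And>e. e \<le> q \<Longrightarrow> to_laurent (monom_x \<gamma>) * pps_nth g e = to_laurent (slice w e f)"
      using closure_idealE[OF g] by metis
    define S where "S = {a. pps_nth h a \<noteq> 0 \<and> a \<le> q}"
    have S: "finite S" unfolding S_def by (rule finite_pps_support_below)
    have S_pos: "a \<ge> 0" if "a \<in> S" for a using that nth_neg_pps[of a h] by (force simp: S_def)
    obtain \<delta> where \<delta>: "\<And>x. x \<in> pps_nth h ` S \<Longrightarrow> \<exists>k. to_laurent (monom_x \<delta>) * x = to_laurent k"
      using clear_denominators[OF finite_imageI[OF S]] by blast
    then have "\<forall>a\<in>S. \<exists>k. to_laurent (monom_x \<delta>) * pps_nth h a = to_laurent k" by blast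
    then obtain k where k: "\<And>a. a \<in> S \<Longrightarrow> to_laurent (monom_x \<delta>) * pps_nth h a = to_laurent (k a)" by metis
    define F where "F = (\<Sum>a\<in>S. twisted w a (k a) * f)"
    have "F \<in> J" unfolding F_def by (intro is_ideal_sum is_ideal_closed f)
    moreover have "to_laurent (monom_x (\<delta> + \<gamma>)) * pps_nth (h * g) e = to_laurent (slice w e F)" if e: "e \<le> q" for e
    proof -
      have split: "(monom_x (\<delta> + \<gamma>) :: ('n, 'a) mpoly) = monom_x \<delta> * monom_x \<gamma>" by (simp add: mult_single)
      have "pps_nth (h * g) e = (\<Sum>a\<in>S. pps_nth h a * pps_nth g (e - a))"
      proof (rule nth_times_pps[OF S])
        fix a assume "pps_nth h a \<noteq> 0" "pps_nth g (e - a) \<noteq> 0"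
        moreover from this have "\<not> e - a < 0" using nth_neg_pps by blast
        ultimately show "a \<in> S" using e by (simp add: S_def)
      qed
      then have "to_laurent (monom_x (\<delta> + \<gamma>)) * pps_nth (h * g) e =
          (\<Sum>a\<in>S. (to_laurent (monom_x \<delta>) * pps_nth h a) * (to_laurent (monom_x \<gamma>) * pps_nth g (e - a)))"
        unfolding split to_laurent_mult by (simp add: sum_distrib_left mult_ac)
      also have "\<dots> = (\<Sum>a\<in>S. to_laurent (k a) * to_laurent (slice w (e - a) f))"
      proof (rule sum.cong)
        fix a assume a: "a \<in> S"
        then have "e - a \<le> q" using e S_pos[OF a] by simp
        then show "(to_laurent (monom_x \<delta>) * pps_nth h a) * (to_laurent (monom_x \<gamma>) * pps_nth g (e - a)) =
            to_laurent (k a) * to_laurent (slice w (e - a) f)"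
          using k[OF a] f(2) by simp
      qed simp
      also have "\<dots> = to_laurent (slice w e F)"
        by (simp add: F_def slice_sum slice_twisted_mult to_laurent_sum to_laurent_mult)
      finally show ?thesis .
    qed
    ultimately show "\<exists>\<gamma>. \<exists>f\<in>J. \<forall>e\<le>q. to_laurent (monom_x \<gamma>) * pps_nth (h * g) e = to_laurent (slice w e f)"
      by blast
  qed
qed simp

text \<open>If \<open>1\<close> were approximated to order \<open>0\<close>, some element of \<open>J\<close> would have a monomial as its first
  non-zero slice, that is, as its initial form.\<close>

lemma one_notin_closure_ideal:
  assumes \<omega>: "\<And>i. \<omega> $ i = of_rat (w i)" and "\<omega> \<in> Trop J"
  shows "1 \<notin> closure_ideal w J"
proof
  assume "1 \<in> closure_ideal w J"
  then obtain \<gamma> f where f: "f \<in> J"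
    "\<And>e. e \<le> 0 \<Longrightarrow> to_laurent (monom_x \<gamma>) * pps_nth 1 e = to_laurent (slice w e f)"
    using closure_idealE by metis
  have slice_0: "slice w 0 f = monom_x \<gamma>"
    using f(2)[of 0] by (intro to_laurent_inject) (simp add: nth_one_pps)
  have slice_neg: "slice w e f = 0" if "e < 0" for e
    using f(2)[of e] that by (intro to_laurent_inject) (simp add: nth_one_pps)
  have "(monom_x \<gamma> :: ('n, 'a) mpoly) \<noteq> 0" by (metis lookup_single_eq lookup_zero zero_neq_one)
  then have "t_in \<omega> f = monom_x \<gamma>"
    using t_in_slice[OF \<omega>, of 0 f] slice_neg by (simp add: slice_0)
  then have "monom_x \<gamma> \<in> t_in_ideal \<omega> J"
    unfolding t_in_ideal_def using f(1) by (metis module.span_base[OF module_times] imageI)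
  then show False using assms(2) by (simp add: Trop_def)
qed

lemma saturated_closure_ideal:
  assumes "q0 \<ge> 0" "pps_t q0 * x \<in> closure_ideal w J"
  shows "x \<in> closure_ideal w J"
  unfolding closure_ideal_def
proof (intro CollectI allI)
  fix q
  obtain \<gamma> f where f: "f \<in> J"
    "\<And>e. e \<le> q + q0 \<Longrightarrow> to_laurent (monom_x \<gamma>) * pps_nth (pps_t q0 * x) e = to_laurent (slice w e f)"
    using closure_idealE[OF assms(2)] by metis
  have "to_laurent (monom_x \<gamma>) * pps_nth x e = to_laurent (slice w e (twisted w (- q0) 1 * f))" if "e \<le> q" for e
    using f(2)[of "e + q0"] that assms(1) by (simp add: slice_twisted_mult)
  then show "\<exists>\<gamma>. \<exists>f\<in>J. \<forall>e\<le>q. to_laurent (monom_x \<gamma>) * pps_nth x e = to_laurent (slice w e f)"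
    using is_ideal_closed(3)[OF f(1)] by blast
qed

end

section \<open>Points of the tropical variety lift to zeros\<close>

lemma to_laurent_monom_prod:
  "to_laurent (monom_x \<beta>) = (\<Prod>i\<in>UNIV. (to_laurent (monom_x (Poly_Mapping.single i 1)) :: ('n::finite, 'a::field) laurent) ^ Poly_Mapping.lookup \<beta> i)"
proof -
  have pow: "(Poly_Mapping.single \<nu> 1 :: ('n, 'a) laurent) ^ k = Poly_Mapping.single (\<Sum>j<k. \<nu>) 1" for \<nu> k
    by (induction k) (auto simp: mult_single add.commute)
  have prod: "(\<Prod>i\<in>S. (Poly_Mapping.single (\<nu> i) 1 :: ('n, 'a) laurent)) = Poly_Mapping.single (\<Sum>i\<in>S. \<nu> i) 1" for \<nu> and S :: "'n set"
    by (induction S rule: infinite_finite_induct) (auto simp: mult_single)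
  have "int_exps \<beta> = (\<Sum>i\<in>UNIV. \<Sum>j<Poly_Mapping.lookup \<beta> i. int_exps (Poly_Mapping.single i 1))"
  proof (rule poly_mapping_eqI)
    fix l
    have "(\<Sum>i\<in>UNIV. int (Poly_Mapping.lookup \<beta> i) * int (Poly_Mapping.lookup (Poly_Mapping.single i (1::nat)) l)) =
        (\<Sum>i\<in>UNIV. if i = l then int (Poly_Mapping.lookup \<beta> l) else 0)"
      by (rule sum.cong) (auto simp: lookup_single when_def)
    then show "Poly_Mapping.lookup (int_exps \<beta>) l =
        Poly_Mapping.lookup (\<Sum>i\<in>UNIV. \<Sum>j<Poly_Mapping.lookup \<beta> i. int_exps (Poly_Mapping.single i 1)) l"
      by (simp add: lookup_sum)
  qed
  then show ?thesis by (simp add: to_laurent_single pow prod)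
qed

lemma hom_on_prod:
  assumes "hom_on A h" "subring A" "\<And>i. i \<in> S \<Longrightarrow> f i \<in> A"
  shows "h (prod f S) = (\<Prod>i\<in>S. h (f i)) \<and> prod f S \<in> A"
  using assms(3)
  by (induction S rule: infinite_finite_induct)
    (auto simp: hom_onD[OF assms(1,2)] subringD[OF assms(2)])

text \<open>Among the generators of the Laurent polynomials are the variables and their inverses, so a point
  with coordinates in the valuation ring has units as coordinates. It is a zero of the substituted
  polynomials; undoing the substitution multiplies the coordinates by powers of \<open>t\<close> and gives a zero
  of \<open>J\<close> with the required valuations.\<close>

lemma Trop_imp_zero:
  fixes J :: "('n::finite, 'k::{alg_closed_field, field_char_0} puiseux) mpoly set" and \<omega> :: "real ^ 'n"
  assumes J: "is_ideal J" and \<omega>: "\<And>i. \<omega> $ i = of_rat (w i)" "\<omega> \<in> Trop J"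
  obtains p where "p \<in> zero_set J" "\<And>i. - pval (p $ i) = ereal (\<omega> $ i)"
proof -
  define \<kappa> :: "'k \<Rightarrow> ('n, 'k) laurent" where "\<kappa> = Poly_Mapping.single 0"
  have \<kappa>: "hom_on UNIV \<kappa>" by (simp add: hom_on_def \<kappa>_def single_add mult_single)
  define X Y :: "'n \<Rightarrow> ('n, 'k) laurent" where
    "X = (\<lambda>i. to_laurent (monom_x (Poly_Mapping.single i 1)))" and
    "Y = (\<lambda>i. Poly_Mapping.single (- int_exps (Poly_Mapping.single i 1)) 1)"
  have XY: "X i * Y i = 1" for i by (simp add: X_def Y_def to_laurent_single mult_single)
  obtain ns :: "'n list" where ns: "set ns = UNIV" using finite_list[of "UNIV :: 'n set"] by auto
  define gs where "gs = map X ns @ map Y ns"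
  define A where "A = gen_alg \<kappa> gs"
  have A: "subring A" unfolding A_def by (rule subring_gen_alg[OF \<kappa>])
  have XA: "X i \<in> A" and YA: "Y i \<in> A" and \<kappa>A: "\<kappa> c \<in> A" for i c
    using set_gen_alg[OF \<kappa>, of gs] range_gen_alg[OF \<kappa>, of _ gs] ns by (auto simp: A_def gs_def)
  note T = subring_pps_over[OF A]
  note Ts = subringD[OF T]
  define I where "I = closure_ideal w J \<inter> pps_over A"
  have UNIV: "subring (UNIV :: ('n, 'k) laurent pps set)" by (simp add: subring_def)
  note Cs = ideal_onD[OF ideal_closure_ideal[OF J, of w] UNIV]
  have "ideal_on (pps_over A) I" unfolding I_def ideal_on_def using Cs Ts by auto
  moreover have "1 \<notin> I" using one_notin_closure_ideal[OF J \<omega>] by (simp add: I_def)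
  moreover have "t_saturated (pps_over A) I"
    unfolding t_saturated_def I_def using saturated_closure_ideal[OF J] by auto
  ultimately obtain \<psi> where \<psi>: "hom_on (pps_over A) \<psi>" "\<And>x. x \<in> I \<Longrightarrow> \<psi> x = 0"
    "\<And>x. x \<in> pps_over A \<Longrightarrow> \<psi> x \<in> puiseux_O" "\<And>h. \<psi> (pps_map \<kappa> h) = puiseux_emb h"
    using affinoid_nullstellensatz[OF \<kappa>, of gs I] unfolding A_def by metis
  note \<psi>s = hom_onD[OF \<psi>(1) T]
  note XT = pps_const_over[OF A XA] and YT = pps_const_over[OF A YA]
  define u where "u = (\<lambda>i. \<psi> (pps_const (X i)))"
  have u: "u i \<in> puiseux_O" for i unfolding u_def by (rule \<psi>(3)[OF XT])
  have u_unit: "puiseux_nth (u i) 0 \<noteq> 0" for i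
  proof
    assume 0: "puiseux_nth (u i) 0 = 0"
    have "u i * \<psi> (pps_const (Y i)) = \<psi> (pps_const (X i * Y i))"
      using \<psi>s(4)[OF XT YT] by (simp add: u_def)
    also have "\<dots> = 1" by (simp add: XY \<psi>s)
    finally have "puiseux_nth (u i * \<psi> (pps_const (Y i))) 0 = 1" by (simp add: puiseux_nth_one)
    then show False using puiseux_res_mult[OF u \<psi>(3)[OF YT]] 0 by simp
  qed
  define p where "p = (\<chi> i. tpow (- w i) * u i)"
  have p: "p $ i = tpow (- w i) * u i" for i by (simp add: p_def)
  have "mpoly_eval f p = 0" if f: "f \<in> J" for f
  proof (cases "f = 0")
    case True
    then show ?thesis by (simp add: mpoly_eval_def)
  next
    case False
    then obtain m where m: "\<And>e. e < m \<Longrightarrow> slice w e f = 0" using least_slice by metis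
    let ?K = "Poly_Mapping.keys f"
    \<comment> \<open>The coefficients of \<open>f\<close> after the substitution, scaled by a power of \<open>t\<close> into the valuation ring.\<close>
    define c where "c = (\<lambda>\<beta>. tpow (- m) * (tpow (- rwt w \<beta>) * Poly_Mapping.lookup f \<beta>))"
    have nth_c: "puiseux_nth (c \<beta>) e = Poly_Mapping.lookup (slice w (e + m) f) \<beta>" for \<beta> e
      by (simp add: c_def puiseux_nth_tpow_times lookup_slice)
    have "c \<beta> \<in> puiseux_O" for \<beta> by (simp add: puiseux_O_def nth_c m)
    then have "\<forall>\<beta>. \<exists>b. c \<beta> = puiseux_emb b \<and> pps_nth b = puiseux_nth (c \<beta>)" by (metis puiseux_O_emb)
    then obtain b where b: "\<And>\<beta>. c \<beta> = puiseux_emb (b \<beta>)" "\<And>\<beta>. pps_nth (b \<beta>) = puiseux_nth (c \<beta>)" by metis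
    define g where "g = (\<Sum>\<beta>\<in>?K. pps_map \<kappa> (b \<beta>) * pps_const (to_laurent (monom_x \<beta>)))"
    have \<kappa>0: "\<kappa> 0 = 0" by (simp add: \<kappa>_def)
    have "pps_nth g e = to_laurent (slice w (e - (- m)) f)" for e
    proof -
      have "pps_nth g e = (\<Sum>\<beta>\<in>?K. to_laurent (monom_x \<beta>) * \<kappa> (puiseux_nth (c \<beta>) e))"
        by (simp add: g_def nth_pps_sum mult.commute[of "pps_map \<kappa> _"] nth_pps_map \<kappa>0 b(2))
      also have "\<dots> = (\<Sum>\<beta>\<in>?K. Poly_Mapping.single (int_exps \<beta>) (Poly_Mapping.lookup (slice w (e + m) f) \<beta>))"
        by (simp add: \<kappa>_def to_laurent_single mult_single nth_c)
      also have "\<dots> = to_laurent (slice w (e + m) f)"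
        unfolding to_laurent_def
        by (rule on_terms_superset[symmetric]) (auto simp: in_keys_iff lookup_slice)
      finally show ?thesis by simp
    qed
    then have g_closure: "g \<in> closure_ideal w J" by (rule closure_ideal_shift[OF J f])
    have mapT: "pps_map \<kappa> h \<in> pps_over A" for h
      using \<kappa>A by (simp add: pps_over_def nth_pps_map \<kappa>0)
    have monom: "\<psi> (pps_const (to_laurent (monom_x \<beta>))) = (\<Prod>i\<in>UNIV. u i ^ Poly_Mapping.lookup \<beta> i)"
      "pps_const (to_laurent (monom_x \<beta>)) \<in> pps_over A" for \<beta>
    proof -
      have const_prod: "pps_const (prod h S) = (\<Prod>i\<in>S. pps_const (h i))" for h :: "'n \<Rightarrow> ('n, 'k) laurent" and S
        by (induction S rule: infinite_finite_induct) auto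
      have "pps_const (to_laurent (monom_x \<beta>)) = (\<Prod>i\<in>UNIV. pps_const (X i) ^ Poly_Mapping.lookup \<beta> i)"
        by (subst to_laurent_monom_prod) (simp add: const_prod pps_const_power X_def)
      then show "\<psi> (pps_const (to_laurent (monom_x \<beta>))) = (\<Prod>i\<in>UNIV. u i ^ Poly_Mapping.lookup \<beta> i)"
        "pps_const (to_laurent (monom_x \<beta>)) \<in> pps_over A"
        using hom_on_prod[OF \<psi>(1) T, of UNIV "\<lambda>i. pps_const (X i) ^ Poly_Mapping.lookup \<beta> i"]
        by (simp_all add: Ts(7) XT \<psi>s(7) u_def)
    qed
    have "g \<in> pps_over A" unfolding g_def by (intro subring_sum[OF T] Ts(6) mapT monom(2))
    then have "0 = \<psi> g" using \<psi>(2) g_closure by (simp add: I_def)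
    also have "\<dots> = (\<Sum>\<beta>\<in>?K. \<psi> (pps_map \<kappa> (b \<beta>) * pps_const (to_laurent (monom_x \<beta>))))"
      unfolding g_def by (rule hom_on_sum[OF \<psi>(1) T]) (intro Ts(6) mapT monom(2))
    also have "\<dots> = (\<Sum>\<beta>\<in>?K. c \<beta> * (\<Prod>i\<in>UNIV. u i ^ Poly_Mapping.lookup \<beta> i))"
      by (simp add: \<psi>s(4) mapT monom \<psi>(4) b(1))
    also have "\<dots> = tpow (- m) * mpoly_eval f p"
      unfolding mpoly_eval_tpow_times[of p w u, OF p] c_def by (simp add: sum_distrib_left mult.assoc)
    finally show ?thesis by simp
  qed
  then have "p \<in> zero_set J" by (simp add: zero_set_def)
  moreover have "- pval (p $ i) = ereal (\<omega> $ i)" for i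
    unfolding p pval_tpow_unit[OF u u_unit] by (simp add: \<omega>(1) of_rat_minus)
  ultimately show ?thesis using that by blast
qed

theorem theorem2p13:
  fixes J :: "('n::finite, 'k::{alg_closed_field, field_char_0} puiseux) mpoly set"
    and \<omega> :: "real ^ 'n"
  assumes "is_ideal J"
  shows "\<omega> \<in> Trop J \<inter> {v. \<forall>i. v $ i \<in> \<rat>} \<longleftrightarrow>
    (\<exists>p\<in>zero_set J. (\<forall>i. - pval (p $ i) = ereal (\<omega> $ i)) \<and> \<omega> \<in> {v. \<forall>i. v $ i \<in> \<rat>})"
proof
  assume \<omega>: "\<omega> \<in> Trop J \<inter> {v. \<forall>i. v $ i \<in> \<rat>}"
  then have "\<forall>i. \<exists>r. \<omega> $ i = of_rat r" by (auto elim: Rats_cases)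
  then obtain w where w: "\<And>i. \<omega> $ i = of_rat (w i)" by metis
  obtain p where "p \<in> zero_set J" "\<And>i. - pval (p $ i) = ereal (\<omega> $ i)"
    using Trop_imp_zero[OF assms w] \<omega> by blast
  then show "\<exists>p\<in>zero_set J. (\<forall>i. - pval (p $ i) = ereal (\<omega> $ i)) \<and> \<omega> \<in> {v. \<forall>i. v $ i \<in> \<rat>}"
    using \<omega> by blast
next
  assume "\<exists>p\<in>zero_set J. (\<forall>i. - pval (p $ i) = ereal (\<omega> $ i)) \<and> \<omega> \<in> {v. \<forall>i. v $ i \<in> \<rat>}"
  then show "\<omega> \<in> Trop J \<inter> {v. \<forall>i. v $ i \<in> \<rat>}" using zero_imp_Trop by blast
qed

end
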